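(* Let $d\ge 1$ be an integer and let $\mathcal{A}=\mathcal{M}(2d,\mathbb{R}^2)=\mathcal{M}(2d,\mathbb{R})\times\mathcal{M}(2d,\mathbb{R})$, with unit $(\mathbf{1},\mathbf{1})$ and $\omega=(\mathbf{1},-\mathbf{1})$. Then: (1) The square roots of $(-\mathbf{1},-\mathbf{1})$ in $\mathcal{A}$ constitute a unique conjugacy class, which is a submanifold with exactly four connected components (the same number as $\mathrm{G}(\mathcal{A})$), of dimension $4d^2=\dim_{\mathbb{R}}(\mathcal{A})/2$. Every square root $(f,f')$ of $(-\mathbf{1},-\mathbf{1})$ satisfies $\mathrm{Scal}(f,f')=\mathrm{Spec}(f,f')=0$. (2) The group $\mathrm{Aut}(\mathcal{A})$ has eight connected components, and it permutes the four connected components of the manifold of square roots of $(-\mathbf{1},-\mathbf{1})$. The permutations induced by $\mathrm{Inn}(\mathcal{A})$ are those of the Klein group (the identity and the three products of two disjoint transpositions). (3) The automorphisms outside $\mathrm{Inn}(\mathcal{A})$ are the maps $(f,f')\mapsto(gf'g^{-1},\,g'fg'^{-1})$ with $(g,g')\in\mathrm{G}(\mathcal{A})$. If $\det(g)$ and $\det(g')$ have opposite signs, such an automorphism induces a circular permutation (a $4$-cycle) of the four components; if they have the same sign, it leaves two components globally invariant and interchanges the other two. (4) The quotient of $\mathrm{Aut}(\mathcal{A})$ by its neutral connected component is isomorphic to the group of isometries of a square in a Euclidean plane.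
   Context: $\mathbf{1}$ is the unit matrix of $\mathcal{M}(2d,\mathbb{R})$. $\mathrm{G}(\mathcal{A})$ is the group of invertible elements of $\mathcal{A}$; $\mathrm{Aut}(\mathcal{A})$ is the group of all automorphisms of the real algebra $\mathcal{A}$, and $\mathrm{Inn}(\mathcal{A})$ is its subgroup of inner automorphisms $x\mapsto a^{-1}xa$, $a\in\mathrm{G}(\mathcal{A})$. Conjugacy classes are the orbits of $\mathrm{Inn}(\mathcal{A})$ in $\mathcal{A}$. All these objects carry their usual (finite-dimensional real) topology; the neutral connected component is the one containing the identity. The center $\mathrm{Z}(\mathcal{A})$ is spanned over $\mathbb{R}$ by $(\mathbf{1},\mathbf{1})$ and $\omega$, and $\mathcal{A}=\mathrm{Z}(\mathcal{A})\oplus[\mathcal{A},\mathcal{A}]$, where $[\mathcal{A},\mathcal{A}]$ is the span of all commutators. The linear forms $\mathrm{Scal},\mathrm{Spec}:\mathcal{A}\to\mathbb{R}$ are defined by: $\mathrm{Scal}(x)(\mathbf{1},\mathbf{1})+\mathrm{Spec}(x)\,\omega$ is the projection of $x$ onto $\mathrm{Z}(\mathcal{A})$ along $[\mathcal{A},\mathcal{A}]$. *)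

theory Defs
  imports "HOL-Analysis.Analysis" "HOL-Algebra.Coset"
begin

text \<open>The times instance of the type \<open>real^'n^'n\<close> is entrywise, hence a separate product symbol.\<close>

type_synonym 'n alg = "(real^'n^'n) \<times> (real^'n^'n)"

definition amult :: "'n::finite alg \<Rightarrow> 'n alg \<Rightarrow> 'n alg"  (infixl "\<star>" 70) where
  "x \<star> y = (fst x ** fst y, snd x ** snd y)"

definition aone :: "'n::finite alg" where
  "aone = (mat 1, mat 1)"

definition omega :: "'n::finite alg" where
  "omega = (mat 1, - mat 1)"

definition GA :: "'n::finite alg set" where
  "GA = {a. \<exists>b. a \<star> b = aone \<and> b \<star> a = aone}"

definition sqrt_set :: "'n::finite alg set" where
  "sqrt_set = {x. x \<star> x = - aone}"

definition center :: "'n::finite alg set" where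
  "center = {z. \<forall>x. z \<star> x = x \<star> z}"

definition commutator_space :: "'n::finite alg set" where
  "commutator_space = span {x \<star> y - y \<star> x | x y. True}"

definition center_proj :: "'n::finite alg \<Rightarrow> 'n alg" where
  "center_proj x = (THE z. z \<in> center \<and> x - z \<in> commutator_space)"

definition Scal :: "'n::finite alg \<Rightarrow> real" where
  "Scal x = (THE s. \<exists>t. center_proj x = s *\<^sub>R aone + t *\<^sub>R omega)"

definition Spec :: "'n::finite alg \<Rightarrow> real" where
  "Spec x = (THE t. \<exists>s. center_proj x = s *\<^sub>R aone + t *\<^sub>R omega)"

text \<open>Every linear endomorphism of a finite-dimensional space is bounded, so automorphisms are
  taken in the normed space of bounded linear maps, whose topology is the usual one.\<close>

definition Aut :: "('n::finite alg \<Rightarrow>\<^sub>L 'n alg) set" where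
  "Aut = {\<phi>. bij (blinfun_apply \<phi>) \<and> blinfun_apply \<phi> aone = aone \<and>
             (\<forall>x y. blinfun_apply \<phi> (x \<star> y) = blinfun_apply \<phi> x \<star> blinfun_apply \<phi> y)}"

definition Inn :: "('n::finite alg \<Rightarrow>\<^sub>L 'n alg) set" where
  "Inn = {\<phi>. \<exists>a b. a \<star> b = aone \<and> b \<star> a = aone \<and> (\<forall>x. blinfun_apply \<phi> x = b \<star> x \<star> a)}"

definition Aut_group :: "('n::finite alg \<Rightarrow>\<^sub>L 'n alg) monoid" where
  "Aut_group = \<lparr>carrier = Aut, mult = (o\<^sub>L), one = id_blinfun\<rparr>"

definition neutral_component :: "('n::finite alg \<Rightarrow>\<^sub>L 'n alg) set" where
  "neutral_component = connected_component_set Aut id_blinfun"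

definition conj_class :: "'n::finite alg \<Rightarrow> 'n alg set" where
  "conj_class x = {blinfun_apply \<phi> x | \<phi>. \<phi> \<in> Inn}"

definition swap_conj :: "real^'n^'n \<Rightarrow> real^'n^'n \<Rightarrow> 'n::finite alg \<Rightarrow> 'n alg" where
  "swap_conj g g' = (\<lambda>(f, f'). (g ** f' ** matrix_inv g, g' ** f ** matrix_inv g'))"

text \<open>Extended by the identity, as required by \<open>permutes\<close>.\<close>

definition component_perm :: "('n::finite alg \<Rightarrow> 'n alg) \<Rightarrow> 'n alg set \<Rightarrow> 'n alg set" where
  "component_perm f C = (if C \<in> components sqrt_set then f ` C else C)"

definition klein_perms :: "'a set \<Rightarrow> ('a \<Rightarrow> 'a) set" where
  "klein_perms S = insert id
     {Transposition.transpose a b \<circ> Transposition.transpose c e | a b c e.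
        distinct [a, b, c, e] \<and> {a, b, c, e} \<subseteq> S}"

text \<open>\<open>Ck_on k f U\<close> is meant for open \<open>U\<close>; quantifying over all directions \<open>v\<close> is, in finite
  dimension, the same as requiring the total derivative to be of class \<open>C\<^sup>k\<close>.\<close>

primrec Ck_on :: "nat \<Rightarrow> ('a::euclidean_space \<Rightarrow> 'b::real_normed_vector) \<Rightarrow> 'a set \<Rightarrow> bool" where
  "Ck_on 0 f U \<longleftrightarrow> continuous_on U f"
| "Ck_on (Suc k) f U \<longleftrightarrow> (\<forall>x\<in>U. f differentiable (at x)) \<and>
     (\<forall>v. Ck_on k (\<lambda>x. frechet_derivative f (at x) v) U)"

definition smooth_on :: "('a::euclidean_space \<Rightarrow> 'b::real_normed_vector) \<Rightarrow> 'a set \<Rightarrow> bool" where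
  "smooth_on f U \<longleftrightarrow> (\<forall>k. Ck_on k f U)"

definition submanifold :: "nat \<Rightarrow> 'a::euclidean_space set \<Rightarrow> bool" where
  "submanifold k S \<longleftrightarrow> (\<forall>p\<in>S. \<exists>U V (h :: 'a \<Rightarrow> 'a) h' (L :: 'a set).
     open U \<and> p \<in> U \<and> open V \<and> homeomorphism U V h h' \<and> smooth_on h U \<and> smooth_on h' V \<and>
     subspace L \<and> dim L = k \<and> h ` (S \<inter> U) = V \<inter> L)"

definition is_square :: "(real^2) set \<Rightarrow> bool" where
  "is_square Q \<longleftrightarrow> (\<exists>c u v. u \<noteq> 0 \<and> norm u = norm v \<and> inner u v = 0 \<and>
     Q = convex hull {c + u, c + v, c - u, c - v})"

definition isometry_group :: "(real^2) set \<Rightarrow> (real^2 \<Rightarrow> real^2) monoid" where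
  "isometry_group Q =
     \<lparr>carrier = {f. bij f \<and> (\<forall>x y. dist (f x) (f y) = dist x y) \<and> f ` Q = Q},
      mult = (\<circ>), one = id\<rparr>"

end

theory Submission
  imports Defs
begin

text \<open>Over \<open>\<complex>\<close> a complex structure splits a commuting real matrix into a block and its
  conjugate, so real matrices commuting with a square root \<open>J\<close> of \<open>-1\<close> have nonnegative determinant.
  Hence the single conjugacy class of such \<open>J\<close> in \<open>M(2d, \<real>)\<close> breaks up into exactly two pieces,
  according to the sign of the determinant of the conjugating matrix; each piece is connected because
  \<open>GL\<^sup>+\<close> and \<open>GL\<^sup>-\<close> are, and open because nearby square roots are conjugate by a matrix
  close to the identity. The square roots in \<open>\<A>\<close> thus form four components, labelled by two signs.
  An automorphism is a conjugation, possibly preceded by the exchange of the factors. It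
  acts on the labels as a signed permutation, and this action identifies the component group of
  \<open>Aut(\<A>)\<close> with the symmetries of a square.\<close>

subsection \<open>Connectedness of the general linear group\<close>

text \<open>The conjugators \<open>(g, g')\<close> of an automorphism are determined only up to
  nonzero scalars, so the signs of their determinants must be shown to depend on the automorphism
  alone. They are read off from the image of one fixed square root \<open>(J, J)\<close>: the sign
  classes of conjugators give disjoint orbits of \<open>J\<close>. The exchange of the factors is
  read off from the image of \<open>omega\<close>. Both evaluations are continuous in the
  automorphism, so they separate the eight classes and show each of them to be open; connectedness
  comes from the parametrisation by conjugators. The square is best seen with vertices
  \<open>c + u\<close>, \<open>c + v\<close>, \<open>c - u\<close>, \<open>c - v\<close>: in
  coordinates along \<open>u\<close> and \<open>v\<close> its symmetries are the signed
  permutations, composed by the same rule as automorphisms. A label \<open>(s, t)\<close> is then a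
  quadrant, hence a side of this square and not a vertex. The dimension and the vanishing of
  \<open>Scal\<close> and \<open>Spec\<close> share one source: \<open>j\<close> and
  \<open>-j\<close> are conjugate, so some invertible element anticommutes with
  \<open>j\<close>.\<close>

lemma matrix_inv_works:
  fixes A :: "'a::field^'n^'n"
  assumes "det A \<noteq> 0"
  shows "A ** matrix_inv A = mat 1" "matrix_inv A ** A = mat 1"
proof -
  have "\<exists>B. A ** B = mat 1 \<and> B ** A = mat 1"
    using assms invertible_det_nz[of A] unfolding invertible_def by blast
  from someI_ex[OF this] show "A ** matrix_inv A = mat 1" "matrix_inv A ** A = mat 1"
    unfolding matrix_inv_def by auto
qed

lemma right_inverse_det_nz:
  fixes A :: "'a::field^'n^'n"
  assumes "A ** B = mat 1"
  shows "det A \<noteq> 0" "det B \<noteq> 0"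
proof -
  have "det A * det B = 1" using assms by (metis det_mul det_I)
  then show "det A \<noteq> 0" "det B \<noteq> 0" by auto
qed

lemma matrix_inv_unique:
  fixes A :: "'a::field^'n^'n"
  assumes "A ** B = mat 1"
  shows "matrix_inv A = B"
  by (metis assms matrix_inv_works(2) matrix_mul_assoc matrix_mul_lid matrix_mul_rid right_inverse_det_nz(1))

lemma det_matrix_inv:
  fixes A :: "'a::field^'n^'n"
  assumes "det A \<noteq> 0"
  shows "det (matrix_inv A) = inverse (det A)"
proof -
  have "det A * det (matrix_inv A) = 1" using matrix_inv_works(1)[OF assms] by (metis det_mul det_I)
  then show ?thesis using assms by (metis inverse_unique)
qed

lemma matrix_inv_mult:
  fixes A B :: "'a::field^'n^'n"
  assumes "det A \<noteq> 0" "det B \<noteq> 0"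
  shows "matrix_inv (A ** B) = matrix_inv B ** matrix_inv A"
proof (rule matrix_inv_unique)
  have "A ** B ** (matrix_inv B ** matrix_inv A) = A ** (B ** matrix_inv B) ** matrix_inv A"
    by (simp add: matrix_mul_assoc)
  then show "A ** B ** (matrix_inv B ** matrix_inv A) = mat 1"
    using assms by (simp add: matrix_inv_works)
qed

lemma matrix_add_rdistrib: "(A + B) ** C = A ** C + B ** (C :: 'a::semiring_1^'k^'m)"
  by (vector matrix_matrix_mult_def sum.distrib[symmetric] algebra_simps)

lemma matrix_diff_ldistrib: "A ** (B - C) = A ** B - A ** (C :: 'a::ring_1^'k^'m)"
  by (vector matrix_matrix_mult_def sum_subtractf[symmetric] algebra_simps)

lemma matrix_diff_rdistrib: "(A - B) ** C = A ** C - B ** (C :: 'a::ring_1^'k^'m)"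
  by (vector matrix_matrix_mult_def sum_subtractf[symmetric] algebra_simps)

lemma matrix_minus_left: "(- A) ** B = - (A ** (B :: 'a::ring_1^'k^'m))"
  by (vector matrix_matrix_mult_def sum_negf)

lemma matrix_minus_right: "A ** (- B) = - (A ** (B :: 'a::ring_1^'k^'m))"
  by (vector matrix_matrix_mult_def sum_negf)

lemmas matrix_ring_simps = matrix_add_ldistrib matrix_add_rdistrib matrix_diff_ldistrib
  matrix_diff_rdistrib matrix_minus_left matrix_minus_right matrix_mul_assoc

lemma bounded_bilinear_matrix_mult:
  "bounded_bilinear ((**) :: real^'m^'n \<Rightarrow> real^'k^'m \<Rightarrow> real^'k^'n)"
  unfolding bilinear_conv_bounded_bilinear[symmetric] bilinear_def
  by (auto intro!: linearI simp: matrix_add_ldistrib matrix_add_rdistrib scalar_matrix_assoc matrix_scalar_ac)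

lemma continuous_on_matrix_mult [continuous_intros]:
  fixes f :: "'a::topological_space \<Rightarrow> real^'m^'n" and g :: "'a \<Rightarrow> real^'k^'m"
  assumes "continuous_on S f" "continuous_on S g"
  shows "continuous_on S (\<lambda>x. f x ** g x)"
  by (rule bounded_bilinear.continuous_on[OF bounded_bilinear_matrix_mult assms])

lemma continuous_on_det [continuous_intros]:
  fixes f :: "'a::topological_space \<Rightarrow> real^'n^'n"
  assumes "continuous_on S f"
  shows "continuous_on S (\<lambda>x. det (f x))"
  unfolding det_def by (intro continuous_intros assms)

text \<open>Cramer's rule for column \<open>l\<close> of the identity. Entries of the inverse become
  quotients of polynomials in the entries of \<open>A\<close>, which is what makes inversion
  continuous.\<close>

lemma matrix_inv_cramer:
  fixes A :: "'a::field^'n^'n"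
  assumes "det A \<noteq> 0"
  shows "matrix_inv A $ k $ l = det (\<chi> i j. if j = k then mat 1 $ i $ l else A $ i $ j) / det A"
proof -
  let ?x = "\<chi> m. matrix_inv A $ m $ l"
  have "A *v ?x = (\<chi> m. (A ** matrix_inv A) $ m $ l)"
    by (simp add: matrix_vector_mult_def matrix_matrix_mult_def)
  then have "A *v ?x = (\<chi> m. mat 1 $ m $ l)"
    by (simp add: matrix_inv_works assms)
  then have "?x = (\<chi> k. det (\<chi> i j. if j = k then (\<chi> m. mat 1 $ m $ l) $ i else A $ i $ j) / det A)"
    by (rule cramer[OF assms, THEN iffD1])
  then have "?x $ k = det (\<chi> i j. if j = k then mat 1 $ i $ l else A $ i $ j) / det A"
    by (simp cong: if_cong)
  then show ?thesis by simp
qed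

lemma continuous_on_matrix_inv:
  fixes f :: "'a::topological_space \<Rightarrow> real^'n^'n"
  assumes f: "continuous_on S f" and nz: "\<And>x. x \<in> S \<Longrightarrow> det (f x) \<noteq> 0"
  shows "continuous_on S (\<lambda>x. matrix_inv (f x))"
proof -
  \<comment> \<open>The test \<open>j = k\<close> in Cramer's matrix does not involve the variable,
    so each branch can be treated separately.\<close>
  have if_cont: "continuous_on S (\<lambda>x. if P then c else g x)" if "continuous_on S g" for P and c :: real and g
    using that by (cases P) auto
  have "continuous_on S (\<lambda>x. \<chi> k l. det (\<chi> i j. if j = k then mat 1 $ i $ l else f x $ i $ j) / det (f x))"
    by (auto intro!: continuous_intros f if_cont simp: nz)
  moreover have "matrix_inv (f x) = (\<chi> k l. det (\<chi> i j. if j = k then mat 1 $ i $ l else f x $ i $ j) / det (f x))"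
    if "x \<in> S" for x
    using matrix_inv_cramer[OF nz[OF that]] by (simp add: vec_eq_iff)
  ultimately show ?thesis by (simp cong: continuous_on_cong)
qed

text \<open>The Householder matrix \<open>1 - 2 u u^T\<close>: for a unit vector \<open>u\<close>,
  the reflection in the hyperplane orthogonal to \<open>u\<close>.\<close>

definition reflection_matrix :: "real^'n \<Rightarrow> real^'n^'n" where
  "reflection_matrix u = (\<chi> i j. of_bool (i = j) - 2 * u $ i * u $ j)"

lemma reflection_matrix_square:
  fixes u :: "real^'n"
  assumes "norm u = 1"
  shows "reflection_matrix u ** reflection_matrix u = mat 1"
proof -
  have 1: "(\<Sum>k\<in>UNIV. u $ k * u $ k) = 1"
    using assms by (simp add: norm_eq_sqrt_inner inner_vec_def)
  have "(\<Sum>k\<in>UNIV. (of_bool (i = k) - 2 * u $ i * u $ k) * (of_bool (k = j) - 2 * u $ k * u $ j)) = of_bool (i = j)" for i j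
  proof -
    have "(\<Sum>k\<in>UNIV. (of_bool (i = k) - 2 * u $ i * u $ k) * (of_bool (k = j) - 2 * u $ k * u $ j))
       = (\<Sum>k\<in>UNIV. (if k = i then of_bool (i = j) - 2 * u $ i * u $ j else 0) - (if k = j then 2 * u $ i * u $ j else 0)
            + 4 * u $ i * u $ j * (u $ k * u $ k))"
      by (intro sum.cong) (auto simp: algebra_simps)
    also have "\<dots> = of_bool (i = j) - 4 * u $ i * u $ j + 4 * u $ i * u $ j * (\<Sum>k\<in>UNIV. u $ k * u $ k)"
      by (simp add: sum.distrib sum_subtractf sum_distrib_left)
    finally show ?thesis by (simp add: 1)
  qed
  then show ?thesis
    by (auto simp: reflection_matrix_def matrix_matrix_mult_def mat_def vec_eq_iff of_bool_def)
qed

text \<open>The product of two connected sets is connected, and so is its image. Applied to matrix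
  multiplication, it makes lying in a common component compatible with products.\<close>

lemma connected_component_image2:
  assumes "connected_component S a b" "connected_component T c d"
    and "continuous_on (S \<times> T) (\<lambda>x. f (fst x) (snd x))" "\<And>x y. x \<in> S \<Longrightarrow> y \<in> T \<Longrightarrow> f x y \<in> U"
  shows "connected_component U (f a c) (f b d)"
proof -
  obtain X Y where X: "connected X" "X \<subseteq> S" "a \<in> X" "b \<in> X" and Y: "connected Y" "Y \<subseteq> T" "c \<in> Y" "d \<in> Y"
    using assms(1,2) by (auto simp: connected_component_def)
  have "connected ((\<lambda>x. f (fst x) (snd x)) ` (X \<times> Y))"
    using X Y by (intro connected_continuous_image connected_Times continuous_on_subset[OF assms(3)]) auto
  moreover have "(\<lambda>x. f (fst x) (snd x)) ` (X \<times> Y) \<subseteq> U"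
    using X(2) Y(2) by (auto intro!: assms(4))
  moreover have "f a c \<in> (\<lambda>x. f (fst x) (snd x)) ` (X \<times> Y)" "f b d \<in> (\<lambda>x. f (fst x) (snd x)) ` (X \<times> Y)"
    using X Y by force+
  ultimately show ?thesis
    unfolding connected_component_def by blast
qed

text \<open>The unit sphere is connected, so all hyperplane reflections lie in one component; this
  covers both the transpositions and the sign changes needed for elementary matrices.\<close>

lemma GL_connected_component:
  fixes A :: "real^'n^'n"
  assumes card: "CARD('n) \<ge> 2" and A: "det A \<noteq> 0" and u: "norm u = 1"
  shows "connected_component {A. det A \<noteq> 0} (mat 1) A \<or>
         connected_component {A. det A \<noteq> 0} (reflection_matrix u) A"
proof -
  define H where "H = {A :: real^'n^'n. det A \<noteq> 0}"
  define I where "I = (mat 1 :: real^'n^'n)"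
  define R where "R = reflection_matrix u"
  define P where "P A \<longleftrightarrow> connected_component H I A \<or> connected_component H R A" for A
  have RR: "R ** R = I" using reflection_matrix_square[OF u] by (simp add: R_def I_def)
  have IH: "I \<in> H" by (simp add: H_def I_def)
  have RH: "R \<in> H" using right_inverse_det_nz[OF RR[unfolded I_def]] by (simp add: H_def)
  have mul: "connected_component H (a ** c) (b ** d)"
    if "connected_component H a b" "connected_component H c d" for a b c d
    using that by (rule connected_component_image2)
      (auto intro!: continuous_intros simp: H_def det_mul)
  \<comment> \<open>Since \<open>R ** R = I\<close>, the pair \<open>{I, R}\<close> is closed under
    products, hence so is the union of their components. Only the generators of the elementary
    induction remain to be treated.\<close>
  have Pmul: "P (A ** B)" if "P A" "P B" for A B
    using that mul[of I A I B] mul[of I A R B] mul[of R A I B] mul[of R A R B]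
    by (auto simp: P_def RR) (auto simp: I_def)
  have PI: "P I" using IH by (simp add: P_def connected_component_refl)
  have Psame: "P B" if "P A" "connected_component H A B" for A B
    using that unfolding P_def by (meson connected_component_trans)
  have Prefl: "P (reflection_matrix v)" if "norm v = 1" for v
  proof -
    have "connected (reflection_matrix ` sphere (0::real^'n) 1)"
    proof (rule connected_continuous_image)
      show "continuous_on (sphere 0 1) (reflection_matrix :: real^'n \<Rightarrow> real^'n^'n)"
        unfolding reflection_matrix_def by (intro continuous_intros)
      show "connected (sphere (0::real^'n) 1)"
        using card by (intro connected_sphere) simp
    qed
    moreover have "reflection_matrix ` sphere (0::real^'n) 1 \<subseteq> H"
      using right_inverse_det_nz(1)[OF reflection_matrix_square[where 'n='n]] by (auto simp: H_def)
    ultimately show ?thesis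
      using u that unfolding P_def R_def connected_component_def
      by (metis imageI mem_sphere_0)
  qed
  have "det A \<noteq> 0 \<longrightarrow> P A"
  proof (induction rule: induct_matrix_elementary)
    case (1 A B)
    then show ?case by (auto simp: det_mul intro: Pmul)
  next
    case (2 A i)
    then show ?case using det_zero_row[of i A] by blast
  next
    case (3 A)
    \<comment> \<open>\<open>D S\<close> keeps the signs of the diagonal of \<open>A\<close> at the
      indices in \<open>S\<close> and has 1 elsewhere. Each new index with a negative entry costs
      one coordinate reflection, so \<open>D UNIV\<close> is a product of reflections.\<close>
    define D where "D S = ((\<chi> i j. if i = j then (if i \<in> S then sgn (A $ i $ i) else 1) else 0) :: real^'n^'n)" for S
    show ?case
    proof
      assume "det A \<noteq> 0"
      then have nz: "A $ i $ i \<noteq> 0" for i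
        using det_diagonal[of A] 3 by auto
      have PD: "P (D S)" for S
      proof (induction S rule: finite_induct[OF finite])
        case 1
        have "D {} = I" by (simp add: D_def I_def mat_def vec_eq_iff)
        then show ?case using PI by simp
      next
        case (2 i F)
        show ?case
        proof (cases "A $ i $ i > 0")
          case True
          then have "D (insert i F) = D F" by (auto simp: D_def vec_eq_iff)
          then show ?thesis using 2 by simp
        next
          case False
          then have neg: "sgn (A $ i $ i) = -1" using nz[of i] by simp
          have D_mult: "(D S ** M) $ a $ b = (if a \<in> S then sgn (A $ a $ a) else 1) * M $ a $ b" for S M a b
            by (simp add: D_def matrix_matrix_mult_def if_distrib[of "\<lambda>c. c * _"] cong: if_cong)
          have "D (insert i F) = D F ** reflection_matrix (axis i 1)"
            using 2(2) neg by (auto simp: vec_eq_iff D_mult) (auto simp: D_def reflection_matrix_def axis_def)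
          then show ?thesis using 2 Prefl[of "axis i 1"] Pmul by simp
        qed
      qed
      \<comment> \<open>Along the segment every diagonal entry keeps its sign, so no matrix on it is
        singular.\<close>
      have "closed_segment (D UNIV) A \<subseteq> H"
      proof
        fix B assume "B \<in> closed_segment (D UNIV) A"
        then obtain t where t: "0 \<le> t" "t \<le> 1" "B = (1 - t) *\<^sub>R D UNIV + t *\<^sub>R A"
          by (auto simp: closed_segment_def)
        have "B $ i $ j = 0" if "i \<noteq> j" for i j using that 3 t by (simp add: D_def)
        then have "det B = prod (\<lambda>i. B $ i $ i) UNIV" by (rule det_diagonal)
        moreover have "B $ i $ i \<noteq> 0" for i
        proof -
          have "B $ i $ i = sgn (A $ i $ i) * ((1 - t) + t * \<bar>A $ i $ i\<bar>)"
            unfolding t(3) using mult_sgn_abs[of "A $ i $ i"] by (simp add: D_def algebra_simps)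
          moreover have "(1 - t) + t * \<bar>A $ i $ i\<bar> > 0"
          proof (cases "t = 0")
            case False
            then have "t * \<bar>A $ i $ i\<bar> > 0" using t nz[of i] by simp
            then show ?thesis using t(2) by linarith
          qed simp
          ultimately show ?thesis using nz[of i] by (simp add: sgn_zero_iff)
        qed
        ultimately show "B \<in> H" by (simp add: H_def)
      qed
      then have "connected_component H (D UNIV) A"
        by (meson connected_component_def connected_segment ends_in_segment)
      then show "P A" using PD Psame by blast
    qed
  next
    case (4 m n)
    \<comment> \<open>The reflection along the unit vector in direction \<open>e_m - e_n\<close>
      exchanges the coordinates \<open>m\<close> and \<open>n\<close>.\<close>
    define v where "v = (1 / sqrt 2) *\<^sub>R (axis m 1 - axis n 1 :: real^'n)"
    have "norm (axis m 1 - axis n 1 :: real^'n) = sqrt 2"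
      using 4 by (simp add: norm_eq_sqrt_inner inner_diff_left inner_diff_right inner_axis_axis)
    then have v: "norm v = 1" by (simp add: v_def)
    have vv: "2 * v $ i * v $ j = (axis m 1 - axis n 1) $ i * (axis m 1 - axis n 1 :: real^'n) $ j" for i j
      by (simp add: v_def)
    have "(\<chi> i j. mat 1 $ i $ Transposition.transpose m n j) = reflection_matrix v"
      using 4 by (simp only: reflection_matrix_def vec_eq_iff vv vec_lambda_beta)
        (auto simp: mat_def axis_def Transposition.transpose_def)
    then show ?case using Prefl[OF v] by simp
  next
    case (5 m n c)
    \<comment> \<open>The shears with one free entry form a line through the identity;
      \<open>?E (- t)\<close> inverts \<open>?E t\<close>, so the line stays among the invertible
      matrices.\<close>
    let ?E = "\<lambda>t. (\<chi> i j. if i = m \<and> j = n then t else of_bool (i = j)) :: real^'n^'n"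
    have "?E t \<in> H" for t
    proof -
      have "?E t ** ?E (- t) = mat 1"
      proof -
        have "(\<Sum>k\<in>UNIV. (if i = m \<and> k = n then t else of_bool (i = k)) * (if k = m \<and> j = n then - t else of_bool (k = j))) = of_bool (i = j)" for i j
        proof -
          have "(\<Sum>k\<in>UNIV. (if i = m \<and> k = n then t else of_bool (i = k)) * (if k = m \<and> j = n then - t else of_bool (k = j)))
            = (\<Sum>k\<in>UNIV. (if k = n then of_bool (i = m) * (t * of_bool (n = j)) else 0) + (if k = i then (if i = m \<and> j = n then - t else of_bool (i = j)) else 0))"
            using 5 by (intro sum.cong) auto
          also have "\<dots> = of_bool (i = j)"
            using 5 by (auto simp: sum.distrib)
          finally show ?thesis .
        qed
        then show ?thesis by (simp add: matrix_matrix_mult_def mat_def vec_eq_iff of_bool_def)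
      qed
      then show ?thesis using right_inverse_det_nz by (auto simp: H_def)
    qed
    then have "range ?E \<subseteq> H" by blast
    moreover have "connected (range ?E)"
    proof (rule connected_continuous_image)
      have "continuous_on UNIV (\<lambda>t. if P then t else c)" for P and c :: real
        by (cases P) auto
      then show "continuous_on UNIV ?E" by (intro continuous_intros)
    qed simp
    moreover have "I = ?E 0" using 5 by (auto simp: I_def mat_def vec_eq_iff)
    ultimately have "connected_component H I (?E c)"
      unfolding connected_component_def by blast
    then show ?case by (simp add: P_def)
  qed
  then show ?thesis using A by (simp add: P_def H_def I_def R_def)
qed

lemma connected_same_sign:
  fixes f :: "'a::topological_space \<Rightarrow> real"
  assumes "connected S" "continuous_on S f" "\<And>x. x \<in> S \<Longrightarrow> f x \<noteq> 0" "a \<in> S" "b \<in> S" "f a > 0"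
  shows "f b > 0"
proof (rule ccontr)
  assume "\<not> f b > 0"
  then have "f b \<le> 0" by simp
  have "connected (f ` S)" by (rule connected_continuous_image[OF assms(2,1)])
  then have "0 \<in> f ` S"
    using connectedD_interval[of "f ` S" "f b" "f a" 0] assms(4-6) \<open>f b \<le> 0\<close> by auto
  then show False using assms(3) by auto
qed

text \<open>At most two components are available, and the sign of the determinant is constant on
  each. As both signs occur, the components are exactly the two sign classes.\<close>

lemma connected_GL_sign:
  assumes card: "CARD('n) \<ge> 2"
  shows "connected {A :: real^'n^'n. det A > 0}" "connected {A :: real^'n^'n. det A < 0}"
    and "\<exists>A :: real^'n^'n. det A < 0"
proof -
  define H where "H = {A :: real^'n^'n. det A \<noteq> 0}"
  obtain i :: 'n where True by simp
  define u where "u = (axis i 1 :: real^'n)"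
  define R where "R = reflection_matrix u"
  have u: "norm u = 1" by (simp add: u_def)
  note cc = GL_connected_component[OF card _ u, folded H_def R_def]
  have sgn: "det B > 0" if AB: "connected_component H A B" and pos: "det A > 0" for A B
  proof -
    obtain T where T: "connected T" "T \<subseteq> H" "A \<in> T" "B \<in> T"
      using AB by (auto simp: connected_component_def)
    show ?thesis
      by (rule connected_same_sign[of T det, OF T(1) _ _ T(3,4) pos]) (use T(2) in \<open>auto simp: H_def intro!: continuous_intros\<close>)
  qed
  have sgn': "det B < 0" if AB: "connected_component H A B" and neg: "det A < 0" for A B
  proof -
    obtain T where T: "connected T" "T \<subseteq> H" "A \<in> T" "B \<in> T"
      using AB by (auto simp: connected_component_def)
    have "- det B > 0"
      by (rule connected_same_sign[OF T(1) _ _ T(3,4), of "\<lambda>A. - det A"])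
         (use T(2) neg in \<open>auto simp: H_def intro!: continuous_intros\<close>)
    then show ?thesis by simp
  qed
  define N where "N = ((\<chi> a b. if a = b then (if a = i then -1 else 1) else 0) :: real^'n^'n)"
  have "det (N :: real^'n^'n) = prod (\<lambda>a. N $ a $ a) UNIV"
    by (rule det_diagonal) (simp add: N_def)
  also have "\<dots> = -1"
    by (simp add: N_def prod.delta)
  finally have N: "det (N :: real^'n^'n) = -1" .
  then show ex: "\<exists>A :: real^'n^'n. det A < 0" by (intro exI[of _ N]) simp
  have not_I: "\<not> connected_component H (mat 1) B" if "det B < 0" for B
    using sgn[of "mat 1" B] that by auto
  have neg: "connected_component H R B" if "det B < 0" for B
    using cc[of B] not_I[OF that] that by auto
  \<comment> \<open>\<open>R\<close> shares its component with \<open>N\<close>, whose determinant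
    is -1.\<close>
  have "det R < 0"
  proof (rule ccontr)
    assume "\<not> det R < 0"
    moreover have "R \<in> H" using connected_component_in[OF neg[of N]] N by simp
    ultimately have "det R > 0" by (simp add: H_def)
    then show False using sgn[OF neg[of N]] N by simp
  qed
  have pos: "connected_component H (mat 1) B" if "det B > 0" for B
    using cc[of B] sgn'[of R B] \<open>det R < 0\<close> that by auto
  have "connected_component_set H (mat 1) = {A. det A > 0}"
    using pos sgn[of "mat 1"] by auto
  then show "connected {A :: real^'n^'n. det A > 0}" by (metis connected_connected_component)
  have "connected_component_set H R = {A. det A < 0}"
    using neg sgn'[of R] \<open>det R < 0\<close> by auto
  then show "connected {A :: real^'n^'n. det A < 0}" by (metis connected_connected_component)
qed

subsection \<open>Real square roots of \<open>-1\<close>\<close>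

lemma det_map_of_real:
  fixes A :: "real^'n^'n"
  shows "det (\<chi> i j. complex_of_real (A $ i $ j)) = complex_of_real (det A)"
  by (simp add: det_def)

lemma det_map_cnj:
  fixes A :: "complex^'n^'n"
  shows "det (\<chi> i j. cnj (A $ i $ j)) = cnj (det A)"
  by (simp add: det_def)

text \<open>Over the complex numbers \<open>J\<close> has the spectral projections \<open>E\<close> and \<open>F = cnj E\<close>, which
  commute with \<open>P\<close>. Hence \<open>P = (PE + F)(E + PF)\<close>, and the second factor is the conjugate of the
  first one.\<close>

lemma det_commuting_complex_structure:
  fixes P J :: "real^'n^'n"
  assumes J: "J ** J = - mat 1" and PJ: "P ** J = J ** P"
  shows "det P \<ge> 0"
proof -
  define cx :: "real^'n^'n \<Rightarrow> complex^'n^'n" where "cx A = (\<chi> i j. complex_of_real (A $ i $ j))" for A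
  define conj :: "complex^'n^'n \<Rightarrow> complex^'n^'n" where "conj A = (\<chi> i j. cnj (A $ i $ j))" for A
  have cx_mul: "cx (A ** B) = cx A ** cx B" for A B
    by (simp add: cx_def matrix_matrix_mult_def vec_eq_iff)
  have cx_one: "cx (mat 1) = mat 1" by (simp add: cx_def mat_def vec_eq_iff)
  have cx_minus: "cx (- A) = - cx A" for A by (simp add: cx_def vec_eq_iff)
  have conj_mul: "conj (A ** B) = conj A ** conj B" for A B
    by (simp add: conj_def matrix_matrix_mult_def vec_eq_iff)
  have conj_add: "conj (A + B) = conj A + conj B" for A B
    by (simp add: conj_def vec_eq_iff)
  have conj_cx: "conj (cx A) = cx A" for A
    by (simp add: conj_def cx_def vec_eq_iff)
  define p j where "p = cx P" and "j = cx J"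
  have jj: "j ** j = - mat 1" using J by (metis cx_mul cx_one cx_minus j_def)
  have pj: "p ** j = j ** p" using PJ by (metis cx_mul p_def j_def)
  define E where "E = (1/2) *\<^sub>R (mat 1 :: complex^'n^'n) - (\<chi> a b. (\<i> / 2) * j $ a $ b)"
  define F where "F = (1/2) *\<^sub>R (mat 1 :: complex^'n^'n) + (\<chi> a b. (\<i> / 2) * j $ a $ b)"
  define h where "h = (\<chi> a b. (\<i> / 2) * j $ a $ b)"
  have ph: "p ** h = h ** p"
  proof -
    have "p ** h = (\<chi> a b. (\<i> / 2) * (p ** j) $ a $ b)" "h ** p = (\<chi> a b. (\<i> / 2) * (j ** p) $ a $ b)"
      by (simp_all add: h_def matrix_matrix_mult_def vec_eq_iff sum_distrib_left mult_ac)
    then show ?thesis by (simp add: pj)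
  qed
  \<comment> \<open>The value 1/4 makes \<open>1/2 - h\<close> and \<open>1/2 + h\<close>
    complementary idempotents.\<close>
  have hh: "h ** h = (1/4) *\<^sub>R mat 1"
  proof -
    have "h ** h = (\<chi> a b. (- 1 / 4) * (j ** j) $ a $ b)"
      by (simp add: h_def matrix_matrix_mult_def vec_eq_iff sum_distrib_left sum_divide_distrib sum_negf mult_ac)
    then show ?thesis by (simp add: jj vec_eq_iff mat_def scaleR_conv_of_real[where 'a=complex])
  qed
  have EF: "E ** F = 0" "F ** E = 0" "E ** E = E" "F ** F = F" "E + F = mat 1" "p ** E = E ** p" "p ** F = F ** p"
    unfolding E_def F_def h_def[symmetric]
    by (simp_all add: matrix_ring_simps matrix_scalar_ac scalar_matrix_assoc[symmetric] hh ph)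
      (simp_all add: vec_eq_iff mat_def scaleR_conv_of_real[where 'a=complex] field_simps)
  have "conj j = j" by (simp add: j_def conj_cx)
  then have cj: "cnj (j $ a $ b) = j $ a $ b" for a b
    by (simp add: conj_def vec_eq_iff)
  have conjE: "conj E = F" "conj F = E"
    by (auto simp: E_def F_def conj_def vec_eq_iff cj mat_def)
  have "(p ** E + F) ** (E + p ** F) = p"
  proof -
    have "(p ** E + F) ** (E + p ** F) = p ** (E ** E) + p ** (E ** p) ** F + F ** E + (F ** p) ** F"
      by (simp add: matrix_ring_simps)
    also have "\<dots> = p ** E + p ** p ** (E ** F) + p ** (F ** F)"
      unfolding EF(6,7)[symmetric] EF(2,3) by (simp add: matrix_mul_assoc)
    also have "\<dots> = p ** (E + F)"
      by (simp add: EF(1,4) matrix_add_ldistrib)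
    finally show ?thesis by (simp add: EF(5))
  qed
  then have "det p = det (p ** E + F) * det (E + p ** F)" by (metis det_mul)
  also have "E + p ** F = conj (p ** E + F)"
    by (simp add: conj_add conj_mul conjE p_def conj_cx add.commute)
  also have "det (conj (p ** E + F)) = cnj (det (p ** E + F))"
    unfolding conj_def by (rule det_map_cnj)
  finally have "complex_of_real (det P) = complex_of_real ((cmod (det (p ** E + F)))\<^sup>2)"
    by (simp add: p_def cx_def det_map_of_real complex_norm_square[symmetric])
  then have "det P = (cmod (det (p ** E + F)))\<^sup>2" using of_real_eq_iff by blast
  then show ?thesis by simp
qed

section \<open>Similarity of complex structures on a real space\<close>

lemma matrix_vector_mult_uminus: "(- A) *v x = - (A *v (x :: 'a::ring_1^'n))"
  by (simp add: matrix_vector_mult_def vec_eq_iff sum_negf)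

text \<open>\<open>J\<close> makes the space complex, and \<open>B\<close> is a complex linearly
  independent family of size \<open>k\<close>, grown one vector at a time. The disjointness clause
  later allows a map to be prescribed separately on \<open>B\<close> and on its image under
  \<open>J\<close>.\<close>

lemma complex_structure_basis:
  fixes J :: "real^'n^'n"
  assumes J: "J ** J = - mat 1" and k: "2 * k \<le> CARD('n)"
  shows "\<exists>B. finite B \<and> card B = k \<and> independent (B \<union> (*v) J ` B) \<and> card (B \<union> (*v) J ` B) = 2 * k
      \<and> B \<inter> (*v) J ` B = {}"
  using k
proof (induction k)
  case 0
  then show ?case by (intro exI[of _ "{}"]) (auto simp: independent_empty)
next
  case (Suc k)
  have JJ: "J *v (J *v x) = - x" for x
    by (simp add: matrix_vector_mul_assoc J matrix_vector_mult_uminus)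
  obtain B where B: "finite B" "card B = k" "independent (B \<union> (*v) J ` B)" "card (B \<union> (*v) J ` B) = 2 * k"
      "B \<inter> (*v) J ` B = {}"
    using Suc by auto
  define T where "T = B \<union> (*v) J ` B"
  have "dim (span T) = 2 * k"
    using B(3,4) by (simp add: T_def dim_span dim_eq_card_independent)
  then have "span T \<noteq> UNIV" using Suc.prems by (metis DIM_cart DIM_real dim_UNIV mult.right_neutral
        Suc_le_lessD add_2_eq_Suc less_irrefl mult_Suc_right Suc_lessD)
  then obtain v where v: "v \<notin> span T" by blast
  have Jspan: "J *v x \<in> span T" if "x \<in> span T" for x
    using that
  proof (induction rule: span_induct_alt)
    case base
    then show ?case by (simp add: span_zero)
  next
    case (step c x y)
    have "J *v x \<in> span T"
    proof (cases "x \<in> B")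
      case True
      then show ?thesis by (simp add: T_def span_base)
    next
      case False
      then obtain b where "b \<in> B" "x = J *v b" using step(1) by (auto simp: T_def)
      then show ?thesis by (simp add: JJ T_def span_base span_neg)
    qed
    then show ?case using step(2)
      by (simp add: matrix_vector_right_distrib matrix_vector_mult_scaleR span_add span_scale)
  qed
  \<comment> \<open>\<open>J\<close> has no real eigenvalue modulo a stable subspace: if
    \<open>J v = b v\<close> modulo \<open>span T\<close>, applying \<open>J\<close> again puts
    \<open>(1 + b^2) v\<close>, hence \<open>v\<close>, into \<open>span T\<close>.\<close>
  have Jv: "J *v v \<notin> span (insert v T)"
  proof
    assume "J *v v \<in> span (insert v T)"
    then obtain b where b: "J *v v - b *\<^sub>R v \<in> span T" by (auto simp: span_insert)
    from Jspan[OF b] have "- v - b *\<^sub>R (J *v v) \<in> span T"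
      by (simp add: matrix_vector_mult_diff_distrib matrix_vector_mult_scaleR JJ)
    from span_neg[OF span_add[OF this span_scale[OF b, of b]]] have "(1 + b * b) *\<^sub>R v \<in> span T"
      by (simp add: algebra_simps)
    from span_scale[OF this, of "1 / (1 + b * b)"] have "v \<in> span T"
      by (simp add: add_nonneg_eq_0_iff)
    with v show False by simp
  qed
  have eq: "insert v B \<union> (*v) J ` insert v B = insert (J *v v) (insert v T)"
    by (auto simp: T_def)
  have nin: "v \<notin> T" "J *v v \<notin> insert v T" using v Jv span_base by blast+
  have "independent (insert (J *v v) (insert v T))"
    using B(3) v Jv by (simp add: independent_insert T_def[symmetric])
  moreover have "card (insert (J *v v) (insert v T)) = 2 * Suc k"
    using nin B by (simp add: T_def)
  moreover have "insert v B \<inter> (*v) J ` insert v B = {}"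
    using nin B(5) by (auto simp: T_def)
  ultimately show ?case
    using B(1,2) nin by (intro exI[of _ "insert v B"]) (auto simp: eq T_def)
qed

text \<open>\<open>J\<close> and \<open>K\<close> define two complex spaces of the same dimension
  \<open>d\<close>; \<open>P\<close> is the matrix of a complex linear isomorphism between them,
  obtained by matching complex bases.\<close>

lemma sqrt_minus_one_similar:
  fixes J K :: "real^'n^'n"
  assumes J: "J ** J = - mat 1" and K: "K ** K = - mat 1" and card: "CARD('n) = 2 * d"
  shows "\<exists>P. det P \<noteq> 0 \<and> K = P ** J ** matrix_inv P"
proof -
  have JJ: "J *v (J *v x) = - x" and KK: "K *v (K *v x) = - x" for x
    by (simp_all add: matrix_vector_mul_assoc J K matrix_vector_mult_uminus)
  obtain B where B: "finite B" "card B = d" "independent (B \<union> (*v) J ` B)" "card (B \<union> (*v) J ` B) = 2 * d"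
      "B \<inter> (*v) J ` B = {}"
    using complex_structure_basis[OF J, of d] card by auto
  obtain C where C: "finite C" "card C = d" "independent (C \<union> (*v) K ` C)" "card (C \<union> (*v) K ` C) = 2 * d"
      "C \<inter> (*v) K ` C = {}"
    using complex_structure_basis[OF K, of d] card by auto
  have spanB: "span (B \<union> (*v) J ` B) = UNIV" and spanC: "span (C \<union> (*v) K ` C) = UNIV"
    using B(3,4) C(3,4) card by (simp_all add: dim_eq_full[symmetric] dim_eq_card_independent)
  obtain f where f: "bij_betw f B C" using B C by (metis finite_same_card_bij)
  \<comment> \<open>For \<open>x = J b\<close> one has \<open>- (J x) = b\<close>, so the second
    branch sends \<open>J b\<close> to \<open>K (f b)\<close>.\<close>
  define g where "g x = (if x \<in> B then f x else K *v f (- (J *v x)))" for x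
  obtain h where h: "linear h" "\<And>x. x \<in> B \<union> (*v) J ` B \<Longrightarrow> h x = g x"
    using linear_independent_extend[OF B(3), of g] by blast
  have hB: "h b = f b" if "b \<in> B" for b using h(2)[of b] that by (simp add: g_def)
  have hJB: "h (J *v b) = K *v f b" if "b \<in> B" for b
  proof -
    have "J *v b \<notin> B" using B(5) that by blast
    then show ?thesis using h(2)[of "J *v b"] that by (simp add: g_def JJ)
  qed
  have "h (J *v x) = K *v h x" for x
  proof -
    have "linear (\<lambda>x. h (J *v x))" "linear (\<lambda>x. K *v h x)"
      using linear_compose[OF matrix_vector_mul_linear[of J] h(1)]
        linear_compose[OF h(1) matrix_vector_mul_linear[of K]] by (simp_all add: o_def)
    then show ?thesis
      by (rule linear_eq_on[where B = "B \<union> (*v) J ` B"])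
         (auto simp: spanB hB hJB JJ KK linear_neg[OF h(1)])
  qed
  moreover have "surj h"
  proof -
    have "C \<union> (*v) K ` C \<subseteq> range h"
    proof
      fix y assume "y \<in> C \<union> (*v) K ` C"
      then obtain c where "c \<in> C" "y = c \<or> y = K *v c" by blast
      moreover then obtain b where "b \<in> B" "c = f b" using f by (auto simp: bij_betw_def)
      ultimately show "y \<in> range h" using hB[of b] hJB[of b] by (metis rangeI)
    qed
    then have "span (C \<union> (*v) K ` C) \<subseteq> range h"
      by (rule span_minimal) (simp add: h(1) linear_subspace_image)
    then show ?thesis using spanC by auto
  qed
  moreover define P where "P = matrix h"
  moreover have P: "P *v x = h x" for x unfolding P_def by (simp add: h(1) matrix_works linear_matrix_vector_mul_eq)
  ultimately have "P ** J = K ** P" by (simp add: matrix_eq matrix_vector_mul_assoc[symmetric])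
  obtain P' where P': "P ** P' = mat 1"
    using \<open>surj h\<close> matrix_right_invertible_surjective[of P] P by (auto simp: surj_def)
  then have "det P \<noteq> 0" by (rule right_inverse_det_nz)
  moreover have "K = P ** J ** matrix_inv P"
    using \<open>P ** J = K ** P\<close> matrix_inv_works(1)[OF \<open>det P \<noteq> 0\<close>]
    by (metis matrix_mul_assoc matrix_mul_rid)
  ultimately show ?thesis by blast
qed

text \<open>The indices are paired by an involution \<open>t\<close> between \<open>A\<close> and
  its complement. \<open>J\<close> is the permutation matrix of \<open>t\<close> with opposite signs
  on the two members of each pair.\<close>

lemma exists_sqrt_minus_one:
  assumes card: "CARD('n) = 2 * d"
  shows "\<exists>J :: real^'n^'n. J ** J = - mat 1"
proof -
  obtain A :: "'n set" where A: "card A = d"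
    using obtain_subset_with_card_n[of d "UNIV :: 'n set"] card by auto
  have "card (- A) = d" using A card by (simp add: Compl_eq_Diff_UNIV card_Diff_subset)
  then obtain f where f: "bij_betw f A (- A)" using A by (metis finite finite_same_card_bij)
  define t where "t i = (if i \<in> A then f i else inv_into A f i)" for i
  define s :: "'n \<Rightarrow> real" where "s i = (if i \<in> A then 1 else -1)" for i
  have t: "t (t i) = i" and s: "s i * s (t i) = -1" for i
    using f bij_betw_inv_into_left[OF f, of i] bij_betw_inv_into_right[OF f, of i]
      bij_betwE[OF f] bij_betwE[OF bij_betw_inv_into[OF f]]
    by (auto simp: t_def s_def)
  define J where "J = ((\<chi> i j. if j = t i then s i else 0) :: real^'n^'n)"
  have "(\<Sum>k\<in>UNIV. (if k = t i then s i else 0) * (if j = t k then s k else 0)) = (if i = j then -1 else 0)" for i j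
    by (simp add: if_distrib[of "\<lambda>c. c * _"] t s cong: if_cong)
  then have "J ** J = - mat 1"
    by (simp add: J_def matrix_matrix_mult_def mat_def vec_eq_iff)
  then show ?thesis by blast
qed

section \<open>Orbits under conjugators of a given determinant sign\<close>

text \<open>The sign class is encoded as a number, so that a further conjugation acts on it by
  multiplication.\<close>

definition conj_orbit :: "real^'n^'n \<Rightarrow> real \<Rightarrow> (real^'n^'n) set" where
  "conj_orbit J s = {g ** J ** matrix_inv g | g. s * det g > 0}"

lemma conj_orbit_subset:
  fixes J :: "real^'n^'n"
  assumes "J ** J = - mat 1"
  shows "conj_orbit J s \<subseteq> {K. K ** K = - mat 1}"
proof
  fix K assume "K \<in> conj_orbit J s"
  then obtain g where "s * det g > 0" and K: "K = g ** J ** matrix_inv g"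
    by (auto simp: conj_orbit_def)
  then have g: "det g \<noteq> 0" by auto
  have "K ** K = g ** J ** (matrix_inv g ** g) ** J ** matrix_inv g" by (simp add: K matrix_mul_assoc)
  also have "\<dots> = g ** (J ** J) ** matrix_inv g"
    using g by (simp add: matrix_inv_works matrix_mul_assoc)
  also have "\<dots> = - mat 1" using g by (simp add: assms matrix_ring_simps matrix_inv_works)
  finally show "K \<in> {K. K ** K = - mat 1}" by simp
qed

lemma sqrt_minus_one_eq_orbits:
  fixes J :: "real^'n^'n"
  assumes "J ** J = - mat 1" "CARD('n) = 2 * d"
  shows "{K. K ** K = - mat 1} = conj_orbit J 1 \<union> conj_orbit J (-1)"
proof
  show "{K. K ** K = - mat 1} \<subseteq> conj_orbit J 1 \<union> conj_orbit J (-1)"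
  proof
    fix K :: "real^'n^'n" assume "K \<in> {K. K ** K = - mat 1}"
    then obtain P where "det P \<noteq> 0" "K = P ** J ** matrix_inv P"
      using sqrt_minus_one_similar[OF assms(1) _ assms(2)] by blast
    then show "K \<in> conj_orbit J 1 \<union> conj_orbit J (-1)"
      by (cases "det P > 0") (auto simp: conj_orbit_def not_less le_less)
  qed
qed (use conj_orbit_subset[OF assms(1)] in auto)

text \<open>Conjugators \<open>g\<close>, \<open>h\<close> with the same result differ by
  \<open>matrix_inv h ** g\<close>, which commutes with \<open>J\<close>; its determinant cannot be
  negative.\<close>

lemma conj_orbit_disjoint:
  fixes J :: "real^'n^'n"
  assumes J: "J ** J = - mat 1"
  shows "conj_orbit J 1 \<inter> conj_orbit J (-1) = {}"
proof -
  have False if g: "det g > 0" and h: "det h < 0" and eq: "g ** J ** matrix_inv g = h ** J ** matrix_inv h" for g h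
  proof -
    let ?P = "matrix_inv h ** g"
    have nz: "det g \<noteq> 0" "det h \<noteq> 0" using g h by auto
    have "?P ** J = matrix_inv h ** (g ** J ** matrix_inv g) ** g"
      using matrix_inv_works[OF nz(1)] by (metis matrix_mul_assoc matrix_mul_rid)
    also have "\<dots> = J ** ?P"
      unfolding eq using matrix_inv_works[OF nz(2)] by (metis matrix_mul_assoc matrix_mul_lid)
    finally have "det ?P \<ge> 0" by (rule det_commuting_complex_structure[OF J])
    moreover have "det ?P < 0" using g h nz by (simp add: det_mul det_matrix_inv mult_neg_pos)
    ultimately show False by simp
  qed
  then show ?thesis by (fastforce simp: conj_orbit_def)
qed

lemma connected_conj_orbit:
  fixes J :: "real^'n^'n"
  assumes "CARD('n) \<ge> 2" "s = 1 \<or> s = -1"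
  shows "connected (conj_orbit J s)"
proof -
  have "{g :: real^'n^'n. s * det g > 0} = {g. det g > 0} \<or> {g :: real^'n^'n. s * det g > 0} = {g. det g < 0}"
    using assms(2) by auto
  then have "connected {g :: real^'n^'n. s * det g > 0}"
    using connected_GL_sign(1,2)[OF assms(1)] by auto
  moreover have "conj_orbit J s = (\<lambda>g. g ** J ** matrix_inv g) ` {g. s * det g > 0}"
    by (auto simp: conj_orbit_def)
  moreover have "continuous_on {g. s * det g > 0} (\<lambda>g. g ** J ** matrix_inv g)"
    by (intro continuous_intros continuous_on_matrix_inv) auto
  ultimately show ?thesis by (simp add: connected_continuous_image)
qed

text \<open>Two square roots \<open>K\<close>, \<open>L\<close> of \<open>-1\<close> are intertwined by \<open>P = 1 - LK\<close>, and \<open>P\<close> is close to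
  \<open>2\<close> when \<open>L\<close> is close to \<open>K\<close>.\<close>

lemma openin_conj_orbit:
  fixes J :: "real^'n^'n"
  assumes J: "J ** J = - mat 1"
  shows "openin (top_of_set {K. K ** K = - mat 1}) (conj_orbit J s)"
proof (subst openin_subopen, intro ballI)
  fix K assume K: "K \<in> conj_orbit J s"
  let ?Q = "{K :: real^'n^'n. K ** K = - mat 1}"
  \<comment> \<open>The determinant is required to be positive, not just nonzero, so that
    multiplying a conjugator by \<open>P\<close> preserves its sign class.\<close>
  let ?T = "?Q \<inter> (\<lambda>L. det (mat 1 - L ** K)) -` {0<..}"
  have KK: "K ** K = - mat 1" using conj_orbit_subset[OF J] K by blast
  have "openin (top_of_set ?Q) ?T"
    by (intro continuous_openin_preimage_gen continuous_intros)
  moreover have "K \<in> ?T"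
  proof -
    have "det (mat 1 - K ** K) = (\<Prod>i::'n\<in>UNIV. 2)"
      by (subst det_diagonal) (auto simp: KK mat_def)
    then show ?thesis using KK by simp
  qed
  moreover have "?T \<subseteq> conj_orbit J s"
  proof
    fix L assume L: "L \<in> ?T"
    obtain g where g: "s * det g > 0" "K = g ** J ** matrix_inv g"
      using K by (auto simp: conj_orbit_def)
    define P where "P = mat 1 - L ** K"
    have P: "det P > 0" using L by (simp add: P_def)
    have LL: "L ** L = - mat 1" using L by simp
    \<comment> \<open>Both \<open>P ** K\<close> and \<open>L ** P\<close> equal
      \<open>K + L\<close>.\<close>
    have "P ** K = K - L ** (K ** K)" by (simp add: P_def matrix_ring_simps)
    also have "\<dots> = L - (L ** L) ** K" by (simp add: KK LL matrix_ring_simps)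
    also have "\<dots> = L ** P" by (simp add: P_def matrix_ring_simps)
    finally have PK: "P ** K = L ** P" .
    have nz: "det P \<noteq> 0" "det g \<noteq> 0" using P g by auto
    have "L = L ** P ** matrix_inv P"
      using matrix_inv_works(1)[OF nz(1)] by (metis matrix_mul_assoc matrix_mul_rid)
    also have "\<dots> = (P ** g) ** J ** matrix_inv (P ** g)"
      by (simp add: PK[symmetric] matrix_inv_mult[OF nz] g(2) matrix_mul_assoc)
    finally have "L = (P ** g) ** J ** matrix_inv (P ** g)" .
    moreover have "s * det (P ** g) > 0"
      using mult_pos_pos[OF P g(1)] by (simp add: det_mul mult_ac)
    ultimately show "L \<in> conj_orbit J s" unfolding conj_orbit_def by blast
  qed
  ultimately show "\<exists>T. openin (top_of_set ?Q) T \<and> K \<in> T \<and> T \<subseteq> conj_orbit J s" by blast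
qed

text \<open>Conjugation by \<open>h\<close> multiplies the conjugator by \<open>h\<close> on the
  left. This is the rule by which automorphisms act on the labels of components.\<close>

lemma conj_conj_orbit:
  fixes J :: "real^'n^'n"
  assumes h: "det h \<noteq> 0"
  shows "(\<lambda>X. h ** X ** matrix_inv h) ` conj_orbit J s = conj_orbit J (sgn (det h) * s)"
proof
  have pos: "sgn (det h) * s * det (h ** g) > 0 \<longleftrightarrow> s * det g > 0" for g
  proof -
    have "sgn (det h) * s * det (h ** g) = \<bar>det h\<bar> * (s * det g)"
      by (simp add: det_mul mult_ac abs_sgn[of "det h"])
    moreover have "\<bar>det h\<bar> > 0" using h by simp
    ultimately show ?thesis by (simp only: zero_less_mult_pos2 zero_less_mult_iff[of "\<bar>det h\<bar>"]) auto
  qed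
  have conj: "h ** (g ** J ** matrix_inv g) ** matrix_inv h = (h ** g) ** J ** matrix_inv (h ** g)"
    if "det g \<noteq> 0" for g
    using that h by (simp add: matrix_inv_mult matrix_mul_assoc)
  show "(\<lambda>X. h ** X ** matrix_inv h) ` conj_orbit J s \<subseteq> conj_orbit J (sgn (det h) * s)"
  proof
    fix Y assume "Y \<in> (\<lambda>X. h ** X ** matrix_inv h) ` conj_orbit J s"
    then obtain g where g: "s * det g > 0" "Y = h ** (g ** J ** matrix_inv g) ** matrix_inv h"
      by (auto simp: conj_orbit_def)
    moreover have "det g \<noteq> 0" using g(1) by auto
    ultimately show "Y \<in> conj_orbit J (sgn (det h) * s)"
      using pos[of g] conj[of g] unfolding conj_orbit_def by blast
  qed
  show "conj_orbit J (sgn (det h) * s) \<subseteq> (\<lambda>X. h ** X ** matrix_inv h) ` conj_orbit J s"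
  proof
    fix Y assume "Y \<in> conj_orbit J (sgn (det h) * s)"
    then obtain k where k: "sgn (det h) * s * det k > 0" "Y = k ** J ** matrix_inv k"
      by (auto simp: conj_orbit_def)
    define g where "g = matrix_inv h ** k"
    have k_eq: "k = h ** g" by (simp add: g_def matrix_mul_assoc matrix_inv_works h)
    have "s * det g > 0" using k(1) pos[of g] by (simp add: k_eq)
    moreover from this have "det g \<noteq> 0" by auto
    ultimately have "g ** J ** matrix_inv g \<in> conj_orbit J s" "Y = h ** (g ** J ** matrix_inv g) ** matrix_inv h"
      using k(2) conj[of g] unfolding k_eq conj_orbit_def by auto
    then show "Y \<in> (\<lambda>X. h ** X ** matrix_inv h) ` conj_orbit J s" by blast
  qed
qed

text \<open>The union of the other members is open too, so a connected set containing
  \<open>F i\<close> cannot leave it. With injectivity, this reduces counting components to counting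
  indices.\<close>

lemma components_eq_open_partition:
  assumes conn: "\<And>i. i \<in> I \<Longrightarrow> connected (F i)" and ne: "\<And>i. i \<in> I \<Longrightarrow> F i \<noteq> {}"
    and op: "\<And>i. i \<in> I \<Longrightarrow> openin (top_of_set S) (F i)"
    and disj: "\<And>i j. i \<in> I \<Longrightarrow> j \<in> I \<Longrightarrow> i \<noteq> j \<Longrightarrow> F i \<inter> F j = {}"
    and cover: "(\<Union>i\<in>I. F i) = S"
  shows "components S = F ` I" "inj_on F I"
proof -
  have comp: "F i \<in> components S" if i: "i \<in> I" for i
    unfolding in_components_maximal
  proof (intro conjI allI impI)
    show "F i \<noteq> {}" "F i \<subseteq> S" "connected (F i)"
      using conn ne cover i by blast+
    fix D assume D: "D \<noteq> {} \<and> F i \<subseteq> D \<and> D \<subseteq> S \<and> connected D"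
    define R where "R = (\<Union>j\<in>I - {i}. F j)"
    have "openin (top_of_set S) R" unfolding R_def by (intro openin_Union) (use op in auto)
    moreover have sub: "openin (top_of_set D) (X \<inter> D)" if X: "openin (top_of_set S) X" for X
    proof -
      obtain T where "open T" "X = S \<inter> T" using X by (auto simp: openin_open)
      then show ?thesis using D by (auto simp: openin_open intro!: exI[of _ T])
    qed
    ultimately have "openin (top_of_set D) (R \<inter> D)" by blast
    moreover have "openin (top_of_set D) (F i)"
      using sub[OF op[OF i]] D by (simp add: Int_absorb2)
    moreover have "D = F i \<union> (R \<inter> D)" "F i \<inter> (R \<inter> D) = {}"
      using D cover disj[OF i] i by (auto simp: R_def)
    ultimately have "R \<inter> D = {}"
      using D ne[OF i] connected_openin[of D] by blast
    then show "D = F i" using \<open>D = F i \<union> (R \<inter> D)\<close> by blast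
  qed
  show "components S = F ` I"
  proof
    show "components S \<subseteq> F ` I"
    proof
      fix D assume D: "D \<in> components S"
      then obtain x where "x \<in> D" "x \<in> S" using in_components_nonempty in_components_subset by blast
      then obtain i where "i \<in> I" "x \<in> F i" using cover by blast
      then show "D \<in> F ` I"
        using components_nonoverlap[OF D comp[of i]] \<open>x \<in> D\<close> by blast
    qed
  qed (use comp in blast)
  show "inj_on F I" using disj ne by (fastforce simp: inj_on_def)
qed

section \<open>Center and injective endomorphisms of a full matrix algebra\<close>

lemma central_matrix:
  fixes A :: "real^'n^'n"
  assumes "\<And>B. A ** B = B ** A"
  shows "\<exists>c. A = c *\<^sub>R mat 1"
proof -
  obtain z :: 'n where True by simp
  \<comment> \<open>Matrix units in the fixed row \<open>z\<close>: comparing row \<open>z\<close>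
    of \<open>A ** E l\<close> and \<open>E l ** A\<close> determines row \<open>l\<close> of
    \<open>A\<close>.\<close>
  define E where "E l = ((\<chi> a b. if a = z \<and> b = l then 1 else 0) :: real^'n^'n)" for l
  have "(A ** E l) $ i $ j = (if j = l then A $ i $ z else 0)" for i j l
    by (simp add: E_def matrix_matrix_mult_def if_distrib[of "\<lambda>c. _ * c"] if_conn(1) cong: if_cong)
  moreover have "(E l ** A) $ i $ j = (if i = z then A $ l $ j else 0)" for i j l
    by (simp add: E_def matrix_matrix_mult_def if_distrib[of "\<lambda>c. c * _"] cong: if_cong)
  ultimately have "(if j = l then A $ i $ z else 0) = (if i = z then A $ l $ j else 0)" for i j l
    using assms[of "E l"] by metis
  from this[where i = z] have *: "A $ l $ j = (if j = l then A $ z $ z else 0)" for l j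
    by (metis (full_types))
  have "A = A $ z $ z *\<^sub>R mat 1"
    unfolding vec_eq_iff
  proof (intro allI)
    show "A $ l $ j = (A $ z $ z *\<^sub>R mat 1) $ l $ j" for l j
      by (subst *) (simp add: mat_def)
  qed
  then show ?thesis by blast
qed

text \<open>Skolem--Noether for a full matrix algebra: \<open>x \<mapsto> \<alpha> (x e\<^sub>z\<^sup>T) u\<close> intertwines the
  standard module with its twist by \<open>\<alpha>\<close>.\<close>

lemma matrix_algebra_hom_inner:
  fixes \<alpha> :: "real^'n^'n \<Rightarrow> real^'n^'n"
  assumes lin: "linear \<alpha>" and mul: "\<And>A B. \<alpha> (A ** B) = \<alpha> A ** \<alpha> B" and inj: "\<And>A. \<alpha> A = 0 \<Longrightarrow> A = 0"
  shows "\<exists>P. det P \<noteq> 0 \<and> (\<forall>A. \<alpha> A = P ** A ** matrix_inv P)"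
proof -
  obtain z :: 'n where True by simp
  define c where "c x = ((\<chi> a b. if b = z then x $ a else 0) :: real^'n^'n)" for x :: "real^'n"
  have lin_c: "linear c" by (rule linearI) (auto simp: c_def vec_eq_iff)
  have A_c: "A ** c x = c (A *v x)" for A x
    by (auto simp: c_def matrix_matrix_mult_def matrix_vector_mult_def vec_eq_iff)
  have "c (axis z 1) $ z $ z = 1" by (simp add: c_def)
  then have "\<alpha> (c (axis z 1)) \<noteq> 0" using inj[of "c (axis z 1)"] by auto
  then obtain u where u: "\<alpha> (c (axis z 1)) *v u \<noteq> 0"
    by (metis matrix_eq matrix_vector_mult_0)
  define f where "f x = \<alpha> (c x) *v u" for x
  have lin_f: "linear f"
    by (rule linearI) (simp_all add: f_def linear_add[OF lin_c] linear_add[OF lin] linear_scale[OF lin_c]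
        linear_scale[OF lin] matrix_vector_mult_add_rdistrib scaleR_matrix_vector_assoc)
  have f_mult: "f (A *v x) = \<alpha> A *v f x" for A x
    by (simp add: f_def A_c[symmetric] mul matrix_vector_mul_assoc)
  have f_inj: "x = 0" if "f x = 0" for x
  proof (rule ccontr)
    assume "x \<noteq> 0"
    define q where "q = x \<bullet> x"
    have q: "q \<noteq> 0" "(\<Sum>j\<in>UNIV. x $ j * x $ j) = q"
      using \<open>x \<noteq> 0\<close> by (simp add: q_def) (simp add: q_def inner_vec_def)
    \<comment> \<open>The rank one matrix \<open>e_z x^T / (x . x)\<close> sends \<open>x\<close> to
      \<open>e_z\<close>, so a nonzero \<open>x\<close> killed by \<open>f\<close> would force
      \<open>f e_z = 0\<close>. This is the simplicity of the standard module.\<close>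
    define A where "A = ((\<chi> i j. axis z 1 $ i / q * x $ j) :: real^'n^'n)"
    have "(A *v x) $ i = axis z 1 $ i / q * (\<Sum>j\<in>UNIV. x $ j * x $ j)" for i
      unfolding A_def matrix_vector_mult_def sum_distrib_left by (simp add: mult.assoc)
    then have "A *v x = axis z 1" unfolding q(2) using q(1) by (simp add: vec_eq_iff)
    then have "f (axis z 1) = 0" using f_mult[of A x] that by simp
    then show False using u by (simp add: f_def)
  qed
  define P where "P = matrix f"
  have P: "P *v x = f x" for x by (simp add: P_def lin_f matrix_works linear_matrix_vector_mul_eq)
  have "inj ((*v) P)"
    using lin_f f_inj by (simp add: P linear_injective_0)
  then obtain P' where "P' ** P = mat 1" using matrix_left_invertible_injective[of P] by auto
  then have nz: "det P \<noteq> 0" by (rule right_inverse_det_nz)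
  have "\<alpha> A = P ** A ** matrix_inv P" for A
  proof -
    have "P ** A = \<alpha> A ** P"
      by (simp add: matrix_eq P f_mult matrix_vector_mul_assoc[symmetric])
    then show ?thesis using matrix_inv_works(1)[OF nz] by (metis matrix_mul_assoc matrix_mul_rid)
  qed
  with nz show ?thesis by blast
qed

text \<open>Covers the unit group and the square roots alike: each is \<open>S \<times> S\<close>
  for a set \<open>S\<close> with two sign classes, whence the common number four.\<close>

lemma components_Times_sign_partition:
  fixes F :: "real \<Rightarrow> 'a::topological_space set"
  assumes conn: "\<And>s. s \<in> {1, -1} \<Longrightarrow> connected (F s)" and ne: "\<And>s. s \<in> {1, -1} \<Longrightarrow> F s \<noteq> {}"
    and op: "\<And>s. s \<in> {1, -1} \<Longrightarrow> openin (top_of_set S) (F s)"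
    and disj: "F 1 \<inter> F (-1) = {}" and cover: "S = F 1 \<union> F (-1)"
  shows "components (S \<times> S) = (\<lambda>(s, t). F s \<times> F t) ` ({1, -1} \<times> {1, -1})"
    and "inj_on (\<lambda>(s, t). F s \<times> F t) ({1, -1} \<times> {1, -1})"
proof -
  let ?F = "\<lambda>(s, t). F s \<times> F t" and ?I = "{1, -1 :: real} \<times> {1, -1 :: real}"
  have 1: "connected (?F i)" if "i \<in> ?I" for i
    using that conn by (cases i) (force simp: connected_Times)
  have 2: "?F i \<noteq> {}" if "i \<in> ?I" for i
    using that ne by (cases i) force
  have 3: "openin (top_of_set (S \<times> S)) (?F i)" if "i \<in> ?I" for i
    using that op by (cases i) (force intro: openin_Times)
  have 4: "?F i \<inter> ?F j = {}" if "i \<in> ?I" "j \<in> ?I" "i \<noteq> j" for i j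
    using that disj by auto
  have 5: "(\<Union>i\<in>?I. ?F i) = S \<times> S" using cover by auto
  show "components (S \<times> S) = ?F ` ?I" "inj_on ?F ?I"
    by (rule components_eq_open_partition[of ?I ?F "S \<times> S", OF 1 2 3 4 5]; assumption)+
qed

subsection \<open>The algebra and its automorphisms\<close>

lemma mat_1_neq_0 [simp]: "(mat 1 :: 'a::zero_neq_one^'n^'n) \<noteq> 0"
  by (auto simp: mat_def vec_eq_iff)

lemma amult_simps [simp]: "(f, f') \<star> (g, g') = (f ** g, f' ** g')"
  by (simp add: amult_def)

lemma amult_assoc: "x \<star> (y \<star> z) = x \<star> y \<star> (z :: 'n::finite alg)"
  by (simp add: amult_def matrix_mul_assoc)

lemma amult_one [simp]: "aone \<star> x = x" "x \<star> aone = (x :: 'n::finite alg)"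
  by (simp_all add: amult_def aone_def)

lemma bounded_bilinear_amult: "bounded_bilinear ((\<star>) :: 'n::finite alg \<Rightarrow> _)"
  unfolding bilinear_conv_bounded_bilinear[symmetric] bilinear_def
  by (auto intro!: linearI simp: amult_def matrix_add_ldistrib matrix_add_rdistrib scalar_matrix_assoc matrix_scalar_ac)

lemma GA_iff: "(g, g') \<in> GA \<longleftrightarrow> det g \<noteq> 0 \<and> det g' \<noteq> 0"
proof
  assume "(g, g') \<in> GA"
  then show "det g \<noteq> 0 \<and> det g' \<noteq> 0"
    using right_inverse_det_nz by (fastforce simp: GA_def aone_def amult_def)
next
  assume "det g \<noteq> 0 \<and> det g' \<noteq> 0"
  then have "(g, g') \<star> (matrix_inv g, matrix_inv g') = aone \<and> (matrix_inv g, matrix_inv g') \<star> (g, g') = aone"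
    by (simp add: aone_def matrix_inv_works)
  then show "(g, g') \<in> GA" unfolding GA_def by blast
qed

lemma sqrt_set_eq: "sqrt_set = {K. K ** K = - mat 1} \<times> {K. K ** K = - mat 1}"
  by (auto simp: sqrt_set_def aone_def amult_def)

abbreviation sign_pairs :: "(real \<times> real) set" where
  "sign_pairs \<equiv> {1, -1} \<times> {1, -1}"

lemma components_GA:
  assumes "CARD('n::finite) \<ge> 2"
  shows "components (GA :: 'n alg set) = (\<lambda>(s, t). {g. s * det g > 0} \<times> {g. t * det g > 0}) ` sign_pairs"
    and "inj_on (\<lambda>(s, t). {g :: real^'n^'n. s * det g > 0} \<times> {g :: real^'n^'n. t * det g > 0}) sign_pairs"
proof -
  have conn: "connected {g :: real^'n^'n. s * det g > 0}" if "s \<in> {1, -1}" for s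
    using that connected_GL_sign(1,2)[OF assms] by auto
  have ne: "{g :: real^'n^'n. s * det g > 0} \<noteq> {}" if "s \<in> {1, -1}" for s
    using that connected_GL_sign(3)[OF assms] by (auto intro: exI[of _ "mat 1"])
  have "open {g :: real^'n^'n. s * det g > 0}" for s
    by (intro open_Collect_less continuous_intros)
  then have op: "openin (top_of_set {g :: real^'n^'n. det g \<noteq> 0}) {g. s * det g > 0}" for s
    by (intro open_subset) auto
  have GA: "(GA :: 'n alg set) = {g. det g \<noteq> 0} \<times> {g. det g \<noteq> 0}" by (auto simp: GA_iff)
  show "components (GA :: 'n alg set) = (\<lambda>(s, t). {g. s * det g > 0} \<times> {g. t * det g > 0}) ` sign_pairs"
    "inj_on (\<lambda>(s, t). {g :: real^'n^'n. s * det g > 0} \<times> {g :: real^'n^'n. t * det g > 0}) sign_pairs"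
    unfolding GA by (rule components_Times_sign_partition[where F = "\<lambda>s. {g. s * det g > 0}", OF conn ne op]; force)+
qed

lemma components_sqrt_set:
  fixes J :: "real^'n^'n"
  assumes J: "J ** J = - mat 1" and card: "CARD('n) \<ge> 2" "CARD('n) = 2 * d"
  shows "components (sqrt_set :: 'n alg set) = (\<lambda>(s, t). conj_orbit J s \<times> conj_orbit J t) ` sign_pairs"
    and "inj_on (\<lambda>(s, t). conj_orbit J s \<times> conj_orbit J t) sign_pairs"
proof -
  have ne: "conj_orbit J s \<noteq> {}" if "s \<in> {1, -1}" for s
  proof -
    have "\<exists>g :: real^'n^'n. s * det g > 0"
      using that connected_GL_sign(3)[OF card(1)] by (auto intro: exI[of _ "mat 1"])
    then show ?thesis by (auto simp: conj_orbit_def)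
  qed
  have conn: "connected (conj_orbit J s)" if "s \<in> {1, -1}" for s
    using that connected_conj_orbit[OF card(1), of s J] by auto
  note op = openin_conj_orbit[OF J]
  note un = sqrt_minus_one_eq_orbits[OF J card(2)]
  note dj = conj_orbit_disjoint[OF J]
  show "components (sqrt_set :: 'n alg set) = (\<lambda>(s, t). conj_orbit J s \<times> conj_orbit J t) ` sign_pairs"
    "inj_on (\<lambda>(s, t). conj_orbit J s \<times> conj_orbit J t) sign_pairs"
    unfolding sqrt_set_eq by (rule components_Times_sign_partition[where F = "conj_orbit J", OF conn ne op dj un]; assumption)+
qed

section \<open>Normal form of the automorphisms\<close>

text \<open>The conjugators are indexed by the target factor, and the exchange, if any, comes first.
  Hence composing after an exchange pairs \<open>g\<close> with \<open>h'\<close> and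
  \<open>g'\<close> with \<open>h\<close>.\<close>

definition alg_aut :: "real^'n^'n \<Rightarrow> real^'n^'n \<Rightarrow> bool \<Rightarrow> 'n::finite alg \<Rightarrow>\<^sub>L 'n alg" where
  "alg_aut g g' e = Blinfun (\<lambda>x. if e then (g ** snd x ** matrix_inv g, g' ** fst x ** matrix_inv g')
     else (g ** fst x ** matrix_inv g, g' ** snd x ** matrix_inv g'))"

lemma alg_aut_apply:
  "blinfun_apply (alg_aut g g' e) x = (if e then (g ** snd x ** matrix_inv g, g' ** fst x ** matrix_inv g')
     else (g ** fst x ** matrix_inv g, g' ** snd x ** matrix_inv g'))"
  unfolding alg_aut_def
  by (subst bounded_linear_Blinfun_apply)
     (auto simp: linear_conv_bounded_linear[symmetric] matrix_add_ldistrib matrix_add_rdistrib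
       scalar_matrix_assoc matrix_scalar_ac intro!: linearI)

lemma alg_aut_compose:
  assumes "det g \<noteq> 0" "det g' \<noteq> 0" "det h \<noteq> 0" "det h' \<noteq> 0"
  shows "alg_aut g g' e o\<^sub>L alg_aut h h' e' =
    (if e then alg_aut (g ** h') (g' ** h) (\<not> e') else alg_aut (g ** h) (g' ** h') e')"
  using assms by (intro blinfun_eqI) (auto simp: alg_aut_apply matrix_inv_mult matrix_mul_assoc)

lemma alg_aut_id: "alg_aut (mat 1) (mat 1) False = id_blinfun"
  by (intro blinfun_eqI) (simp add: alg_aut_apply matrix_inv_unique[of "mat 1" "mat 1"])

lemma alg_aut_inverse:
  assumes "det g \<noteq> 0" "det g' \<noteq> 0"
  obtains h h' where "det h \<noteq> 0" "det h' \<noteq> 0"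
    "alg_aut g g' e o\<^sub>L alg_aut h h' e = id_blinfun" "alg_aut h h' e o\<^sub>L alg_aut g g' e = id_blinfun"
proof (cases e)
  case True
  \<comment> \<open>With the exchange, \<open>g\<close> is composed with the second conjugator, so
    the inverse conjugators appear in swapped order.\<close>
  show ?thesis
    by (rule that[of "matrix_inv g'" "matrix_inv g"])
       (use assms in \<open>auto simp: True alg_aut_compose det_matrix_inv matrix_inv_works alg_aut_id\<close>)
next
  case False
  show ?thesis
    by (rule that[of "matrix_inv g" "matrix_inv g'"])
       (use assms in \<open>auto simp: False alg_aut_compose det_matrix_inv matrix_inv_works alg_aut_id\<close>)
qed

lemma alg_aut_in_Aut:
  fixes g g' :: "real^'n^'n"
  assumes nz: "det g \<noteq> 0" "det g' \<noteq> 0"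
  shows "alg_aut g g' e \<in> Aut"
proof -
  obtain h h' where "alg_aut g g' e o\<^sub>L alg_aut h h' e = id_blinfun" "alg_aut h h' e o\<^sub>L alg_aut g g' e = id_blinfun"
    using alg_aut_inverse[OF nz] by metis
  then have "alg_aut g g' e (alg_aut h h' e x) = x" "alg_aut h h' e (alg_aut g g' e x) = x" for x
    by (metis blinfun_apply_blinfun_compose blinfun_apply_id_blinfun id_apply)+
  then have "bij (blinfun_apply (alg_aut g g' e))"
    by (intro o_bij[of "blinfun_apply (alg_aut h h' e)"]) (auto simp: fun_eq_iff)
  moreover have "g ** x ** matrix_inv g ** (g ** y ** matrix_inv g) = g ** (x ** y) ** matrix_inv g"
    if "det g \<noteq> 0" for g x y :: "real^'n^'n"
  proof -
    have "g ** x ** matrix_inv g ** (g ** y ** matrix_inv g) = g ** x ** (matrix_inv g ** g) ** y ** matrix_inv g"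
      by (simp add: matrix_mul_assoc)
    then show ?thesis using that by (simp add: matrix_inv_works matrix_mul_assoc)
  qed
  ultimately show ?thesis
    using nz by (auto simp: Aut_def alg_aut_apply aone_def amult_def matrix_inv_works)
qed

text \<open>A map fixing both central idempotents preserves the ideals they generate, that is the
  two factors, and on each of them the matrix algebra case applies.\<close>

lemma inner_of_fixed_idempotents:
  fixes F :: "'n::finite alg \<Rightarrow> 'n alg"
  assumes lin: "linear F" and mul: "\<And>x y. F (x \<star> y) = F x \<star> F y" and inj: "\<And>x. F x = 0 \<Longrightarrow> x = 0"
    and 1: "F (mat 1, 0) = (mat 1, 0)" and 2: "F (0, mat 1) = (0, mat 1)"
  shows "\<exists>g g'. det g \<noteq> 0 \<and> det g' \<noteq> 0 \<and> (\<forall>x. F x = (g ** fst x ** matrix_inv g, g' ** snd x ** matrix_inv g'))"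
proof -
  have F1: "F (f, 0) = (fst (F (f, 0)), 0)" for f
    using mul[of "(mat 1, 0)" "(f, 0)"] by (simp add: 1 amult_def prod_eq_iff)
  have F2: "F (0, f) = (0, snd (F (0, f)))" for f
    using mul[of "(0, mat 1)" "(0, f)"] by (simp add: 2 amult_def prod_eq_iff)
  have F_eq: "F x = (fst (F (fst x, 0)), snd (F (0, snd x)))" for x
  proof -
    have "F x = F (fst x, 0) + F (0, snd x)" by (simp add: linear_add[OF lin, symmetric])
    then show ?thesis by (subst (asm) F1, subst (asm) F2) simp
  qed
  have "\<exists>P. det P \<noteq> 0 \<and> (\<forall>A. fst (F (A, 0)) = P ** A ** matrix_inv P)"
  proof (rule matrix_algebra_hom_inner)
    show "linear (\<lambda>A. fst (F (A, 0)))"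
      by (rule linearI) (simp_all add: linear_add[OF lin, symmetric] linear_scale[OF lin, symmetric] fst_add[symmetric] fst_scaleR[symmetric] del: fst_add fst_scaleR)
    show "fst (F (A ** B, 0)) = fst (F (A, 0)) ** fst (F (B, 0))" for A B
      using mul[of "(A, 0)" "(B, 0)"] by (simp add: amult_def)
    show "A = 0" if "fst (F (A, 0)) = 0" for A
      using inj[of "(A, 0)"] F1[of A] that by (simp add: zero_prod_def)
  qed
  moreover have "\<exists>P. det P \<noteq> 0 \<and> (\<forall>A. snd (F (0, A)) = P ** A ** matrix_inv P)"
  proof (rule matrix_algebra_hom_inner)
    show "linear (\<lambda>A. snd (F (0, A)))"
      by (rule linearI) (simp_all add: linear_add[OF lin, symmetric] linear_scale[OF lin, symmetric] snd_add[symmetric] snd_scaleR[symmetric] del: snd_add snd_scaleR)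
    show "snd (F (0, A ** B)) = snd (F (0, A)) ** snd (F (0, B))" for A B
      using mul[of "(0, A)" "(0, B)"] by (simp add: amult_def)
    show "A = 0" if "snd (F (0, A)) = 0" for A
      using inj[of "(0, A)"] F2[of A] that by (simp add: zero_prod_def)
  qed
  ultimately show ?thesis using F_eq by metis
qed

text \<open>\<open>(1, 0)\<close> is a central idempotent other than zero and the unit, and so is
  its image. Scalar components leave only \<open>(1, 0)\<close> and \<open>(0, 1)\<close>; in the
  second case, precomposing with the exchange leads back to the first.\<close>

lemma Aut_eq: "(Aut :: ('n::finite alg \<Rightarrow>\<^sub>L 'n alg) set) = {alg_aut g g' e | g g' e. det g \<noteq> 0 \<and> det g' \<noteq> 0}" (is "_ = ?R")
proof
  show "Aut \<subseteq> ?R"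
  proof
    fix \<phi> :: "'n alg \<Rightarrow>\<^sub>L 'n alg" assume \<phi>: "\<phi> \<in> Aut"
    then have bij: "bij \<phi>" and one: "\<phi> aone = aone" and mul: "\<And>x y. \<phi> (x \<star> y) = \<phi> x \<star> \<phi> y"
      by (auto simp: Aut_def)
    have inj: "x = 0" if "\<phi> x = 0" for x
      using injD[OF bij_is_inj[OF bij], of x 0] that by (simp add: blinfun.zero_right)
    define p where "p = \<phi> (mat 1, 0)"
    have pp: "p \<star> p = p" using mul[of "(mat 1, 0)" "(mat 1, 0)"] by (simp add: p_def)
    have central: "p \<star> y = y \<star> p" for y
    proof -
      obtain x where "y = \<phi> x" using bij_is_surj[OF bij] by (metis surjD)
      moreover have "(mat 1, 0) \<star> x = x \<star> (mat 1, 0)" by (simp add: amult_def)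
      ultimately show ?thesis unfolding p_def by (metis mul)
    qed
    have "\<exists>c. fst p = c *\<^sub>R mat 1"
    proof (rule central_matrix)
      show "fst p ** B = B ** fst p" for B using central[of "(B, 0)"] by (simp add: amult_def)
    qed
    moreover have "\<exists>c. snd p = c *\<^sub>R mat 1"
    proof (rule central_matrix)
      show "snd p ** B = B ** snd p" for B using central[of "(0, B)"] by (simp add: amult_def)
    qed
    ultimately obtain a b where ab: "fst p = a *\<^sub>R mat 1" "snd p = b *\<^sub>R mat 1" by blast
    have id: "c *\<^sub>R mat 1 = 0 \<or> c *\<^sub>R mat 1 = (mat 1 :: real^'n^'n)"
      if "(c *\<^sub>R mat 1) ** (c *\<^sub>R mat 1) = c *\<^sub>R (mat 1 :: real^'n^'n)" for c
    proof -
      have "(c * c) *\<^sub>R (mat 1 :: real^'n^'n) = c *\<^sub>R mat 1"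
        using that by (simp add: matrix_scalar_ac scalar_matrix_assoc[symmetric])
      \<comment> \<open>\<open>undefined\<close> is just some index: any diagonal entry gives the
        scalar equation.\<close>
      from arg_cong[OF this, of "\<lambda>M. M $ undefined $ undefined"] have "c * c = c"
        unfolding mat_def vector_scaleR_component vec_lambda_beta by simp
      then have "c = 0 \<or> c = 1" by simp
      then show ?thesis by (elim disjE) simp_all
    qed
    have "fst p = 0 \<or> fst p = mat 1" "snd p = 0 \<or> snd p = mat 1"
    proof -
      have "fst p ** fst p = fst p" "snd p ** snd p = snd p" using pp by (simp_all add: amult_def prod_eq_iff)
      then show "fst p = 0 \<or> fst p = mat 1" "snd p = 0 \<or> snd p = mat 1"
        using id[of a] id[of b] unfolding ab by blast+
    qed
    moreover have "p \<noteq> 0" using inj[of "(mat 1, 0)"] by (auto simp: p_def zero_prod_def)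
    moreover have "p \<noteq> aone"
    proof
      assume "p = aone"
      then have "\<phi> ((mat 1, 0) - aone) = 0" using one by (simp add: p_def blinfun.diff_right)
      from inj[OF this] show False by (simp add: aone_def zero_prod_def)
    qed
    ultimately consider "p = (mat 1, 0)" | "p = (0, mat 1)"
      by (cases p) (auto simp: aone_def zero_prod_def)
    then show "\<phi> \<in> {alg_aut g g' e | g g' e. det g \<noteq> 0 \<and> det g' \<noteq> 0}"
    proof cases
      case 1
      have "\<phi> (0, mat 1) = \<phi> (aone - (mat 1, 0))" by (simp add: aone_def)
      also have "\<dots> = (0, mat 1)" using 1 one by (simp add: blinfun.diff_right p_def) (simp add: aone_def)
      finally have 2: "\<phi> (0, mat 1) = (0, mat 1)" .
      obtain g g' where "det g \<noteq> 0" "det g' \<noteq> 0" "\<And>x. \<phi> x = (g ** fst x ** matrix_inv g, g' ** snd x ** matrix_inv g')"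
        using inner_of_fixed_idempotents[of "blinfun_apply \<phi>", OF _ mul inj 1[unfolded p_def] 2]
        by (auto simp: bounded_linear.linear[OF blinfun.bounded_linear_right])
      moreover from this have "\<phi> = alg_aut g g' False" by (intro blinfun_eqI) (simp add: alg_aut_apply)
      ultimately show ?thesis by blast
    next
      case 2
      let ?F = "\<lambda>x. \<phi> (prod.swap x)"
      have "\<phi> (0, mat 1) = \<phi> (aone - (mat 1, 0))" by (simp add: aone_def)
      also have "\<dots> = (mat 1, 0)" using 2 one by (simp add: blinfun.diff_right p_def) (simp add: aone_def)
      finally have *: "?F (mat 1, 0) = (mat 1, 0)" by simp
      have lin: "linear ?F"
        by (rule linearI) (simp_all add: blinfun.add_right[symmetric] blinfun.scaleR_right[symmetric] prod.swap_def)
      have mul': "?F (x \<star> y) = ?F x \<star> ?F y" for x y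
        unfolding mul[symmetric] by (simp add: amult_def)
      have inj': "x = 0" if "?F x = 0" for x
        using inj[OF that] by (metis swap_swap swap_simp zero_prod_def)
      have **: "?F (0, mat 1) = (0, mat 1)" using 2 by (simp add: p_def)
      obtain g g' where g: "det g \<noteq> 0" "det g' \<noteq> 0"
          "\<And>x. ?F x = (g ** fst x ** matrix_inv g, g' ** snd x ** matrix_inv g')"
        using inner_of_fixed_idempotents[of ?F, OF lin mul' inj' * **] by blast
      moreover have "\<phi> = alg_aut g g' True"
      proof (rule blinfun_eqI)
        show "\<phi> x = alg_aut g g' True x" for x
          using g(3)[of "prod.swap x"] by (simp add: alg_aut_apply)
      qed
      ultimately show ?thesis by blast
    qed
  qed
qed (auto intro: alg_aut_in_Aut)

lemma Inn_eq: "(Inn :: ('n::finite alg \<Rightarrow>\<^sub>L 'n alg) set) = {alg_aut g g' False | g g'. det g \<noteq> 0 \<and> det g' \<noteq> 0}" (is "_ = ?R")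
proof
  show "Inn \<subseteq> ?R"
  proof
    fix \<phi> :: "'n alg \<Rightarrow>\<^sub>L 'n alg" assume "\<phi> \<in> Inn"
    then obtain a b where ab: "a \<star> b = aone" "b \<star> a = aone" "\<And>x. \<phi> x = b \<star> x \<star> a"
      by (auto simp: Inn_def)
    have inv: "fst b ** fst a = mat 1" "snd b ** snd a = mat 1"
      using ab(2) by (auto simp: amult_def aone_def)
    \<comment> \<open>Inner automorphisms are written \<open>b x a\<close> with \<open>b\<close>
      inverse to \<open>a\<close>, so the conjugators in normal form are the components of
      \<open>b\<close>.\<close>
    then have "\<phi> = alg_aut (fst b) (snd b) False"
      by (intro blinfun_eqI) (simp add: ab alg_aut_apply amult_def matrix_inv_unique)
    then show "\<phi> \<in> {alg_aut g g' False | g g'. det g \<noteq> 0 \<and> det g' \<noteq> 0}"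
      using right_inverse_det_nz(1)[OF inv(1)] right_inverse_det_nz(1)[OF inv(2)] by blast
  qed
  show "?R \<subseteq> Inn"
  proof clarify
    fix g g' :: "real^'n^'n" assume nz: "det g \<noteq> 0" "det g' \<noteq> 0"
    then show "alg_aut g g' False \<in> Inn"
      unfolding Inn_def
      by (intro CollectI exI[of _ "(matrix_inv g, matrix_inv g')"] exI[of _ "(g, g')"])
         (simp add: aone_def matrix_inv_works alg_aut_apply amult_def)
  qed
qed

lemma conj_in_orbit_iff:
  fixes J :: "real^'n^'n"
  assumes J: "J ** J = - mat 1" and g: "det g \<noteq> 0" and s: "s \<in> {1, -1}"
  shows "g ** J ** matrix_inv g \<in> conj_orbit J s \<longleftrightarrow> s * det g > 0"
proof
  assume *: "g ** J ** matrix_inv g \<in> conj_orbit J s"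
  have "g ** J ** matrix_inv g \<in> conj_orbit J (-s)" if "(- s) * det g > 0"
    using that unfolding conj_orbit_def by blast
  then have "\<not> (- s) * det g > 0"
    using * conj_orbit_disjoint[OF J] s by auto
  then show "s * det g > 0" using g s by auto
qed (auto simp: conj_orbit_def)

section \<open>The eight pieces of the automorphism group\<close>

text \<open>As the image of a product of sign classes each piece is visibly connected. That the
  pieces are disjoint is not visible, since different conjugators may give the same
  automorphism.\<close>

definition aut_piece :: "real \<Rightarrow> real \<Rightarrow> bool \<Rightarrow> ('n::finite alg \<Rightarrow>\<^sub>L 'n alg) set" where
  "aut_piece s t e = {alg_aut g g' e | g g'. s * det g > 0 \<and> t * det g' > 0}"

lemma alg_aut_mem_piece:
  assumes "det g \<noteq> 0" "det g' \<noteq> 0"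
  shows "alg_aut g g' e \<in> aut_piece (sgn (det g)) (sgn (det g')) e"
proof -
  have "sgn x * x > 0" if "x \<noteq> 0" for x :: real
    using that by (cases x "0 :: real" rule: linorder_cases) auto
  then show ?thesis using assms unfolding aut_piece_def by blast
qed

text \<open>A description free of conjugators. The orbits met by the image of \<open>(J, J)\<close>
  show the two signs; a diagonal entry of the first component of the image of \<open>omega\<close>
  is 1 or -1 and shows whether the factors are exchanged. Disjointness and openness of the pieces
  both follow.\<close>

lemma aut_piece_eq:
  fixes J :: "real^'n^'n"
  assumes J: "J ** J = - mat 1" and st: "s \<in> {1, -1}" "t \<in> {1, -1}"
  shows "aut_piece s t e = {\<phi> \<in> Aut. blinfun_apply \<phi> (J, J) \<in> conj_orbit J s \<times> conj_orbit J t \<and>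
      fst (blinfun_apply \<phi> omega) $ i $ i * (if e then -1 else 1) > 0}" (is "_ = ?R")
proof
  have omega: "fst (alg_aut g g' e omega) $ i $ i = (if e then -1 else 1)"
    if "det g \<noteq> 0" for g g' e
    using that by (simp add: alg_aut_apply omega_def matrix_ring_simps matrix_inv_works) (simp add: mat_def)
  show "aut_piece s t e \<subseteq> ?R"
  proof
    fix \<phi> :: "'n alg \<Rightarrow>\<^sub>L 'n alg" assume "\<phi> \<in> aut_piece s t e"
    then obtain g g' where g: "\<phi> = alg_aut g g' e" "s * det g > 0" "t * det g' > 0"
      by (auto simp: aut_piece_def)
    then have nz: "det g \<noteq> 0" "det g' \<noteq> 0" by auto
    show "\<phi> \<in> ?R"
      using alg_aut_in_Aut[OF nz] omega[OF nz(1)] conj_in_orbit_iff[OF J nz(1) st(1)]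
        conj_in_orbit_iff[OF J nz(2) st(2)] g by (simp add: alg_aut_apply)
  qed
  show "?R \<subseteq> aut_piece s t e"
  proof
    fix \<phi> assume R: "\<phi> \<in> ?R"
    then obtain g g' e' where g: "\<phi> = alg_aut g g' e'" "det g \<noteq> 0" "det g' \<noteq> 0"
      by (auto simp: Aut_eq)
    have "e' = e" using R omega[OF g(2), of g' e'] by (auto simp: g(1) split: if_splits)
    moreover have "s * det g > 0" "t * det g' > 0"
      using R conj_in_orbit_iff[OF J g(2) st(1)] conj_in_orbit_iff[OF J g(3) st(2)]
      by (auto simp: g(1) alg_aut_apply split: if_splits)
    ultimately show "\<phi> \<in> aut_piece s t e" using g(1) by (auto simp: aut_piece_def)
  qed
qed

lemma continuous_on_blinfun_eval: "continuous_on S (\<lambda>\<phi>. blinfun_apply \<phi> x)"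
  by (intro continuous_intros)

lemma openin_aut_piece:
  fixes J :: "real^'n^'n"
  assumes J: "J ** J = - mat 1" and st: "s \<in> {1, -1}" "t \<in> {1, -1}"
  shows "openin (top_of_set Aut) (aut_piece s t e :: ('n alg \<Rightarrow>\<^sub>L 'n alg) set)"
proof -
  obtain i :: 'n where True by simp
  let ?A = "Aut :: ('n alg \<Rightarrow>\<^sub>L 'n alg) set"
  \<comment> \<open>The orbits are open only relative to the set of square roots, so evaluation at
    \<open>(J, J)\<close> has to be viewed as a map into that set.\<close>
  have "\<phi> (J, J) \<in> sqrt_set" if "\<phi> \<in> ?A" for \<phi>
  proof -
    have "\<phi> (J, J) \<star> \<phi> (J, J) = \<phi> ((J, J) \<star> (J, J))" using that by (simp add: Aut_def)
    also have "(J, J) \<star> (J, J) = - aone" by (simp add: J aone_def)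
    also have "\<phi> (- aone) = - aone" using that by (simp add: Aut_def blinfun.minus_right)
    finally show ?thesis by (simp add: sqrt_set_def)
  qed
  moreover have "openin (top_of_set sqrt_set) (conj_orbit J s \<times> conj_orbit J t)"
    unfolding sqrt_set_eq by (intro openin_Times openin_conj_orbit J)
  ultimately have 1: "openin (top_of_set ?A) (?A \<inter> (\<lambda>\<phi>. blinfun_apply \<phi> (J, J)) -` (conj_orbit J s \<times> conj_orbit J t))"
    by (intro continuous_openin_preimage[of _ _ sqrt_set] continuous_on_blinfun_eval) auto
  have 2: "openin (top_of_set ?A) (?A \<inter> (\<lambda>\<phi>. fst (blinfun_apply \<phi> omega) $ i $ i * (if e then -1 else 1)) -` {0<..})"
    by (intro continuous_openin_preimage_gen continuous_intros continuous_on_fst continuous_on_blinfun_eval)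
  have "aut_piece s t e = (?A \<inter> (\<lambda>\<phi>. blinfun_apply \<phi> (J, J)) -` (conj_orbit J s \<times> conj_orbit J t)) \<inter>
      (?A \<inter> (\<lambda>\<phi>. fst (blinfun_apply \<phi> omega) $ i $ i * (if e then -1 else 1)) -` {0<..})"
    by (subst aut_piece_eq[OF J st, of e i]) auto
  with openin_Int[OF 1 2] show ?thesis by simp
qed

lemma connected_aut_piece:
  assumes "CARD('n::finite) \<ge> 2" "s \<in> {1, -1}" "t \<in> {1, -1}"
  shows "connected (aut_piece s t e :: ('n alg \<Rightarrow>\<^sub>L 'n alg) set)"
proof -
  let ?S = "{g :: real^'n^'n. s * det g > 0} \<times> {g :: real^'n^'n. t * det g > 0}"
  have "connected {g :: real^'n^'n. s * det g > 0}" if "s \<in> {1, -1}" for s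
    using that connected_GL_sign(1,2)[OF assms(1)] by auto
  then have "connected ?S" using assms(2,3) by (intro connected_Times) auto
  moreover have "continuous_on ?S (\<lambda>p. alg_aut (fst p) (snd p) e)"
  proof (rule continuous_on_blinfun_componentwise)
    fix x :: "'n alg"
    have 1: "continuous_on ?S (\<lambda>p. matrix_inv (fst p))" "continuous_on ?S (\<lambda>p. matrix_inv (snd p))"
      by (intro continuous_on_matrix_inv continuous_intros; auto)+
    show "continuous_on ?S (\<lambda>p. alg_aut (fst p) (snd p) e x)"
      unfolding alg_aut_apply by (cases e; simp; intro continuous_intros 1)
  qed
  moreover have "aut_piece s t e = (\<lambda>p. alg_aut (fst p) (snd p) e) ` ?S"
    by (force simp: aut_piece_def)
  ultimately show ?thesis by (simp add: connected_continuous_image)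
qed

abbreviation aut_labels :: "(real \<times> real \<times> bool) set" where
  "aut_labels \<equiv> {1, -1} \<times> {1, -1} \<times> UNIV"

lemma aut_piece_disjoint:
  fixes \<phi> :: "'n::finite alg \<Rightarrow>\<^sub>L 'n alg"
  assumes card: "CARD('n) = 2 * d"
    and "\<phi> \<in> aut_piece s t e" "\<phi> \<in> aut_piece s' t' e'"
    and "(s, t, e) \<in> aut_labels" "(s', t', e') \<in> aut_labels"
  shows "(s, t, e) = (s', t', e' :: bool)"
proof -
  obtain J :: "real^'n^'n" where J: "J ** J = - mat 1" using exists_sqrt_minus_one[OF card] by blast
  have st: "s \<in> {1, -1}" "t \<in> {1, -1}" "s' \<in> {1, -1}" "t' \<in> {1, -1}" using assms(4,5) by auto
  note 1 = assms(2)[unfolded aut_piece_eq[OF J st(1,2), of e undefined]]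
  note 2 = assms(3)[unfolded aut_piece_eq[OF J st(3,4), of e' undefined]]
  have "s = s'" using 1 2 st(1,3) conj_orbit_disjoint[OF J] by auto
  moreover have "t = t'" using 1 2 st(2,4) conj_orbit_disjoint[OF J] by auto
  moreover have "e = e'" using 1 2 by (auto split: if_splits)
  ultimately show ?thesis by simp
qed

lemma components_Aut:
  assumes card: "CARD('n::finite) \<ge> 2" "CARD('n) = 2 * d"
  shows "components (Aut :: ('n alg \<Rightarrow>\<^sub>L 'n alg) set) = (\<lambda>(s, t, e). aut_piece s t e) ` aut_labels"
    and "inj_on (\<lambda>(s, t, e). aut_piece s t e :: ('n alg \<Rightarrow>\<^sub>L 'n alg) set) aut_labels"
proof -
  let ?F = "\<lambda>(s, t, e). aut_piece s t e :: ('n alg \<Rightarrow>\<^sub>L 'n alg) set"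
  obtain J :: "real^'n^'n" where J: "J ** J = - mat 1" using exists_sqrt_minus_one[OF card(2)] by blast
  have ex: "\<exists>g :: real^'n^'n. s * det g > 0" if "s \<in> {1, -1}" for s
    using that connected_GL_sign(3)[OF card(1)] by (auto intro: exI[of _ "mat 1"])
  have 1: "connected (?F i)" if "i \<in> aut_labels" for i
    using that connected_aut_piece[OF card(1)] by (cases i) force
  have 2: "?F i \<noteq> {}" if "i \<in> aut_labels" for i
  proof -
    obtain s t e where i: "i = (s, t, e)" "s \<in> {1, -1}" "t \<in> {1, -1}" using \<open>i \<in> aut_labels\<close> by auto
    show ?thesis using ex[OF i(2)] ex[OF i(3)] by (auto simp: i(1) aut_piece_def)
  qed
  have 3: "openin (top_of_set Aut) (?F i)" if "i \<in> aut_labels" for i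
    using that openin_aut_piece[OF J] by (cases i) force
  have 4: "?F i \<inter> ?F j = {}" if "i \<in> aut_labels" "j \<in> aut_labels" "i \<noteq> j" for i j
    using that aut_piece_disjoint[OF card(2)] by (cases i; cases j) blast
  have 5: "(\<Union>i\<in>aut_labels. ?F i) = Aut"
  proof
    show "(\<Union>i\<in>aut_labels. ?F i) \<subseteq> Aut"
      by (auto simp: aut_piece_def intro!: alg_aut_in_Aut)
    show "Aut \<subseteq> (\<Union>i\<in>aut_labels. ?F i)"
    proof
      fix \<phi> :: "'n alg \<Rightarrow>\<^sub>L 'n alg" assume "\<phi> \<in> Aut"
      then obtain g g' e where g: "\<phi> = alg_aut g g' e" "det g \<noteq> 0" "det g' \<noteq> 0" by (auto simp: Aut_eq)
      then have "\<phi> \<in> ?F (sgn (det g), sgn (det g'), e)" using alg_aut_mem_piece by simp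
      moreover have "(sgn (det g), sgn (det g'), e) \<in> aut_labels" using g by (auto simp: sgn_if)
      ultimately show "\<phi> \<in> (\<Union>i\<in>aut_labels. ?F i)" by blast
    qed
  qed
  show "components (Aut :: ('n alg \<Rightarrow>\<^sub>L 'n alg) set) = ?F ` aut_labels" "inj_on ?F aut_labels"
    by (rule components_eq_open_partition[of aut_labels ?F Aut, OF 1 2 3 4 5]; assumption)+
qed

subsection \<open>The square roots of \<open>-1\<close> form a submanifold\<close>

text \<open>On an open set derivatives depend only on the values there. The inductions below compute
  a derivative on \<open>U\<close> and then replace it by its formula through this lemma.\<close>

lemma Ck_on_cong:
  assumes "open U" "\<And>x. x \<in> U \<Longrightarrow> f x = g x" "Ck_on k f U"
  shows "Ck_on k g U"
  using assms(2,3)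
proof (induction k arbitrary: f g)
  case 0
  then show ?case by (simp cong: continuous_on_cong)
next
  case (Suc k)
  have der: "(g has_derivative D) (at x)" if "x \<in> U" "(f has_derivative D) (at x)" for x D
    using has_derivative_transform_within_open[OF that(2) assms(1) that(1)] Suc.prems(1) by blast
  have dif: "f differentiable (at x)" if "x \<in> U" for x using Suc.prems(2) that by simp
  have fd: "frechet_derivative f (at x) = frechet_derivative g (at x)" if "x \<in> U" for x
    using frechet_derivative_at[OF der[OF that]] dif[OF that] by (simp add: frechet_derivative_works)
  have "Ck_on k (\<lambda>x. frechet_derivative g (at x) v) U" for v
    by (rule Suc.IH[of "\<lambda>x. frechet_derivative f (at x) v"]) (use Suc.prems(2) in \<open>simp_all add: fd\<close>)
  moreover have "g differentiable (at x)" if "x \<in> U" for x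
    using dif[OF that] der[OF that] unfolding differentiable_def by blast
  ultimately show ?case by simp
qed

lemma Ck_on_SucD: "Ck_on (Suc k) f U \<Longrightarrow> Ck_on k f U"
proof (induction k arbitrary: f)
  case 0
  then show ?case
    by (auto intro!: continuous_at_imp_continuous_on differentiable_imp_continuous_within)
next
  case (Suc k)
  then show ?case by (metis Ck_on.simps(2))
qed

lemma Ck_on_const: "Ck_on k (\<lambda>x. c) U"
  by (induction k arbitrary: c) (simp_all add: frechet_derivative_const)

lemma Ck_on_add:
  assumes "open U" "Ck_on k f U" "Ck_on k g U"
  shows "Ck_on k (\<lambda>x. f x + g x) U"
  using assms(2,3)
proof (induction k arbitrary: f g)
  case 0
  then show ?case by (simp add: continuous_on_add)
next
  case (Suc k)
  have dif: "f differentiable (at x)" "g differentiable (at x)" if "x \<in> U" for x using Suc.prems that by simp_all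
  have "Ck_on k (\<lambda>x. frechet_derivative (\<lambda>x. f x + g x) (at x) v) U" for v
  proof (rule Ck_on_cong[OF assms(1)])
    show "Ck_on k (\<lambda>x. frechet_derivative f (at x) v + frechet_derivative g (at x) v) U"
      using Suc by simp
    show "frechet_derivative f (at x) v + frechet_derivative g (at x) v = frechet_derivative (\<lambda>x. f x + g x) (at x) v"
      if "x \<in> U" for x
      using frechet_derivative_at[OF has_derivative_add[OF frechet_derivative_works[THEN iffD1, OF dif(1)[OF that]]
            frechet_derivative_works[THEN iffD1, OF dif(2)[OF that]]]] by metis
  qed
  then show ?case using dif by auto
qed

text \<open>By the Leibniz rule, the derivative is a sum of two expressions of the same bilinear
  shape, to which the induction hypothesis applies.\<close>

lemma Ck_on_bilinear:
  assumes B: "bounded_bilinear B" and U: "open U" and "Ck_on k f U" "Ck_on k g U"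
  shows "Ck_on k (\<lambda>x. B (f x) (g x)) U"
  using assms(3,4)
proof (induction k arbitrary: f g)
  case 0
  then show ?case by (simp add: bounded_bilinear.continuous_on[OF B])
next
  case (Suc k)
  have dif: "f differentiable (at x)" "g differentiable (at x)" if "x \<in> U" for x using Suc.prems that by simp_all
  have der: "((\<lambda>x. B (f x) (g x)) has_derivative
      (\<lambda>h. B (f x) (frechet_derivative g (at x) h) + B (frechet_derivative f (at x) h) (g x))) (at x)"
    if "x \<in> U" for x
    using dif[OF that] by (intro bounded_bilinear.FDERIV[OF B]) (simp_all add: frechet_derivative_works)
  have "Ck_on k (\<lambda>x. frechet_derivative (\<lambda>x. B (f x) (g x)) (at x) v) U" for v
  proof (rule Ck_on_cong[OF U])
    show "Ck_on k (\<lambda>x. B (f x) (frechet_derivative g (at x) v) + B (frechet_derivative f (at x) v) (g x)) U"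
      using Suc.prems Suc.prems[THEN Ck_on_SucD] by (intro Ck_on_add[OF U] Suc.IH) simp_all
    show "B (f x) (frechet_derivative g (at x) v) + B (frechet_derivative f (at x) v) (g x) =
        frechet_derivative (\<lambda>x. B (f x) (g x)) (at x) v" if "x \<in> U" for x
      using frechet_derivative_at[OF der[OF that]] by metis
  qed
  then show ?case using der unfolding Ck_on.simps differentiable_def by blast
qed

interpretation amult: bounded_bilinear "(\<star>) :: 'n::finite alg \<Rightarrow> 'n alg \<Rightarrow> 'n alg"
  by (rule bounded_bilinear_amult)

text \<open>A bootstrap: the derivative is a product built from \<open>f\<close> itself, so
  regularity of order \<open>k\<close> yields order \<open>k + 1\<close>. Inversion and its
  translates satisfy this equation.\<close>

lemma Ck_on_inverse_like:
  fixes f :: "'n::finite alg \<Rightarrow> 'n alg"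
  assumes U: "open U" and f: "\<And>x. x \<in> U \<Longrightarrow> (f has_derivative (\<lambda>v. - (f x \<star> v \<star> f x))) (at x)"
  shows "Ck_on k f U"
proof (induction k)
  case 0
  then show ?case using f
    by (auto intro!: continuous_at_imp_continuous_on has_derivative_continuous)
next
  case (Suc k)
  have "Ck_on k (\<lambda>x. frechet_derivative f (at x) v) U" for v
  proof (rule Ck_on_cong[OF U])
    show "Ck_on k (\<lambda>x. (-1) *\<^sub>R (f x \<star> v \<star> f x)) U"
      by (intro Ck_on_bilinear[OF bounded_bilinear_scaleR U] Ck_on_const
          Ck_on_bilinear[OF bounded_bilinear_amult U] Suc)
    show "(-1) *\<^sub>R (f x \<star> v \<star> f x) = frechet_derivative f (at x) v" if "x \<in> U" for x
      using frechet_derivative_at[OF f[OF that]] by (metis scaleR_minus1_left)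
  qed
  then show ?case using f unfolding Ck_on.simps differentiable_def by blast
qed

section \<open>Inversion in the algebra and its derivative\<close>

definition ainv :: "'n::finite alg \<Rightarrow> 'n alg" where
  "ainv x = (matrix_inv (fst x), matrix_inv (snd x))"

lemma ainv_works:
  assumes "a \<in> GA"
  shows "a \<star> ainv a = aone" "ainv a \<star> a = aone"
  using assms by (cases a; simp add: GA_iff ainv_def aone_def matrix_inv_works)+

lemma ainv_unique:
  assumes "a \<star> b = aone"
  shows "a \<in> GA" "ainv a = b"
proof -
  have inv: "fst a ** fst b = mat 1" "snd a ** snd b = mat 1" using assms by (auto simp: amult_def aone_def)
  show "a \<in> GA"
    using inv[THEN right_inverse_det_nz(1)] GA_iff[of "fst a" "snd a"] by simp
  show "ainv a = b"
    using inv[THEN matrix_inv_unique] by (simp add: ainv_def)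
qed

lemma open_GA: "open (GA :: 'n::finite alg set)"
proof -
  have GA: "(GA :: 'n alg set) = {x. det (fst x) \<noteq> 0} \<inter> {x. det (snd x) \<noteq> 0}" by (auto simp: GA_iff)
  show ?thesis unfolding GA by (intro open_Int open_Collect_neq continuous_intros)
qed

lemma continuous_on_ainv: "continuous_on GA ainv"
  unfolding ainv_def
  by (intro continuous_on_Pair continuous_on_matrix_inv continuous_intros) (auto simp: GA_iff)

lemma has_derivative_ainv:
  fixes x :: "'n::finite alg"
  assumes x: "x \<in> GA"
  shows "(ainv has_derivative (\<lambda>v. - (ainv x \<star> v \<star> ainv x))) (at x)"
  unfolding has_derivative_iff_norm
proof
  show "bounded_linear (\<lambda>v. - (ainv x \<star> v \<star> ainv x))"
    by (intro bounded_linear_minus bounded_linear_compose[OF amult.bounded_linear_left amult.bounded_linear_right])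
  obtain K where K: "\<And>a b :: 'n alg. norm (a \<star> b) \<le> norm a * norm b * K" "K > 0"
    using amult.pos_bounded by blast
  \<comment> \<open>The remainder factors by \<open>y^-1 - x^-1 = - y^-1 (y - x) x^-1\<close>. After
    division by \<open>norm (y - x)\<close> it is bounded by a multiple of
    \<open>norm (ainv x - ainv y)\<close>, so continuity of inversion suffices.\<close>
  have diff: "ainv y - ainv x - - (ainv x \<star> (y - x) \<star> ainv x) = (ainv x - ainv y) \<star> (y - x) \<star> ainv x"
    if "y \<in> GA" for y
  proof -
    have "ainv x \<star> x \<star> ainv x = ainv x" "ainv y \<star> y \<star> ainv x = ainv x" "ainv y \<star> x \<star> ainv x = ainv y"
      using ainv_works[OF x] ainv_works[OF that] by (simp_all add: amult_assoc[symmetric])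
    then show ?thesis by (simp add: amult.diff_left amult.diff_right)
  qed
  have ev: "\<forall>\<^sub>F y in at x. norm (norm (ainv y - ainv x - - (ainv x \<star> (y - x) \<star> ainv x)) / norm (y - x))
      \<le> norm (ainv x - ainv y) * K * norm (ainv x) * K"
  proof -
    have "\<forall>\<^sub>F y in at x. y \<in> GA" using open_GA x by (simp add: eventually_at_topological) blast
    then show ?thesis
    proof eventually_elim
      case (elim y)
      have "norm ((ainv x - ainv y) \<star> (y - x) \<star> ainv x) \<le> norm ((ainv x - ainv y) \<star> (y - x)) * norm (ainv x) * K"
        by (rule K)
      also have "\<dots> \<le> norm (ainv x - ainv y) * norm (y - x) * K * norm (ainv x) * K"
        using K by (intro mult_right_mono) auto
      finally show ?case unfolding diff[OF elim] using K(2)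
        by (cases "y = x") (simp_all add: divide_simps mult_ac)
    qed
  qed
  have "(ainv \<longlongrightarrow> ainv x) (at x)"
    using continuous_on_ainv x continuous_on_eq_continuous_at[OF open_GA, of ainv] by (auto simp: isCont_def)
  then have "((\<lambda>y. norm (ainv x - ainv y) * K * norm (ainv x) * K) \<longlongrightarrow> norm (ainv x - ainv x) * K * norm (ainv x) * K) (at x)"
    by (intro tendsto_intros)
  then show "((\<lambda>y. norm (ainv y - ainv x - - (ainv x \<star> (y - x) \<star> ainv x)) / norm (y - x)) \<longlongrightarrow> 0) (at x)"
    by (intro Lim_null_comparison[OF ev]) simp
qed

text \<open>The common shape of the chart and its inverse below: \<open>a = w = j\<close> and
  \<open>u = b = aone\<close> for the former, \<open>a = w = aone\<close> and
  \<open>u = b = j\<close> for the latter.\<close>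

lemma smooth_on_translated_ainv:
  "smooth_on (\<lambda>x. 2 *\<^sub>R (u \<star> ainv (x + a) \<star> w) - b) {x. x + a \<in> GA}"
proof -
  let ?U = "{x. x + a \<in> GA}"
  have "?U = (\<lambda>x. x - a) ` GA" by force
  then have U: "open ?U" using open_translation_subtract[OF open_GA] by simp
  have "((\<lambda>x. ainv (x + a)) has_derivative (\<lambda>v. - (ainv (x + a) \<star> v \<star> ainv (x + a)))) (at x)"
    if "x + a \<in> GA" for x
    using has_derivative_compose[of "\<lambda>x. x + a" "\<lambda>v. v" x UNIV ainv] has_derivative_ainv[OF that]
    by (simp add: has_derivative_add_const)
  then have "Ck_on k (\<lambda>x. ainv (x + a)) ?U" for k by (intro Ck_on_inverse_like U) simp
  then have "Ck_on k (\<lambda>x. 2 *\<^sub>R (u \<star> ainv (x + a) \<star> w) + (- b)) ?U" for k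
    by (intro Ck_on_add[OF U] Ck_on_const Ck_on_bilinear[OF bounded_bilinear_scaleR U]
        Ck_on_bilinear[OF bounded_bilinear_amult U])
  then show ?thesis by (simp add: smooth_on_def)
qed

section \<open>Elements anticommuting with a square root\<close>

text \<open>With \<open>J\<close> also \<open>-J\<close> is a square root of -1, hence similar to
  \<open>J\<close>; a matrix realising the similarity anticommutes with \<open>J\<close>.\<close>

lemma exists_anticommuting_unit:
  fixes j :: "'n::finite alg"
  assumes card: "CARD('n) = 2 * d" and j: "j \<in> sqrt_set"
  obtains t where "t \<in> GA" "t \<star> j = - (j \<star> t)"
proof -
  have anti: "\<exists>P. det P \<noteq> 0 \<and> P ** J = - (J ** P)" if J: "J ** J = - mat 1" for J :: "real^'n^'n"
  proof -
    have "(- J) ** (- J) = - mat 1" using J by (simp add: matrix_minus_left matrix_minus_right)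
    then obtain P where P: "det P \<noteq> 0" "- J = P ** J ** matrix_inv P"
      using sqrt_minus_one_similar[OF J _ card] by blast
    have "P ** J = P ** J ** (matrix_inv P ** P)" using matrix_inv_works[OF P(1)] by simp
    also have "\<dots> = - (J ** P)" by (simp only: matrix_mul_assoc P(2)[symmetric] matrix_minus_left)
    finally show ?thesis using P(1) by blast
  qed
  have "fst j ** fst j = - mat 1" "snd j ** snd j = - mat 1" using j by (auto simp: sqrt_set_eq)
  then obtain P P' where "det P \<noteq> 0" "P ** fst j = - (fst j ** P)" "det P' \<noteq> 0" "P' ** snd j = - (snd j ** P')"
    using anti by metis
  then show thesis by (intro that[of "(P, P')"]) (auto simp: GA_iff amult_def)
qed

text \<open>Left multiplication by an anticommuting unit exchanges anticommutant and commutant, so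
  they have equal dimension. The algebra is their direct sum, and half of \<open>8 d^2\<close> is
  \<open>4 d^2\<close>.\<close>

lemma dim_anticommutant:
  fixes j :: "'n::finite alg"
  assumes card: "CARD('n) = 2 * d" and j: "j \<in> sqrt_set"
  shows "subspace {x. x \<star> j = - (j \<star> x)}" "dim {x. x \<star> j = - (j \<star> x)} = 4 * d\<^sup>2"
proof -
  define L where "L = {x. x \<star> j = - (j \<star> x)}"
  define M where "M = {x. x \<star> j = j \<star> x}"
  have jj: "j \<star> j = - aone" using j by (simp add: sqrt_set_def)
  have jjx: "j \<star> (j \<star> x) = - x" "x \<star> j \<star> j = - x" for x
    by (simp_all add: amult_assoc jj amult.minus_left) (simp add: amult_assoc[symmetric] jj amult.minus_right)
  have L: "subspace L" and M: "subspace M"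
    by (auto simp: L_def M_def subspace_def amult.add_left amult.add_right amult.scaleR_left amult.scaleR_right
        amult.zero_left amult.zero_right)
  obtain t where t: "t \<in> GA" "t \<star> j = - (j \<star> t)" using exists_anticommuting_unit[OF card j] .
  have t_inj: "inj ((\<star>) t)"
    by (rule inj_on_inverseI[of _ "(\<star>) (ainv t)"]) (simp add: amult_assoc ainv_works[OF t(1)])
  have lin: "linear ((\<star>) t)" by (rule linearI) (simp_all add: amult.add_right amult.scaleR_right)
  have dim_t: "dim ((\<star>) t ` S) = dim S" for S
    by (rule dim_image_eq[OF lin]) (use t_inj in \<open>auto intro: inj_on_subset\<close>)
  have tx: "t \<star> x \<star> j = t \<star> (x \<star> j)" "j \<star> (t \<star> x) = - (t \<star> (j \<star> x))" for x
    using t(2) by (simp_all add: amult_assoc amult.minus_left)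
  have "(\<star>) t ` L \<subseteq> M" "(\<star>) t ` M \<subseteq> L"
    by (auto simp: L_def M_def tx amult.minus_right)
  then have "dim L = dim M" using dim_subset dim_t by (metis le_antisym)
  moreover have "L \<inter> M = {0}"
  proof
    show "L \<inter> M \<subseteq> {0}"
    proof
      fix x assume "x \<in> L \<inter> M"
      then have "j \<star> x = - (j \<star> x)" by (auto simp: L_def M_def)
      then have "j \<star> x = 0" by (metis add_eq_0_iff double_eq_0_iff scaleR_2 scaleR_eq_0_iff zero_neq_numeral)
      then show "x \<in> {0}" using jjx(1)[of x] by (simp add: amult.zero_right)
    qed
  qed (simp add: subspace_0 L M)
  moreover have "{x + y | x y. x \<in> L \<and> y \<in> M} = UNIV"
  proof -
    have "\<exists>a b. x = a + b \<and> a \<in> L \<and> b \<in> M" for x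
    proof (intro exI conjI)
      \<comment> \<open>The involution \<open>x \<mapsto> j x j\<close> is 1 on \<open>L\<close> and
        -1 on \<open>M\<close>; the summands are the two eigenprojections of
        \<open>x\<close>.\<close>
      show "x = (1/2) *\<^sub>R (x + j \<star> x \<star> j) + (1/2) *\<^sub>R (x - j \<star> x \<star> j)"
        by (simp add: scaleR_add_right[symmetric] scaleR_2[symmetric])
      show "(1/2) *\<^sub>R (x + j \<star> x \<star> j) \<in> L" "(1/2) *\<^sub>R (x - j \<star> x \<star> j) \<in> M"
        by (simp_all add: L_def M_def amult.scaleR_left amult.scaleR_right amult.add_left amult.add_right
            amult.diff_left amult.diff_right jjx amult_assoc[symmetric])
          (simp_all add: amult_assoc jjx jj amult.minus_left amult.minus_right scaleR_minus_right[symmetric] del: scaleR_minus_right)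
    qed
    then show ?thesis by blast
  qed
  ultimately have "2 * dim L = DIM('n alg)"
    using dim_sums_Int[OF L M] by simp
  then show "subspace {x. x \<star> j = - (j \<star> x)}" "dim {x. x \<star> j = - (j \<star> x)} = 4 * d\<^sup>2"
    using L by (auto simp: L_def card power2_eq_square)
qed

text \<open>The Cayley-type map \<open>x \<mapsto> (x + j)\<^sup>-\<^sup>1 (j - x)\<close> straightens the set of square roots near
  \<open>j\<close> into the space of elements anticommuting with \<open>j\<close>.\<close>

lemma submanifold_sqrt_set:
  assumes card: "CARD('n::finite) = 2 * d"
  shows "submanifold (4 * d\<^sup>2) (sqrt_set :: 'n alg set)"
  unfolding submanifold_def
proof
  fix j :: "'n alg" assume j: "j \<in> sqrt_set"
  have jj: "j \<star> j = - aone" using j by (simp add: sqrt_set_def)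
  have jjx: "j \<star> (j \<star> x) = - x" "x \<star> j \<star> j = - x" for x
    by (simp_all add: amult_assoc jj amult.minus_left) (simp add: amult_assoc[symmetric] jj amult.minus_right)
  define U where "U = {x. x + j \<in> GA}"
  define V where "V = {x :: 'n alg. x + aone \<in> GA}"
  \<comment> \<open>Writing \<open>j - x = 2 j - (x + j)\<close> turns the Cayley map into a formula
    with a single inverse. Solving \<open>(x + j) (y + 1) = 2 j\<close> for \<open>x\<close> gives
    \<open>h'\<close>.\<close>
  define h where "h x = 2 *\<^sub>R (aone \<star> ainv (x + j) \<star> j) - aone" for x
  define h' where "h' x = 2 *\<^sub>R (j \<star> ainv (x + aone) \<star> aone) - j" for x
  define L where "L = {x. x \<star> j = - (j \<star> x)}"
  have open_U: "open {x :: 'n alg. x + a \<in> GA}" for a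
  proof -
    have "{x :: 'n alg. x + a \<in> GA} = (\<lambda>x. x - a) ` GA" by force
    then show ?thesis using open_translation_subtract[OF open_GA] by simp
  qed
  have smooth: "smooth_on h U" "smooth_on h' V"
    unfolding h_def h'_def U_def V_def by (rule smooth_on_translated_ainv)+
  have h_inv: "h x \<in> V" "h' (h x) = x" if "x \<in> U" for x
  proof -
    let ?a = "x + j"
    have a: "?a \<in> GA" using that by (simp add: U_def)
    \<comment> \<open>\<open>h x + 1 = 2 (x + j)^-1 j\<close>, and \<open>-j\<close> is the inverse
      of \<open>j\<close>, which dictates this inverse.\<close>
    have "(h x + aone) \<star> ((-1/2) *\<^sub>R (j \<star> ?a)) = aone"
    proof -
      have "(h x + aone) \<star> ((-1/2) *\<^sub>R (j \<star> ?a)) = - (ainv ?a \<star> (j \<star> j) \<star> ?a)"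
        by (simp add: h_def amult.scaleR_left amult.scaleR_right amult.minus_right amult_assoc)
      then show ?thesis by (simp only: jj amult.minus_left amult.minus_right amult_one ainv_works(2)[OF a] minus_minus)
    qed
    note inv = ainv_unique[OF this]
    show "h x \<in> V" using inv(1) by (simp add: V_def)
    show "h' (h x) = x" unfolding h'_def inv(2) by (simp add: amult.scaleR_right amult.minus_right jjx)
  qed
  have h'_inv: "h' y \<in> U" "h (h' y) = y" if "y \<in> V" for y
  proof -
    let ?a = "y + aone"
    have a: "?a \<in> GA" using that by (simp add: V_def)
    have "(h' y + j) \<star> ((-1/2) *\<^sub>R (?a \<star> j)) = - (j \<star> (ainv ?a \<star> ?a) \<star> j)"
      by (simp add: h'_def amult.scaleR_left amult.scaleR_right amult.minus_right amult_assoc)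
    also have "\<dots> = aone" by (simp add: ainv_works(2)[OF a] jj)
    finally have "(h' y + j) \<star> ((-1/2) *\<^sub>R (?a \<star> j)) = aone" .
    note inv = ainv_unique[OF this]
    show "h' y \<in> U" using inv(1) by (simp add: U_def)
    show "h (h' y) = y" unfolding h_def inv(2) by (simp add: amult.scaleR_left amult.minus_left jjx)
  qed
  have hom: "homeomorphism U V h h'"
  proof (rule homeomorphismI)
    have "Ck_on 0 h U" "Ck_on 0 h' V" using smooth unfolding smooth_on_def by blast+
    then show "continuous_on U h" "continuous_on V h'" by simp_all
  qed (use h_inv h'_inv in auto)
  have "h x \<in> L" if x: "x \<in> sqrt_set" "x \<in> U" for x
  proof -
    let ?a = "x + j" and ?b = "ainv (x + j)"
    have a: "?a \<in> GA" using x(2) by (simp add: U_def)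
    have xx: "x \<star> x = - aone" using x(1) by (simp add: sqrt_set_def)
    \<comment> \<open>Both sides equal \<open>x j - 1\<close>, so \<open>x + j\<close> intertwines
      \<open>j\<close> and \<open>x\<close>. The resulting relation \<open>j b j = b + j\<close>,
      with \<open>b\<close> the inverse of \<open>x + j\<close>, says that \<open>h x\<close>
      anticommutes with \<open>j\<close>.\<close>
    have "?a \<star> j = x \<star> ?a" by (simp add: amult.add_left amult.add_right jj xx)
    then have "?a \<star> j \<star> ?b \<star> j = x \<star> (?a \<star> ?b) \<star> j" by (simp add: amult_assoc)
    also have "\<dots> = ?a \<star> (?b + j)" by (simp add: ainv_works[OF a] amult.add_right) (simp add: amult.add_left jj)
    finally have "?b \<star> (?a \<star> (j \<star> ?b \<star> j)) = ?b \<star> (?a \<star> (?b + j))" by (simp add: amult_assoc)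
    then have jbj: "j \<star> ?b \<star> j = ?b + j" by (simp add: amult_assoc ainv_works[OF a])
    show ?thesis
      unfolding L_def h_def mem_Collect_eq
      by (simp add: amult.diff_left amult.diff_right amult.scaleR_left amult.scaleR_right amult_assoc jbj jjx)
         (simp add: scaleR_add_right scaleR_2)
  qed
  moreover have "h' y \<in> sqrt_set" if y: "y \<in> V" "y \<in> L" for y
  proof -
    let ?c = "ainv (y + aone)"
    have c: "y + aone \<in> GA" using y(1) by (simp add: V_def)
    \<comment> \<open>Anticommutation in the form \<open>j (1 + y) = (1 - y) j\<close>. Multiplied
      on both sides by the inverse \<open>c\<close> of \<open>1 + y\<close>, it becomes
      \<open>c j = 2 c j c - j c\<close>, the relation that reduces the square of
      \<open>h' y\<close> to -1.\<close>
    have "j \<star> (y + aone) = (aone - y) \<star> j" using y(2) by (simp add: L_def amult.add_right amult.diff_left)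
    then have e: "j \<star> (y + aone) = (2 *\<^sub>R aone - (y + aone)) \<star> j" by (simp add: scaleR_2)
    have "?c \<star> j = ?c \<star> (j \<star> (y + aone) \<star> ?c)"
      by (simp add: amult_assoc[symmetric] ainv_works[OF c])
    also have "\<dots> = ?c \<star> ((2 *\<^sub>R aone - (y + aone)) \<star> j \<star> ?c)" by (simp only: e)
    also have "\<dots> = 2 *\<^sub>R (?c \<star> j \<star> ?c) - (?c \<star> (y + aone)) \<star> j \<star> ?c"
      by (simp only: amult.diff_left amult.diff_right amult.scaleR_left amult.scaleR_right amult_one amult_assoc)
    finally have "j \<star> (?c \<star> j) = j \<star> (2 *\<^sub>R (?c \<star> j \<star> ?c) - j \<star> ?c)" by (simp add: ainv_works[OF c])
    moreover have "j \<star> (2 *\<^sub>R (?c \<star> j \<star> ?c) - j \<star> ?c) = 2 *\<^sub>R (j \<star> ?c \<star> j \<star> ?c) + ?c"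
      by (simp add: amult.diff_right amult.scaleR_right amult_assoc jj amult.minus_left)
    ultimately have jcj: "j \<star> ?c \<star> j = 2 *\<^sub>R (j \<star> ?c \<star> j \<star> ?c) + ?c"
      by (simp only: amult_assoc)
    have "h' y \<star> h' y = 4 *\<^sub>R (j \<star> ?c \<star> j \<star> ?c) - 2 *\<^sub>R (j \<star> ?c \<star> j) + 2 *\<^sub>R ?c - aone"
      by (simp add: h'_def amult.diff_left amult.diff_right amult.scaleR_left amult.scaleR_right amult_assoc jj
          amult.minus_left amult.add_left scaleR_add_right)
    also have "\<dots> = - aone"
    proof -
      have "4 *\<^sub>R w - 2 *\<^sub>R v + 2 *\<^sub>R ?c - aone = - aone" if "v = 2 *\<^sub>R w + ?c" for v w
        by (simp add: that scaleR_add_right)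
      from this[OF jcj] show ?thesis .
    qed
    finally show ?thesis by (simp add: sqrt_set_def)
  qed
  ultimately have img: "h ` (sqrt_set \<inter> U) = V \<inter> L"
    using h_inv h'_inv by (auto simp: image_iff) (metis IntI)
  have "j \<in> U"
  proof -
    have "(j + j) \<star> ((-1/2) *\<^sub>R j) = (-1/2) *\<^sub>R (2 *\<^sub>R (j \<star> j))"
      by (simp add: amult.add_left amult.scaleR_right amult.minus_right scaleR_2)
    then have "(j + j) \<star> ((-1/2) *\<^sub>R j) = aone" by (simp add: jj)
    then have "j + j \<in> GA" by (rule ainv_unique(1))
    then show ?thesis by (simp add: U_def)
  qed
  show "\<exists>U V (h :: 'n alg \<Rightarrow> 'n alg) h' (L :: 'n alg set). open U \<and> j \<in> U \<and> open V \<and> homeomorphism U V h h' \<and> smooth_on h U \<and> smooth_on h' V \<and>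
      subspace L \<and> dim L = 4 * d\<^sup>2 \<and> h ` (sqrt_set \<inter> U) = V \<inter> L"
  proof (rule exI[of _ U], rule exI[of _ V], rule exI[of _ h], rule exI[of _ h'], rule exI[of _ L], intro conjI)
    show "open U" "open V" by (simp_all add: U_def V_def open_U)
    show "subspace L" "dim L = 4 * d\<^sup>2" using dim_anticommutant[OF card j] by (simp_all add: L_def)
  qed (fact \<open>j \<in> U\<close> hom smooth img)+
qed

subsection \<open>The linear forms Scal and Spec\<close>

lemma center_scalar:
  assumes "z \<in> center"
  shows "\<exists>a b. z = (a *\<^sub>R mat 1, b *\<^sub>R mat 1)"
proof -
  have c: "z \<star> x = x \<star> z" for x using assms unfolding center_def by blast
  have "\<exists>a. fst z = a *\<^sub>R mat 1"
  proof (rule central_matrix)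
    show "fst z ** B = B ** fst z" for B using c[of "(B, 0)"] by (simp add: amult_def)
  qed
  moreover have "\<exists>a. snd z = a *\<^sub>R mat 1"
  proof (rule central_matrix)
    show "snd z ** B = B ** snd z" for B using c[of "(0, B)"] by (simp add: amult_def)
  qed
  ultimately show ?thesis by (metis prod.collapse)
qed

lemma commutator_space_trace:
  fixes x :: "'n::finite alg"
  assumes "x \<in> commutator_space"
  shows "trace (fst x) = 0" "trace (snd x) = 0"
proof -
  have "subspace {x :: 'n alg. trace (fst x) = 0 \<and> trace (snd x) = 0}"
    by (auto simp: subspace_def trace_def sum.distrib sum_distrib_left[symmetric])
  moreover have "{x \<star> y - y \<star> x | x y. True} \<subseteq> {x :: 'n alg. trace (fst x) = 0 \<and> trace (snd x) = 0}"
  proof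
    fix w :: "'n alg" assume "w \<in> {x \<star> y - y \<star> x | x y. True}"
    then obtain x y where w: "w = x \<star> y - y \<star> x" by blast
    show "w \<in> {x. trace (fst x) = 0 \<and> trace (snd x) = 0}"
      using trace_mul_sym[of "fst x" "fst y"] trace_mul_sym[of "snd x" "snd y"]
      by (simp add: w amult_def trace_sub)
  qed
  ultimately have "commutator_space \<subseteq> {x :: 'n alg. trace (fst x) = 0 \<and> trace (snd x) = 0}"
    unfolding commutator_space_def by (rule span_minimal[rotated])
  then show "trace (fst x) = 0" "trace (snd x) = 0" using assms by auto
qed

lemma center_Int_commutator_space:
  fixes z :: "'n::finite alg"
  assumes "z \<in> center" "z \<in> commutator_space"
  shows "z = 0"
proof -
  obtain a b where z: "z = (a *\<^sub>R mat 1, b *\<^sub>R mat 1)" using center_scalar[OF assms(1)] by blast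
  have "trace (c *\<^sub>R (mat 1 :: real^'n^'n)) = c * CARD('n)" for c
    by (simp add: trace_def mat_def)
  then have "a = 0" "b = 0" using commutator_space_trace[OF assms(2)] by (simp_all add: z)
  then show ?thesis by (simp add: z zero_prod_def)
qed

text \<open>If \<open>t\<close> is invertible and anticommutes with \<open>x\<close>, then
  \<open>x\<close> is the commutator of \<open>(1/2) x t^-1\<close> and \<open>t\<close>, each of
  the two products contributing \<open>x / 2\<close>.\<close>

lemma sqrt_set_commutator:
  fixes x :: "'n::finite alg"
  assumes card: "CARD('n) = 2 * d" and x: "x \<in> sqrt_set"
  shows "x \<in> commutator_space"
proof -
  obtain t where t: "t \<in> GA" "t \<star> x = - (x \<star> t)" using exists_anticommuting_unit[OF card x] .
  let ?y = "(1/2) *\<^sub>R (x \<star> ainv t)"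
  have "?y \<star> t - t \<star> ?y = (1/2) *\<^sub>R (x \<star> (ainv t \<star> t)) - (1/2) *\<^sub>R (t \<star> x \<star> ainv t)"
    by (simp add: amult.scaleR_left amult.scaleR_right amult_assoc)
  also have "t \<star> x \<star> ainv t = - x"
    by (simp add: t(2) amult.minus_left amult_assoc[symmetric] ainv_works[OF t(1)])
  finally have "?y \<star> t - t \<star> ?y = x"
    by (simp add: ainv_works[OF t(1)] scaleR_add_left[symmetric])
  then show ?thesis unfolding commutator_space_def by (intro span_base) (metis (mono_tags, lifting) mem_Collect_eq)
qed

text \<open>The definite descriptions ask for uniqueness: the central part is unique because center
  and commutator space meet in zero, its coefficients because \<open>aone\<close> and
  \<open>omega\<close> are linearly independent.\<close>

lemma Scal_Spec_sqrt_set: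
  fixes x :: "'n::finite alg"
  assumes card: "CARD('n) = 2 * d" and x: "x \<in> sqrt_set"
  shows "Scal x = 0" "Spec x = 0"
proof -
  have sub: "subspace (commutator_space :: 'n alg set)" by (simp add: commutator_space_def)
  have xc: "x \<in> commutator_space" by (rule sqrt_set_commutator[OF assms])
  have proj: "center_proj x = 0"
    unfolding center_proj_def
  proof (rule the_equality)
    show "0 \<in> center \<and> x - 0 \<in> commutator_space"
      using xc by (simp add: center_def amult.zero_left amult.zero_right)
    fix z assume z: "z \<in> center \<and> x - z \<in> commutator_space"
    then have "x - (x - z) \<in> commutator_space" using subspace_diff[OF sub xc] by blast
    then show "z = 0" using z center_Int_commutator_space[of z] by simp
  qed
  have zero: "s = 0 \<and> t = 0" if "0 = s *\<^sub>R aone + t *\<^sub>R (omega :: 'n alg)" for s t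
  proof -
    obtain i :: 'n where True by simp
    have "(fst (s *\<^sub>R aone + t *\<^sub>R (omega :: 'n alg))) $ i $ i = 0" "(snd (s *\<^sub>R aone + t *\<^sub>R (omega :: 'n alg))) $ i $ i = 0"
      unfolding that[symmetric] by simp_all
    then have "s + t = 0" "s - t = 0" by (simp_all add: aone_def omega_def mat_def)
    then show ?thesis by simp
  qed
  show "Scal x = 0" unfolding Scal_def proj
  proof (rule the_equality)
    show "\<exists>t. (0 :: 'n alg) = 0 *\<^sub>R aone + t *\<^sub>R omega" by (rule exI[of _ 0]) simp
  qed (use zero in blast)
  show "Spec x = 0" unfolding Spec_def proj
  proof (rule the_equality)
    show "\<exists>s. (0 :: 'n alg) = s *\<^sub>R aone + 0 *\<^sub>R omega" by (rule exI[of _ 0]) simp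
  qed (use zero in blast)
qed

subsection \<open>The action on the components\<close>

abbreviation sqrt_piece :: "real^'n^'n \<Rightarrow> real \<Rightarrow> real \<Rightarrow> 'n::finite alg set" where
  "sqrt_piece J s t \<equiv> conj_orbit J s \<times> conj_orbit J t"

text \<open>The action on labels as a signed permutation: an optional exchange of the two signs,
  followed by multiplication by the signs of the determinants.\<close>

lemma alg_aut_sqrt_piece:
  assumes "det g \<noteq> 0" "det g' \<noteq> 0"
  shows "blinfun_apply (alg_aut g g' e) ` sqrt_piece J s t =
    (if e then sqrt_piece J (sgn (det g) * t) (sgn (det g') * s)
     else sqrt_piece J (sgn (det g) * s) (sgn (det g') * t))"
proof (cases e)
  case True
  have "blinfun_apply (alg_aut g g' e) ` sqrt_piece J s t =
      (\<lambda>X. g ** X ** matrix_inv g) ` conj_orbit J t \<times> (\<lambda>X. g' ** X ** matrix_inv g') ` conj_orbit J s"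
    using True by (force simp: alg_aut_apply image_iff)
  then show ?thesis using True assms by (simp add: conj_conj_orbit)
next
  case False
  have "blinfun_apply (alg_aut g g' e) ` sqrt_piece J s t =
      (\<lambda>X. g ** X ** matrix_inv g) ` conj_orbit J s \<times> (\<lambda>X. g' ** X ** matrix_inv g') ` conj_orbit J t"
    using False by (force simp: alg_aut_apply image_iff)
  then show ?thesis using False assms by (simp add: conj_conj_orbit)
qed

lemma swap_conj_eq: "swap_conj g g' = blinfun_apply (alg_aut g g' True)"
  by (rule ext) (auto simp: swap_conj_def alg_aut_apply split: prod.splits)

text \<open>The exchange flag is well defined because pieces with different labels are disjoint; the
  outer automorphisms are thus exactly the normal forms with exchange.\<close>

lemma outer_automorphisms:
  assumes card: "CARD('n::finite) = 2 * d"
  shows "blinfun_apply ` ((Aut :: ('n alg \<Rightarrow>\<^sub>L 'n alg) set) - Inn) = {swap_conj g g' | g g'. (g, g') \<in> GA}"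
proof -
  have "alg_aut g g' True \<noteq> alg_aut h h' False"
    if "det g \<noteq> 0" "det g' \<noteq> 0" "det h \<noteq> 0" "det h' \<noteq> 0" for g g' h h' :: "real^'n^'n"
  proof
    assume eq: "alg_aut g g' True = alg_aut h h' False"
    have "(sgn (det g), sgn (det g'), True) = (sgn (det h), sgn (det h'), False)"
      by (rule aut_piece_disjoint[OF card alg_aut_mem_piece[OF that(1,2)]])
         (use alg_aut_mem_piece[OF that(3,4), of False] that in \<open>auto simp: eq sgn_if\<close>)
    then show False by simp
  qed
  then have "(Aut :: ('n alg \<Rightarrow>\<^sub>L 'n alg) set) - Inn = {alg_aut g g' True | g g'. det g \<noteq> 0 \<and> det g' \<noteq> 0}"
    unfolding Aut_eq Inn_eq by (safe; (metis (full_types))?)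
  then show ?thesis by (auto simp: swap_conj_eq GA_iff image_iff)
qed

lemma sqrt_set_conj_class:
  assumes card: "CARD('n::finite) = 2 * d"
  shows "\<exists>x. (sqrt_set :: 'n alg set) = conj_class x"
proof -
  obtain J :: "real^'n^'n" where J: "J ** J = - mat 1" using exists_sqrt_minus_one[OF card] by blast
  have "sqrt_set \<subseteq> conj_class (J, J)"
  proof
    fix x :: "'n alg" assume "x \<in> sqrt_set"
    then have x: "fst x ** fst x = - mat 1" "snd x ** snd x = - mat 1" by (auto simp: sqrt_set_eq)
    obtain g g' where g: "det g \<noteq> 0" "fst x = g ** J ** matrix_inv g" "det g' \<noteq> 0" "snd x = g' ** J ** matrix_inv g'"
      using sqrt_minus_one_similar[OF J x(1) card] sqrt_minus_one_similar[OF J x(2) card] by blast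
    then have "alg_aut g g' False \<in> Inn" "x = alg_aut g g' False (J, J)"
      by (auto simp: Inn_eq alg_aut_apply prod_eq_iff)
    then show "x \<in> conj_class (J, J)" unfolding conj_class_def by blast
  qed
  moreover have "conj_class (J, J) \<subseteq> sqrt_set"
  proof
    fix x assume "x \<in> conj_class (J, J)"
    then obtain g g' where g: "det g \<noteq> 0" "det g' \<noteq> 0" "x = alg_aut g g' False (J, J)"
      by (auto simp: conj_class_def Inn_eq)
    have "g ** J ** matrix_inv g \<in> {K. K ** K = - mat 1}" if "det g \<noteq> 0" for g
      unfolding sqrt_minus_one_eq_orbits[OF J card]
      using that by (cases "det g > 0") (auto simp: conj_orbit_def not_less le_less)
    then show "x \<in> sqrt_set" using g by (simp add: sqrt_set_eq alg_aut_apply)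
  qed
  ultimately show ?thesis by blast
qed

lemma component_perm_permutes:
  fixes \<phi> :: "'n::finite alg \<Rightarrow>\<^sub>L 'n alg"
  assumes card: "CARD('n) \<ge> 2" "CARD('n) = 2 * d" and \<phi>: "\<phi> \<in> Aut"
  shows "component_perm (blinfun_apply \<phi>) permutes components sqrt_set"
proof -
  obtain J :: "real^'n^'n" where J: "J ** J = - mat 1" using exists_sqrt_minus_one[OF card(2)] by blast
  let ?S = "components (sqrt_set :: 'n alg set)"
  have S: "?S = (\<lambda>(s, t). sqrt_piece J s t) ` sign_pairs" by (rule components_sqrt_set(1)[OF J card])
  obtain g g' e where g: "\<phi> = alg_aut g g' e" "det g \<noteq> 0" "det g' \<noteq> 0" using \<phi> by (auto simp: Aut_eq)
  obtain h h' where h: "det h \<noteq> 0" "det h' \<noteq> 0"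
    "alg_aut g g' e o\<^sub>L alg_aut h h' e = id_blinfun" "alg_aut h h' e o\<^sub>L alg_aut g g' e = id_blinfun"
    using alg_aut_inverse[OF g(2,3)] by metis
  \<comment> \<open>Stated for arbitrary conjugators, so that it applies both to
    \<open>\<phi>\<close> and to its inverse, which carries the same flag \<open>e\<close>.\<close>
  have closed: "blinfun_apply (alg_aut k k' e) ` C \<in> ?S" if nz: "det k \<noteq> 0" "det k' \<noteq> 0" and C: "C \<in> ?S"
    for k k' :: "real^'n^'n" and C
  proof -
    obtain s t where st: "C = sqrt_piece J s t" "s \<in> {1, -1}" "t \<in> {1, -1}" using C unfolding S by auto
    have sgns: "sgn (det k) \<in> {1, -1}" "sgn (det k') \<in> {1, -1}" using nz by (auto simp: sgn_if)
    have mul: "a * b \<in> {1, -1}" if "a \<in> {1, -1}" "b \<in> {1, -1}" for a b :: real using that by auto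
    have mem: "sqrt_piece J a b \<in> ?S" if "a \<in> {1, -1}" "b \<in> {1, -1}" for a b
      unfolding S by (rule image_eqI[of _ _ "(a, b)"]) (use that in auto)
    have "sqrt_piece J (sgn (det k) * t) (sgn (det k') * s) \<in> ?S" "sqrt_piece J (sgn (det k) * s) (sgn (det k') * t) \<in> ?S"
      by (intro mem mul sgns st(2,3))+
    then show ?thesis unfolding st(1) alg_aut_sqrt_piece[OF nz] by simp
  qed
  have inv: "alg_aut g g' e (alg_aut h h' e x) = x" "alg_aut h h' e (alg_aut g g' e x) = x" for x
    using arg_cong[OF h(3), of "\<lambda>\<psi>. blinfun_apply \<psi> x"] arg_cong[OF h(4), of "\<lambda>\<psi>. blinfun_apply \<psi> x"] by simp_all
  have "bij_betw (component_perm (blinfun_apply \<phi>)) ?S ?S"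
  proof (rule bij_betw_byWitness[where f' = "\<lambda>C. blinfun_apply (alg_aut h h' e) ` C"])
    show "\<forall>C\<in>?S. alg_aut h h' e ` component_perm \<phi> C = C"
      by (simp add: component_perm_def g(1) image_image inv)
    show "\<forall>C\<in>?S. component_perm \<phi> (alg_aut h h' e ` C) = C"
      using closed[OF h(1,2)] by (simp add: component_perm_def g(1) image_image inv)
    show "component_perm \<phi> ` ?S \<subseteq> ?S"
      using closed[OF g(2,3)] by (auto simp: component_perm_def g(1))
    show "(`) (alg_aut h h' e) ` ?S \<subseteq> ?S" using closed[OF h(1,2)] by auto
  qed
  then show ?thesis by (rule bij_imp_permutes) (simp add: component_perm_def)
qed

text \<open>A product of two disjoint transpositions of four points is determined by the partner of
  \<open>w\<close>. The symmetries of the notation bring \<open>w\<close> to the first place,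
  leaving three choices.\<close>

lemma klein_perms_four:
  assumes d: "distinct [w, x, y, z]"
  shows "klein_perms {w, x, y, z} = {id, Transposition.transpose w x \<circ> Transposition.transpose y z,
    Transposition.transpose w y \<circ> Transposition.transpose x z, Transposition.transpose w z \<circ> Transposition.transpose x y}"
    (is "_ = ?R")
proof
  define D where "D a b c e = Transposition.transpose a b \<circ> Transposition.transpose c e" for a b c e :: 'a
  have sym1: "D a b c e = D b a c e" and sym2: "D a b c e = D a b e c" for a b c e
    by (simp_all add: D_def Transposition.transpose_commute)
  have sym3: "D a b c e = D c e a b" if "distinct [a, b, c, e]" for a b c e
    using that by (auto simp: D_def fun_eq_iff Transposition.transpose_def)
  have R: "?R = {id, D w x y z, D w y x z, D w z x y}" by (simp add: D_def)
  have first: "D w b c e \<in> ?R" if bce: "distinct [w, b, c, e]" "{b, c, e} \<subseteq> {w, x, y, z}" for b c e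
  proof -
    have "b \<in> {x, y, z}" "c \<in> {x, y, z}" "e \<in> {x, y, z}" using bce by auto
    then consider "b = x" "c = y" "e = z" | "b = x" "c = z" "e = y" | "b = y" "c = x" "e = z"
      | "b = y" "c = z" "e = x" | "b = z" "c = x" "e = y" | "b = z" "c = y" "e = x"
      using bce(1) by auto
    then show ?thesis unfolding R
      by cases (simp_all add: sym2[of w x z y] sym2[of w y z x] sym2[of w z y x])
  qed
  show "klein_perms {w, x, y, z} \<subseteq> ?R"
  proof
    fix p assume "p \<in> klein_perms {w, x, y, z}"
    then consider "p = id" | a b c e where "p = D a b c e" "distinct [a, b, c, e]" "{a, b, c, e} \<subseteq> {w, x, y, z}"
      unfolding klein_perms_def D_def by blast
    then show "p \<in> ?R"
    proof cases
      case 2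
      have "w \<in> {a, b, c, e}"
      proof (rule ccontr)
        assume "w \<notin> {a, b, c, e}"
        then have "{a, b, c, e} \<subseteq> {x, y, z}" using 2(3) by auto
        then have "card {a, b, c, e} \<le> card {x, y, z}" by (intro card_mono) auto
        moreover have "card {a, b, c, e} = 4" using 2(2) by simp
        moreover have "card {x, y, z} \<le> 3" using card_length[of "[x, y, z]"] by simp
        ultimately show False by simp
      qed
      then consider "w = a" | "w = b" | "w = c" | "w = e" by blast
      then show ?thesis
      proof cases
        case 1
        then show ?thesis using first[of b c e] 2 by simp
      next
        case b: 2
        then show ?thesis using first[of a c e] 2(2,3) by (auto simp: 2(1) sym1[of a b])
      next
        case 3
        have "p = D c e a b" using 2 sym3 by simp
        then show ?thesis using 3 first[of e a b] 2(2,3) by auto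
      next
        case 4
        have "p = D e c a b" using 2 sym3 sym1 by metis
        then show ?thesis using 4 first[of c a b] 2(2,3) by auto
      qed
    qed simp
  qed
  show "?R \<subseteq> klein_perms {w, x, y, z}"
  proof -
    have "D a b c e \<in> klein_perms {w, x, y, z}" if "distinct [a, b, c, e]" "{a, b, c, e} \<subseteq> {w, x, y, z}" for a b c e
      unfolding klein_perms_def D_def using that by blast
    from this[of w x y z] this[of w y x z] this[of w z x y]
    have "D w x y z \<in> klein_perms {w, x, y, z}" "D w y x z \<in> klein_perms {w, x, y, z}" "D w z x y \<in> klein_perms {w, x, y, z}"
      using d by auto
    moreover have "id \<in> klein_perms {w, x, y, z}" by (simp add: klein_perms_def)
    ultimately show ?thesis unfolding R by blast
  qed
qed

lemma sqrt_pieces_distinct: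
  fixes J :: "real^'n^'n"
  assumes "J ** J = - mat 1" "CARD('n) \<ge> 2" "CARD('n) = 2 * d"
  shows "components sqrt_set = {sqrt_piece J 1 1, sqrt_piece J 1 (-1), sqrt_piece J (-1) 1, sqrt_piece J (-1) (-1)}"
    and "distinct [sqrt_piece J 1 1, sqrt_piece J 1 (-1), sqrt_piece J (-1) 1, sqrt_piece J (-1) (-1)]"
proof -
  have eq: "sign_pairs = {(1, 1), (1, -1), (-1, 1), (-1, -1)}" by auto
  show "components sqrt_set = {sqrt_piece J 1 1, sqrt_piece J 1 (-1), sqrt_piece J (-1) 1, sqrt_piece J (-1) (-1)}"
    unfolding components_sqrt_set(1)[OF assms] eq by simp
  show "distinct [sqrt_piece J 1 1, sqrt_piece J 1 (-1), sqrt_piece J (-1) 1, sqrt_piece J (-1) (-1)]"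
  proof -
    have "distinct (map (\<lambda>(s, t). sqrt_piece J s t) [(1, 1), (1, -1), (-1, 1), (-1, -1)])"
      unfolding distinct_map using components_sqrt_set(2)[OF assms] by (simp add: eq)
    then show ?thesis by (simp only: list.map case_prod_conv)
  qed
qed

lemma inner_component_perms:
  assumes card: "CARD('n::finite) \<ge> 2" "CARD('n) = 2 * d"
  shows "{component_perm (blinfun_apply \<phi>) | \<phi>. \<phi> \<in> (Inn :: ('n alg \<Rightarrow>\<^sub>L 'n alg) set)} = klein_perms (components sqrt_set)"
proof -
  obtain J :: "real^'n^'n" where J: "J ** J = - mat 1" using exists_sqrt_minus_one[OF card(2)] by blast
  note S = sqrt_pieces_distinct[OF J card]
  define w x y z where "w = sqrt_piece J 1 1" and "x = sqrt_piece J 1 (-1)"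
    and "y = sqrt_piece J (-1) 1" and "z = sqrt_piece J (-1) (-1)"
  note wxyz = w_def[symmetric] x_def[symmetric] y_def[symmetric] z_def[symmetric]
  have dist: "distinct [w, x, y, z]" and comps: "components sqrt_set = {w, x, y, z}"
    using S unfolding wxyz by blast+
  \<comment> \<open>Multiplication of the labels by \<open>(s, t)\<close>: a change of the second
    sign exchanges \<open>w\<close> with \<open>x\<close> and \<open>y\<close> with
    \<open>z\<close>, a change of the first \<open>w\<close> with \<open>y\<close> and
    \<open>x\<close> with \<open>z\<close>.\<close>
  define T where "T s t = (if s = 1 then (if t = 1 then id else Transposition.transpose w x \<circ> Transposition.transpose y z)
      else (if t = (1::real) then Transposition.transpose w y \<circ> Transposition.transpose x z
        else Transposition.transpose w z \<circ> Transposition.transpose x y))" for s t :: real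
  have perm: "component_perm (blinfun_apply (alg_aut g g' False)) = T (sgn (det g)) (sgn (det g'))"
    if nz: "det g \<noteq> 0" "det g' \<noteq> 0" for g g' :: "real^'n^'n"
  proof
    fix C
    note act = alg_aut_sqrt_piece[OF nz, of False J]
    have act': "alg_aut g g' False ` w = sqrt_piece J (sgn (det g)) (sgn (det g'))"
      "alg_aut g g' False ` x = sqrt_piece J (sgn (det g)) (- sgn (det g'))"
      "alg_aut g g' False ` y = sqrt_piece J (- sgn (det g)) (sgn (det g'))"
      "alg_aut g g' False ` z = sqrt_piece J (- sgn (det g)) (- sgn (det g'))"
      unfolding w_def x_def y_def z_def act by simp_all
    have ne: "w \<noteq> x" "w \<noteq> y" "w \<noteq> z" "x \<noteq> w" "x \<noteq> y" "x \<noteq> z" "y \<noteq> w" "y \<noteq> x" "y \<noteq> z" "z \<noteq> w" "z \<noteq> x" "z \<noteq> y"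
      using dist by auto
    have sgn_cases: "sgn a = 1 \<or> sgn a = -1" if "a \<noteq> 0" for a :: real using that by (simp add: sgn_if)
    have cases: "C = w \<or> C = x \<or> C = y \<or> C = z \<or> C \<notin> {w, x, y, z}" by blast
    consider "sgn (det g) = 1" "sgn (det g') = 1" | "sgn (det g) = 1" "sgn (det g') = -1"
      | "sgn (det g) = -1" "sgn (det g') = 1" | "sgn (det g) = -1" "sgn (det g') = -1"
      using sgn_cases[OF nz(1)] sgn_cases[OF nz(2)] by blast
    then show "component_perm (blinfun_apply (alg_aut g g' False)) C = T (sgn (det g)) (sgn (det g')) C"
      using cases
      by cases (elim disjE; simp add: component_perm_def comps act' wxyz T_def ne Transposition.transpose_def)+
  qed
  have ex: "\<exists>g :: real^'n^'n. det g \<noteq> 0 \<and> sgn (det g) = s" if "s = 1 \<or> s = -1" for s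
  proof -
    obtain g :: "real^'n^'n" where "det g < 0" using connected_GL_sign(3)[OF card(1)] by blast
    then show ?thesis using that by (auto intro: exI[of _ g] exI[of _ "mat 1"])
  qed
  have "{component_perm (blinfun_apply \<phi>) | \<phi>. \<phi> \<in> (Inn :: ('n alg \<Rightarrow>\<^sub>L 'n alg) set)} = {T 1 1, T 1 (-1), T (-1) 1, T (-1) (-1)}"
  proof
    show "{component_perm (blinfun_apply \<phi>) | \<phi>. \<phi> \<in> (Inn :: ('n alg \<Rightarrow>\<^sub>L 'n alg) set)} \<subseteq> {T 1 1, T 1 (-1), T (-1) 1, T (-1) (-1)}"
    proof
      fix p assume "p \<in> {component_perm (blinfun_apply \<phi>) | \<phi>. \<phi> \<in> (Inn :: ('n alg \<Rightarrow>\<^sub>L 'n alg) set)}"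
      then obtain g g' :: "real^'n^'n" where g: "det g \<noteq> 0" "det g' \<noteq> 0" "p = component_perm (blinfun_apply (alg_aut g g' False))"
        unfolding Inn_eq by blast
      have "sgn (det g) = 1 \<or> sgn (det g) = -1" "sgn (det g') = 1 \<or> sgn (det g') = -1" using g by (auto simp: sgn_if)
      then show "p \<in> {T 1 1, T 1 (-1), T (-1) 1, T (-1) (-1)}" unfolding g(3) perm[OF g(1,2)] by auto
    qed
    have "T s t \<in> {component_perm (blinfun_apply \<phi>) | \<phi>. \<phi> \<in> (Inn :: ('n alg \<Rightarrow>\<^sub>L 'n alg) set)}"
      if st: "s = 1 \<or> s = -1" "t = 1 \<or> t = -1" for s t
    proof -
      obtain g g' :: "real^'n^'n" where g: "det g \<noteq> 0" "sgn (det g) = s" "det g' \<noteq> 0" "sgn (det g') = t"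
        using ex[OF st(1)] ex[OF st(2)] by blast
      have "T s t = component_perm (blinfun_apply (alg_aut g g' False))" using perm[OF g(1,3)] g by simp
      then show ?thesis using g(1,3) unfolding Inn_eq by blast
    qed
    then show "{T 1 1, T 1 (-1), T (-1) 1, T (-1) (-1)} \<subseteq> {component_perm (blinfun_apply \<phi>) | \<phi>. \<phi> \<in> (Inn :: ('n alg \<Rightarrow>\<^sub>L 'n alg) set)}"
      by (metis (no_types, lifting) empty_subsetI insert_subset)
  qed
  then show ?thesis unfolding comps klein_perms_four[OF dist] by (simp add: T_def)
qed

lemma swap_conj_component_perm:
  fixes J :: "real^'n^'n"
  assumes "J ** J = - mat 1" "CARD('n) \<ge> 2" "CARD('n) = 2 * d" "det g \<noteq> 0" "det g' \<noteq> 0"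
    and "s \<in> {1, -1}" "t \<in> {1, -1}"
  shows "component_perm (swap_conj g g') (sqrt_piece J s t) = sqrt_piece J (sgn (det g) * t) (sgn (det g') * s)"
proof -
  have "sqrt_piece J s t \<in> components sqrt_set"
    unfolding components_sqrt_set(1)[OF assms(1-3)] using assms(6,7) by (force simp: image_iff)
  then show ?thesis by (simp add: component_perm_def swap_conj_eq alg_aut_sqrt_piece assms(4,5))
qed

text \<open>The action on labels is \<open>(s, t) \<mapsto> (p t, q s)\<close>, with
  \<open>p\<close>, \<open>q\<close> the signs of the determinants. Its square multiplies both
  labels by \<open>p q = -1\<close> and so has no fixed point.\<close>

lemma swap_conj_four_cycle:
  fixes g g' :: "real^'n^'n"
  assumes card: "CARD('n) \<ge> 2" "CARD('n) = 2 * d" and g: "det g * det g' < 0"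
  shows "\<exists>C1 C2 C3 C4. distinct [C1, C2, C3, C4] \<and> components sqrt_set = {C1, C2, C3, C4} \<and>
           component_perm (swap_conj g g') C1 = C2 \<and> component_perm (swap_conj g g') C2 = C3 \<and>
           component_perm (swap_conj g g') C3 = C4 \<and> component_perm (swap_conj g g') C4 = C1"
proof -
  obtain J :: "real^'n^'n" where J: "J ** J = - mat 1" using exists_sqrt_minus_one[OF card(2)] by blast
  note S = sqrt_pieces_distinct[OF J card]
  have nz: "det g \<noteq> 0" "det g' \<noteq> 0" using g by auto
  note act = swap_conj_component_perm[OF J card nz]
  define w x y z where "w = sqrt_piece J 1 1" and "x = sqrt_piece J 1 (-1)"
    and "y = sqrt_piece J (-1) 1" and "z = sqrt_piece J (-1) (-1)"
  note wxyz = w_def[symmetric] x_def[symmetric] y_def[symmetric] z_def[symmetric]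
  have dist: "distinct [w, x, y, z]" and comps: "components sqrt_set = {w, x, y, z}"
    using S unfolding wxyz by blast+
  have act': "component_perm (swap_conj g g') w = sqrt_piece J (sgn (det g)) (sgn (det g'))"
    "component_perm (swap_conj g g') x = sqrt_piece J (- sgn (det g)) (sgn (det g'))"
    "component_perm (swap_conj g g') y = sqrt_piece J (sgn (det g)) (- sgn (det g'))"
    "component_perm (swap_conj g g') z = sqrt_piece J (- sgn (det g)) (- sgn (det g'))"
    using act[of 1 1] act[of 1 "-1"] act[of "-1" 1] act[of "-1" "-1"]
    unfolding w_def x_def y_def z_def by simp_all
  consider "sgn (det g) = 1" "sgn (det g') = -1" | "sgn (det g) = -1" "sgn (det g') = 1"
    using g by (auto simp: mult_less_0_iff)
  then show ?thesis
  proof cases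
    case 1
    have "component_perm (swap_conj g g') w = x" "component_perm (swap_conj g g') x = z"
      "component_perm (swap_conj g g') z = y" "component_perm (swap_conj g g') y = w"
      unfolding act' 1 by (simp_all add: wxyz)
    moreover have "distinct [w, x, z, y]" using dist by auto
    moreover have "components sqrt_set = {w, x, z, y}" unfolding comps by auto
    ultimately show ?thesis by blast
  next
    case 2
    have "component_perm (swap_conj g g') w = y" "component_perm (swap_conj g g') y = z"
      "component_perm (swap_conj g g') z = x" "component_perm (swap_conj g g') x = w"
      unfolding act' 2 by (simp_all add: wxyz)
    moreover have "distinct [w, y, z, x]" using dist by auto
    moreover have "components sqrt_set = {w, y, z, x}" unfolding comps by auto
    ultimately show ?thesis by blast
  qed
qed

text \<open>Here \<open>p = q\<close> in \<open>(s, t) \<mapsto> (p t, q s)\<close>: the two labels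
  with \<open>s = p t\<close> are fixed, and the other two are exchanged.\<close>

lemma swap_conj_two_fixed:
  fixes g g' :: "real^'n^'n"
  assumes card: "CARD('n) \<ge> 2" "CARD('n) = 2 * d" and g: "det g * det g' > 0"
  shows "\<exists>C1 C2 C3 C4. distinct [C1, C2, C3, C4] \<and> components sqrt_set = {C1, C2, C3, C4} \<and>
           component_perm (swap_conj g g') C1 = C1 \<and> component_perm (swap_conj g g') C2 = C2 \<and>
           component_perm (swap_conj g g') C3 = C4 \<and> component_perm (swap_conj g g') C4 = C3"
proof -
  obtain J :: "real^'n^'n" where J: "J ** J = - mat 1" using exists_sqrt_minus_one[OF card(2)] by blast
  note S = sqrt_pieces_distinct[OF J card]
  have nz: "det g \<noteq> 0" "det g' \<noteq> 0" using g by auto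
  note act = swap_conj_component_perm[OF J card nz]
  define w x y z where "w = sqrt_piece J 1 1" and "x = sqrt_piece J 1 (-1)"
    and "y = sqrt_piece J (-1) 1" and "z = sqrt_piece J (-1) (-1)"
  note wxyz = w_def[symmetric] x_def[symmetric] y_def[symmetric] z_def[symmetric]
  have dist: "distinct [w, x, y, z]" and comps: "components sqrt_set = {w, x, y, z}"
    using S unfolding wxyz by blast+
  have act': "component_perm (swap_conj g g') w = sqrt_piece J (sgn (det g)) (sgn (det g'))"
    "component_perm (swap_conj g g') x = sqrt_piece J (- sgn (det g)) (sgn (det g'))"
    "component_perm (swap_conj g g') y = sqrt_piece J (sgn (det g)) (- sgn (det g'))"
    "component_perm (swap_conj g g') z = sqrt_piece J (- sgn (det g)) (- sgn (det g'))"
    using act[of 1 1] act[of 1 "-1"] act[of "-1" 1] act[of "-1" "-1"]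
    unfolding w_def x_def y_def z_def by simp_all
  consider "sgn (det g) = 1" "sgn (det g') = 1" | "sgn (det g) = -1" "sgn (det g') = -1"
    using g by (auto simp: zero_less_mult_iff)
  then show ?thesis
  proof cases
    case 1
    have "component_perm (swap_conj g g') w = w" "component_perm (swap_conj g g') z = z"
      "component_perm (swap_conj g g') x = y" "component_perm (swap_conj g g') y = x"
      unfolding act' 1 by (simp_all add: wxyz)
    moreover have "distinct [w, z, x, y]" using dist by auto
    moreover have "components sqrt_set = {w, z, x, y}" unfolding comps by auto
    ultimately show ?thesis by blast
  next
    case 2
    have "component_perm (swap_conj g g') x = x" "component_perm (swap_conj g g') y = y"
      "component_perm (swap_conj g g') w = z" "component_perm (swap_conj g g') z = w"
      unfolding act' 2 by (simp_all add: wxyz)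
    moreover have "distinct [x, y, w, z]" using dist by auto
    moreover have "components sqrt_set = {x, y, w, z}" unfolding comps by auto
    ultimately show ?thesis by blast
  qed
qed

subsection \<open>Isometries of a square\<close>

lemma group_isometry_group: "group (isometry_group Q)"
proof (rule groupI)
  fix f g assume fg: "f \<in> carrier (isometry_group Q)" "g \<in> carrier (isometry_group Q)"
  then have "f ` Q = Q" "g ` Q = Q" by (simp_all add: isometry_group_def)
  then have "(\<lambda>x. f (g x)) ` Q = Q" by (metis image_image)
  with fg show "f \<otimes>\<^bsub>isometry_group Q\<^esub> g \<in> carrier (isometry_group Q)"
    by (simp add: isometry_group_def bij_comp)
next
  fix f assume f: "f \<in> carrier (isometry_group Q)"
  then have bij: "bij f" and dist: "\<And>x y. dist (f x) (f y) = dist x y" and im: "f ` Q = Q"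
    by (auto simp: isometry_group_def)
  have "dist (inv_into UNIV f x) (inv_into UNIV f y) = dist x y" for x y
    using dist[of "inv_into UNIV f x" "inv_into UNIV f y"] bij by (simp add: bij_is_surj surj_f_inv_f)
  moreover have "inv_into UNIV f ` Q = Q" using im bij by (metis bij_is_inj image_inv_f_f)
  ultimately have "inv_into UNIV f \<in> carrier (isometry_group Q)"
    using bij by (simp add: isometry_group_def bij_imp_bij_inv)
  moreover have "inv_into UNIV f \<otimes>\<^bsub>isometry_group Q\<^esub> f = \<one>\<^bsub>isometry_group Q\<^esub>"
    using bij by (simp add: isometry_group_def bij_is_inj)
  ultimately show "\<exists>g\<in>carrier (isometry_group Q). g \<otimes>\<^bsub>isometry_group Q\<^esub> f = \<one>\<^bsub>isometry_group Q\<^esub>" by blast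
qed (auto simp: isometry_group_def)

text \<open>The l1 distance is at most 2 and its square is the squared Euclidean distance plus twice
  a product. Euclidean distance 2 forces that product to vanish, so only opposite vertices qualify;
  an isometry of the square must permute these pairs.\<close>

lemma diamond_diameter:
  fixes a b a' b' :: real
  assumes "\<bar>a\<bar> + \<bar>b\<bar> \<le> 1" "\<bar>a'\<bar> + \<bar>b'\<bar> \<le> 1" "(a - a')\<^sup>2 + (b - b')\<^sup>2 = 4"
  shows "(b = 0 \<and> b' = 0 \<and> a' = - a \<and> (a = 1 \<or> a = -1)) \<or> (a = 0 \<and> a' = 0 \<and> b' = - b \<and> (b = 1 \<or> b = -1))"
proof -
  have "\<bar>a - a'\<bar> + \<bar>b - b'\<bar> \<le> 2" using assms(1,2) by linarith
  then have "(\<bar>a - a'\<bar> + \<bar>b - b'\<bar>)\<^sup>2 \<le> 2\<^sup>2" by (intro power_mono) auto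
  then have "(a - a')\<^sup>2 + (b - b')\<^sup>2 + 2 * \<bar>a - a'\<bar> * \<bar>b - b'\<bar> \<le> 4" by (simp add: power2_sum)
  then have le: "\<bar>a - a'\<bar> * \<bar>b - b'\<bar> \<le> 0" using assms(3) by simp
  have "\<bar>a - a'\<bar> * \<bar>b - b'\<bar> \<ge> 0" by simp
  with le have "\<bar>a - a'\<bar> * \<bar>b - b'\<bar> = 0" by linarith
  then have "a = a' \<or> b = b'" by simp
  then show ?thesis
  proof
    assume "a = a'"
    then have "(b - b')\<^sup>2 = 2\<^sup>2" using assms(3) by simp
    then have "b - b' = 2 \<or> b - b' = -2" by (simp only: power2_eq_iff)
    then show ?thesis using assms(1,2) \<open>a = a'\<close> by auto
  next
    assume "b = b'"
    then have "(a - a')\<^sup>2 = 2\<^sup>2" using assms(3) by simp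
    then have "a - a' = 2 \<or> a - a' = -2" by (simp only: power2_eq_iff)
    then show ?thesis using assms(1,2) \<open>b = b'\<close> by auto
  qed
qed

text \<open>\<open>u\<close> and \<open>v\<close> are the half-diagonals. In coordinates along them
  the square is the unit ball of the l1 norm, and its symmetries are signed permutations of the
  coordinates.\<close>

locale square_frame =
  fixes c u v :: "real^2"
  assumes u_nz: "u \<noteq> 0" and norm_uv: "norm u = norm v" and ortho: "inner u v = 0"
begin

definition pt :: "real \<Rightarrow> real \<Rightarrow> real^2" where
  "pt a b = c + a *\<^sub>R u + b *\<^sub>R v"

definition px :: "real^2 \<Rightarrow> real" where
  "px x = inner (x - c) u / inner u u"

definition py :: "real^2 \<Rightarrow> real" where
  "py x = inner (x - c) v / inner u u"

definition square :: "(real^2) set" where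
  "square = convex hull {c + u, c + v, c - u, c - v}"

lemma uu_pos: "inner u u > 0"
  using u_nz by simp

lemma vv: "inner v v = inner u u"
  using norm_uv by (simp add: power2_norm_eq_inner[symmetric])

lemma px_pt [simp]: "px (pt a b) = a" and py_pt [simp]: "py (pt a b) = b"
  using u_nz by (simp_all add: px_def py_def pt_def inner_add_left vv ortho inner_commute[of v u])

lemma pt_px_py [simp]: "pt (px x) (py x) = x"
proof -
  have "u \<noteq> v" using ortho u_nz by auto
  have "v \<noteq> 0" using norm_uv u_nz by auto
  then have "independent {u, v}"
    using u_nz ortho by (intro pairwise_orthogonal_independent) (auto simp: pairwise_def orthogonal_def inner_commute)
  then have "dim {u, v} = 2" using \<open>u \<noteq> v\<close> by (simp add: dim_eq_card_independent)
  then have span: "span {u, v} = UNIV" by (simp add: dim_eq_full[symmetric])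
  define y where "y = x - pt (px x) (py x)"
  have "inner y u = 0" "inner y v = 0"
    using u_nz by (simp_all add: y_def pt_def px_def py_def inner_diff_left inner_add_left vv ortho inner_commute[of v u])
  then have "orthogonal y y"
    by (intro orthogonal_to_span[of y "{u, v}" y]) (auto simp: span orthogonal_def)
  then show ?thesis by (simp add: y_def orthogonal_def)
qed

lemma pt_eq_iff [simp]: "pt a b = pt a' b' \<longleftrightarrow> a = a' \<and> b = b'"
  by (metis px_pt py_pt)

lemma dist_pt: "(dist (pt a b) (pt a' b'))\<^sup>2 = inner u u * ((a - a')\<^sup>2 + (b - b')\<^sup>2)"
proof -
  have eq: "pt a b - pt a' b' = (a - a') *\<^sub>R u + (b - b') *\<^sub>R v" by (simp add: pt_def algebra_simps)
  show ?thesis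
    unfolding dist_norm eq power2_norm_eq_inner
    by (simp add: inner_add_left inner_add_right vv ortho inner_commute[of v u]
        power2_eq_square algebra_simps)
qed

lemma dist_pt_eq_iff:
  "dist (pt a b) (pt a' b') = dist (pt p q) (pt p' q') \<longleftrightarrow> (a - a')\<^sup>2 + (b - b')\<^sup>2 = (p - p')\<^sup>2 + (q - q')\<^sup>2"
proof -
  have "dist (pt a b) (pt a' b') = dist (pt p q) (pt p' q') \<longleftrightarrow>
      (dist (pt a b) (pt a' b'))\<^sup>2 = (dist (pt p q) (pt p' q'))\<^sup>2"
    by (simp add: power2_eq_iff_nonneg)
  then show ?thesis unfolding dist_pt using uu_pos by simp
qed

lemma pt_mem_square: "pt a b \<in> square \<longleftrightarrow> \<bar>a\<bar> + \<bar>b\<bar> \<le> 1"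
proof
  define D where "D = {x. \<bar>px x\<bar> + \<bar>py x\<bar> \<le> 1}"
  have "convex D"
  proof (rule convexI)
    fix x y and s t :: real assume xy: "x \<in> D" "y \<in> D" and st: "0 \<le> s" "0 \<le> t" "s + t = 1"
    have "s *\<^sub>R x + t *\<^sub>R y - c = s *\<^sub>R (x - c) + t *\<^sub>R (y - c)"
    proof -
      have s: "s = 1 - t" using st(3) by simp
      show ?thesis unfolding s by (simp add: algebra_simps)
    qed
    then have p: "px (s *\<^sub>R x + t *\<^sub>R y) = s * px x + t * px y" "py (s *\<^sub>R x + t *\<^sub>R y) = s * py x + t * py y"
      by (simp_all add: px_def py_def inner_add_left add_divide_distrib)
    have "\<bar>s * px x + t * px y\<bar> + \<bar>s * py x + t * py y\<bar> \<le> (s * \<bar>px x\<bar> + t * \<bar>px y\<bar>) + (s * \<bar>py x\<bar> + t * \<bar>py y\<bar>)"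
      using st abs_triangle_ineq[of "s * px x" "t * px y"] abs_triangle_ineq[of "s * py x" "t * py y"]
      by (simp add: abs_mult)
    also have "\<dots> = s * (\<bar>px x\<bar> + \<bar>py x\<bar>) + t * (\<bar>px y\<bar> + \<bar>py y\<bar>)" by (simp add: algebra_simps)
    also have "\<dots> \<le> s * 1 + t * 1"
      using xy st by (intro add_mono mult_left_mono) (auto simp: D_def)
    finally show "s *\<^sub>R x + t *\<^sub>R y \<in> D" using st by (simp add: D_def p)
  qed
  moreover have "c + u = pt 1 0" "c + v = pt 0 1" "c - u = pt (-1) 0" "c - v = pt 0 (-1)"
    by (simp_all add: pt_def)
  then have "{c + u, c + v, c - u, c - v} \<subseteq> D" by (simp add: D_def)
  ultimately have "square \<subseteq> D" unfolding square_def by (rule hull_minimal[rotated])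
  then show "\<bar>a\<bar> + \<bar>b\<bar> \<le> 1" if "pt a b \<in> square" using that by (auto simp: D_def)
next
  assume ab: "\<bar>a\<bar> + \<bar>b\<bar> \<le> 1"
  \<comment> \<open>The positive and negative parts of \<open>a\<close> and \<open>b\<close> serve
    as weights of the vertices. The leftover weight is shared equally by \<open>c + u\<close> and
    \<open>c - u\<close>, where it does not move the point.\<close>
  define r where "r = (1 - \<bar>a\<bar> - \<bar>b\<bar>) / 2"
  define k where "k i = [(\<bar>a\<bar> + a) / 2 + r, (\<bar>b\<bar> + b) / 2, (\<bar>a\<bar> - a) / 2 + r, (\<bar>b\<bar> - b) / 2] ! i" for i
  define w where "w i = [c + u, c + v, c - u, c - v] ! i" for i
  have set4: "{0, 1, 2, 3} = {..<4::nat}" by auto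
  have all4: "(\<forall>i\<in>{..<4::nat}. P i) \<longleftrightarrow> P 0 \<and> P 1 \<and> P 2 \<and> P 3" for P
    unfolding set4[symmetric] by simp
  have "(\<Sum>i<4. k i *\<^sub>R w i) \<in> square"
  proof (rule convex_sum)
    show "convex square" by (simp add: square_def)
    show "(\<Sum>i<4. k i) = 1"
      by (simp add: k_def r_def eval_nat_numeral) (simp add: field_simps)
    have "\<forall>i\<in>{..<4}. 0 \<le> k i" unfolding all4 using ab by (simp add: k_def r_def eval_nat_numeral abs_real_def)
    then show "0 \<le> k i" if "i \<in> {..<4}" for i using that by blast
    have "\<forall>i\<in>{..<4}. w i \<in> square" unfolding all4 w_def square_def
      by (simp add: eval_nat_numeral hull_inc)
    then show "w i \<in> square" if "i \<in> {..<4}" for i using that by blast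
  qed simp
  also have "(\<Sum>i<4. k i *\<^sub>R w i) = pt a b"
  proof -
    have "(\<Sum>i<4. k i *\<^sub>R w i) = (k 0 + k 1 + k 2 + k 3) *\<^sub>R c + (k 0 - k 2) *\<^sub>R u + (k 1 - k 3) *\<^sub>R v"
      by (simp add: w_def eval_nat_numeral algebra_simps)
    also have "k 0 + k 1 + k 2 + k 3 = 1" by (simp add: k_def r_def eval_nat_numeral) (simp add: field_simps)
    also have "k 0 - k 2 = a" by (simp add: k_def eval_nat_numeral field_simps)
    also have "k 1 - k 3 = b" by (simp add: k_def eval_nat_numeral field_simps)
    finally show ?thesis by (simp add: pt_def)
  qed
  finally show "pt a b \<in> square" .
qed

text \<open>Parametrised like \<open>alg_aut\<close>, with signs in place of conjugators, so that
  the two composition rules correspond.\<close>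

definition sq_iso :: "real \<Rightarrow> real \<Rightarrow> bool \<Rightarrow> real^2 \<Rightarrow> real^2" where
  "sq_iso s t e x = (if e then pt (s * py x) (t * px x) else pt (s * px x) (t * py x))"

lemma sq_iso_compose:
  "sq_iso s t e \<circ> sq_iso s' t' e' = (if e then sq_iso (s * t') (t * s') (\<not> e') else sq_iso (s * s') (t * t') e')"
  by (auto simp: sq_iso_def fun_eq_iff)

lemma sq_iso_id: "sq_iso 1 1 False = id"
  by (auto simp: sq_iso_def fun_eq_iff)

lemma sq_iso_carrier:
  assumes st: "s \<in> {1, -1}" "t \<in> {1, -1}"
  shows "sq_iso s t e \<in> carrier (isometry_group square)"
proof -
  define f where "f = sq_iso s t e"
  define f' where "f' = (if e then sq_iso t s e else sq_iso s t e)"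
  have inv: "f \<circ> f' = id" "f' \<circ> f = id"
    using st by (auto simp: f_def f'_def sq_iso_compose sq_iso_id)
  have mem: "sq_iso a b e x \<in> square \<longleftrightarrow> x \<in> square" if "a \<in> {1, -1}" "b \<in> {1, -1}" for a b x
    using that pt_mem_square[of "px x" "py x"] by (auto simp: sq_iso_def pt_mem_square)
  have "dist (f x) (f y) = dist x y" for x y
  proof -
    have "dist (f x) (f y) = dist (pt (px x) (py x)) (pt (px y) (py y))"
      unfolding f_def sq_iso_def using st
      by (cases e) (auto simp only: if_True if_False dist_pt_eq_iff, auto simp: power2_eq_square algebra_simps)
    then show ?thesis by simp
  qed
  moreover have "f ` square = square"
  proof
    show "f ` square \<subseteq> square" using mem[OF st] by (auto simp: f_def)
    show "square \<subseteq> f ` square"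
    proof
      fix x assume "x \<in> square"
      then have "f' x \<in> square" using mem st by (auto simp: f'_def)
      moreover have "f (f' x) = x" using inv(1) by (metis comp_apply id_apply)
      ultimately show "x \<in> f ` square" by (metis imageI)
    qed
  qed
  ultimately show ?thesis
    using o_bij[OF inv(2,1)] by (simp add: isometry_group_def f_def)
qed

text \<open>An isometry preserving the square permutes the pairs of points at maximal distance, that is
  the two pairs of opposite vertices; it fixes their midpoint, and it is determined by the images
  of the centre and of two adjacent vertices.\<close>

lemma isometry_square_cases:
  assumes f: "f \<in> carrier (isometry_group square)"
  shows "\<exists>s\<in>{1, -1}. \<exists>t\<in>{1, -1}. \<exists>e. f = sq_iso s t e"
proof -
  have dist: "dist (f x) (f y) = dist x y" and im: "f ` square = square" for x y
    using f by (auto simp: isometry_group_def)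
  define X Y where "X a b = px (f (pt a b))" and "Y a b = py (f (pt a b))" for a b
  have f_pt: "f (pt a b) = pt (X a b) (Y a b)" for a b by (simp add: X_def Y_def)
  have d: "(X a b - X a' b')\<^sup>2 + (Y a b - Y a' b')\<^sup>2 = (a - a')\<^sup>2 + (b - b')\<^sup>2" for a b a' b'
    using dist[of "pt a b" "pt a' b'"] unfolding f_pt dist_pt_eq_iff .
  have sq: "\<bar>X a b\<bar> + \<bar>Y a b\<bar> \<le> 1" if "\<bar>a\<bar> + \<bar>b\<bar> \<le> 1" for a b
  proof -
    have "f (pt a b) \<in> square" using that im pt_mem_square by blast
    then show ?thesis by (simp add: f_pt pt_mem_square)
  qed
  have u: "(Y 1 0 = 0 \<and> Y (-1) 0 = 0 \<and> X (-1) 0 = - X 1 0 \<and> (X 1 0 = 1 \<or> X 1 0 = -1)) \<or>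
      (X 1 0 = 0 \<and> X (-1) 0 = 0 \<and> Y (-1) 0 = - Y 1 0 \<and> (Y 1 0 = 1 \<or> Y 1 0 = -1))"
    using d[of 1 0 "-1" 0] by (intro diamond_diameter sq) auto
  have v: "(Y 0 1 = 0 \<and> Y 0 (-1) = 0 \<and> X 0 (-1) = - X 0 1 \<and> (X 0 1 = 1 \<or> X 0 1 = -1)) \<or>
      (X 0 1 = 0 \<and> X 0 (-1) = 0 \<and> Y 0 (-1) = - Y 0 1 \<and> (Y 0 1 = 1 \<or> Y 0 1 = -1))"
    using d[of 0 1 0 "-1"] by (intro diamond_diameter sq) auto
  have uv: "(X 1 0 - X 0 1)\<^sup>2 + (Y 1 0 - Y 0 1)\<^sup>2 = 2" using d[of 1 0 0 1] by simp
  \<comment> \<open>The image of the centre is at distance one from two opposite vertices. When the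
    two equations are added, the mixed terms cancel and the squared norm of the coordinates is
    zero.\<close>
  have zero: "X 0 0 = 0 \<and> Y 0 0 = 0"
  proof -
    have 1: "(X 0 0 - X 1 0)\<^sup>2 + (Y 0 0 - Y 1 0)\<^sup>2 = 1" "(X 0 0 - X (-1) 0)\<^sup>2 + (Y 0 0 - Y (-1) 0)\<^sup>2 = 1"
      using d[of 0 0 1 0] d[of 0 0 "-1" 0] by simp_all
    have "(X 0 0)\<^sup>2 + (Y 0 0)\<^sup>2 = 0"
      using u 1 by (auto simp: power2_eq_square algebra_simps)
    then show ?thesis by (simp add: sum_power2_eq_zero_iff)
  qed
  \<comment> \<open>Polarisation: the distances to the centre and to a vertex determine the inner
    product with that vertex.\<close>
  have coords: "X a b * X 1 0 + Y a b * Y 1 0 = a" "X a b * X 0 1 + Y a b * Y 0 1 = b" for a b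
  proof -
    have 0: "(X a b)\<^sup>2 + (Y a b)\<^sup>2 = a\<^sup>2 + b\<^sup>2" using d[of a b 0 0] zero by simp
    have one: "(X 1 0)\<^sup>2 + (Y 1 0)\<^sup>2 = 1" "(X 0 1)\<^sup>2 + (Y 0 1)\<^sup>2 = 1" using u v by auto
    have 1: "(X a b - X 1 0)\<^sup>2 + (Y a b - Y 1 0)\<^sup>2 = (a - 1)\<^sup>2 + b\<^sup>2" using d[of a b 1 0] by simp
    have 2: "(X a b - X 0 1)\<^sup>2 + (Y a b - Y 0 1)\<^sup>2 = a\<^sup>2 + (b - 1)\<^sup>2" using d[of a b 0 1] by simp
    show "X a b * X 1 0 + Y a b * Y 1 0 = a" using 0 1 one(1) by (simp add: power2_diff)
    show "X a b * X 0 1 + Y a b * Y 0 1 = b" using 0 2 one(2) by (simp add: power2_diff)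
  qed
  \<comment> \<open>Images of adjacent vertices cannot lie on the same axis: their squared distance
    would be 0 or 4 instead of 2.\<close>
  consider (straight) s t where "s \<in> {1, -1}" "t \<in> {1, -1}" "X 1 0 = s" "Y 1 0 = 0" "X 0 1 = 0" "Y 0 1 = t"
    | (flip) s t where "s \<in> {1, -1}" "t \<in> {1, -1}" "X 1 0 = 0" "Y 1 0 = t" "X 0 1 = s" "Y 0 1 = 0"
    using u v uv by fastforce
  then show ?thesis
  proof cases
    case straight
    have "X a b = s * a" "Y a b = t * b" for a b
      using coords[of a b] straight by auto
    then have "f (pt (px x) (py x)) = sq_iso s t False x" for x unfolding f_pt by (simp add: sq_iso_def)
    then have "f = sq_iso s t False" by (simp add: fun_eq_iff)
    then show ?thesis using straight(1,2) by blast
  next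
    case flip
    have "X a b = s * b" "Y a b = t * a" for a b
      using coords[of a b] flip by auto
    then have "f (pt (px x) (py x)) = sq_iso s t True x" for x unfolding f_pt by (simp add: sq_iso_def)
    then have "f = sq_iso s t True" by (simp add: fun_eq_iff)
    then show ?thesis using flip(1,2) by blast
  qed
qed

lemma sq_iso_eq_id:
  assumes "sq_iso s t e = id"
  shows "s = 1 \<and> t = 1 \<and> \<not> e"
proof -
  have "sq_iso s t e (pt 1 0) = pt 1 0" "sq_iso s t e (pt 0 1) = pt 0 1" using assms by simp_all
  then show ?thesis by (cases e) (auto simp: sq_iso_def)
qed

end

subsection \<open>The quotient of the automorphism group\<close>

lemma group_Aut_group: "group (Aut_group :: ('n::finite alg \<Rightarrow>\<^sub>L 'n alg) monoid)"
proof (rule groupI)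
  fix \<phi> \<psi> :: "'n alg \<Rightarrow>\<^sub>L 'n alg" assume "\<phi> \<in> carrier Aut_group" "\<psi> \<in> carrier Aut_group"
  then have 1: "\<phi> \<in> Aut" "\<psi> \<in> Aut" by (simp_all add: Aut_group_def)
  have "blinfun_apply (\<phi> o\<^sub>L \<psi>) = blinfun_apply \<phi> \<circ> blinfun_apply \<psi>" by (simp add: fun_eq_iff)
  then have "\<phi> o\<^sub>L \<psi> \<in> Aut" using 1 by (simp add: Aut_def bij_comp del: split_paired_All)
  then show "\<phi> \<otimes>\<^bsub>Aut_group\<^esub> \<psi> \<in> carrier Aut_group" by (simp add: Aut_group_def)
next
  show "\<one>\<^bsub>Aut_group\<^esub> \<in> carrier (Aut_group :: ('n alg \<Rightarrow>\<^sub>L 'n alg) monoid)"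
    using alg_aut_in_Aut[of "mat 1" "mat 1" False] by (simp add: Aut_group_def alg_aut_id)
next
  fix \<phi> :: "'n alg \<Rightarrow>\<^sub>L 'n alg" assume "\<phi> \<in> carrier Aut_group"
  then obtain g g' e where g: "\<phi> = alg_aut g g' e" "det g \<noteq> 0" "det g' \<noteq> 0"
    by (auto simp: Aut_group_def Aut_eq)
  obtain h h' where "det h \<noteq> 0" "det h' \<noteq> 0" "alg_aut h h' e o\<^sub>L alg_aut g g' e = id_blinfun"
    using alg_aut_inverse[OF g(2,3)] by metis
  then show "\<exists>\<psi>\<in>carrier Aut_group. \<psi> \<otimes>\<^bsub>Aut_group\<^esub> \<phi> = \<one>\<^bsub>Aut_group\<^esub>"
    using alg_aut_in_Aut[of h h' e] by (auto simp: Aut_group_def g(1))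
qed (auto simp: Aut_group_def intro!: blinfun_eqI)

text \<open>Described through the pieces because the conjugators are not unique; disjointness of the
  pieces makes the label unique.\<close>

definition aut_label :: "('n::finite alg \<Rightarrow>\<^sub>L 'n alg) \<Rightarrow> real \<times> real \<times> bool" where
  "aut_label \<phi> = (THE l. l \<in> aut_labels \<and> \<phi> \<in> (case l of (s, t, e) \<Rightarrow> aut_piece s t e))"

lemma sgn_det_label:
  fixes g g' :: "real^'n^'n"
  assumes "det g \<noteq> 0" "det g' \<noteq> 0"
  shows "(sgn (det g), sgn (det g'), e) \<in> aut_labels"
  using assms by (auto simp: sgn_if)

lemma aut_label_eq:
  fixes g g' :: "real^'n^'n"
  assumes card: "CARD('n) = 2 * d" and nz: "det g \<noteq> 0" "det g' \<noteq> 0"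
  shows "aut_label (alg_aut g g' e) = (sgn (det g), sgn (det g'), e)"
  unfolding aut_label_def
proof (rule the_equality)
  show "(sgn (det g), sgn (det g'), e) \<in> aut_labels \<and>
      alg_aut g g' e \<in> (case (sgn (det g), sgn (det g'), e) of (s, t, e) \<Rightarrow> aut_piece s t e)"
    using sgn_det_label[OF nz] alg_aut_mem_piece[OF nz] by simp
  fix l assume l: "l \<in> aut_labels \<and> alg_aut g g' e \<in> (case l of (s, t, e) \<Rightarrow> aut_piece s t e)"
  obtain s t e' where l_eq: "l = (s, t, e')" by (cases l)
  show "l = (sgn (det g), sgn (det g'), e)"
    unfolding l_eq
    by (rule aut_piece_disjoint[OF card _ alg_aut_mem_piece[OF nz] _ sgn_det_label[OF nz]])
       (use l in \<open>simp_all add: l_eq\<close>)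
qed

lemma neutral_component_eq:
  assumes card: "CARD('n::finite) \<ge> 2" "CARD('n) = 2 * d"
  shows "(neutral_component :: ('n alg \<Rightarrow>\<^sub>L 'n alg) set) = aut_piece 1 1 False"
proof -
  have "aut_piece 1 1 False \<in> components (Aut :: ('n alg \<Rightarrow>\<^sub>L 'n alg) set)"
    unfolding components_Aut(1)[OF card] by (rule image_eqI[of _ _ "(1, 1, False)"]) auto
  then obtain \<psi> :: "'n alg \<Rightarrow>\<^sub>L 'n alg" where \<psi>: "aut_piece 1 1 False = connected_component_set Aut \<psi>"
    by (auto simp: components_iff)
  have "id_blinfun \<in> (aut_piece 1 1 False :: ('n alg \<Rightarrow>\<^sub>L 'n alg) set)"
    using alg_aut_mem_piece[of "mat 1 :: real^'n^'n" "mat 1 :: real^'n^'n" False] by (simp add: alg_aut_id)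
  then show ?thesis unfolding \<psi> neutral_component_def by (rule connected_component_eq)
qed

context square_frame
begin

definition aut_iso :: "('n::finite alg \<Rightarrow>\<^sub>L 'n alg) \<Rightarrow> real^2 \<Rightarrow> real^2" where
  "aut_iso \<phi> = (case aut_label \<phi> of (s, t, e) \<Rightarrow> sq_iso s t e)"

text \<open>The sign of the determinant is multiplicative and the composition rules of
  \<open>alg_aut\<close> and \<open>sq_iso\<close> agree. The kernel is the piece with label
  \<open>(1, 1, False)\<close>, so the first isomorphism theorem yields the quotient.\<close>

lemma aut_iso_epi:
  assumes card: "CARD('n::finite) \<ge> 2" "CARD('n) = 2 * d"
  shows "group_hom (Aut_group :: ('n alg \<Rightarrow>\<^sub>L 'n alg) monoid) (isometry_group square) aut_iso"
    and "(aut_iso :: ('n alg \<Rightarrow>\<^sub>L 'n alg) \<Rightarrow> _) ` carrier Aut_group = carrier (isometry_group square)"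
    and "kernel (Aut_group :: ('n alg \<Rightarrow>\<^sub>L 'n alg) monoid) (isometry_group square) aut_iso = neutral_component"
proof -
  let ?A = "Aut_group :: ('n alg \<Rightarrow>\<^sub>L 'n alg) monoid"
  have iso: "aut_iso (alg_aut g g' e) = sq_iso (sgn (det g)) (sgn (det g')) e"
    if "det g \<noteq> 0" "det g' \<noteq> 0" for g g' :: "real^'n^'n" and e
    using aut_label_eq[OF card(2) that] by (simp add: aut_iso_def)
  have carrier: "aut_iso \<phi> \<in> carrier (isometry_group square)" if \<phi>: "\<phi> \<in> carrier ?A" for \<phi>
  proof -
    obtain g g' e where g: "\<phi> = alg_aut g g' e" "det g \<noteq> 0" "det g' \<noteq> 0"
      using \<phi> by (auto simp: Aut_group_def Aut_eq)
    have "sgn (det g) \<in> {1, -1}" "sgn (det g') \<in> {1, -1}" using g(2,3) by (auto simp: sgn_if)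
    then show ?thesis unfolding g(1) iso[OF g(2,3)] by (rule sq_iso_carrier)
  qed
  have "aut_iso \<in> hom ?A (isometry_group square)"
  proof (rule homI)
    fix \<phi> \<psi> assume "\<phi> \<in> carrier ?A" "\<psi> \<in> carrier ?A"
    then obtain g g' e h h' e' where g: "\<phi> = alg_aut g g' e" "det g \<noteq> 0" "det g' \<noteq> 0"
      and h: "\<psi> = alg_aut h h' e'" "det h \<noteq> 0" "det h' \<noteq> 0"
      unfolding Aut_group_def Aut_eq by auto
    have nz: "det (a ** b) \<noteq> 0" if "det a \<noteq> 0" "det b \<noteq> 0" for a b :: "real^'n^'n" using that by (simp add: det_mul)
    have "aut_iso (\<phi> o\<^sub>L \<psi>) = aut_iso \<phi> \<circ> aut_iso \<psi>"
      unfolding g(1) h(1) alg_aut_compose[OF g(2,3) h(2,3)]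
      by (simp add: iso nz g h sq_iso_compose det_mul sgn_mult)
    then show "aut_iso (\<phi> \<otimes>\<^bsub>?A\<^esub> \<psi>) = aut_iso \<phi> \<otimes>\<^bsub>isometry_group square\<^esub> aut_iso \<psi>"
      by (simp add: Aut_group_def isometry_group_def)
  qed (rule carrier)
  then show "group_hom ?A (isometry_group square) aut_iso"
    by (simp add: group_hom_def group_hom_axioms_def group_Aut_group group_isometry_group)
  have ex: "\<exists>g :: real^'n^'n. det g \<noteq> 0 \<and> sgn (det g) = s" if "s \<in> {1, -1}" for s
  proof -
    obtain g :: "real^'n^'n" where "det g < 0" using connected_GL_sign(3)[OF card(1)] by blast
    then show ?thesis using that by (auto intro: exI[of _ g] exI[of _ "mat 1"])
  qed
  show "(aut_iso :: ('n alg \<Rightarrow>\<^sub>L 'n alg) \<Rightarrow> _) ` carrier Aut_group = carrier (isometry_group square)"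
  proof
    show "carrier (isometry_group square) \<subseteq> aut_iso ` carrier ?A"
    proof
      fix f assume "f \<in> carrier (isometry_group square)"
      then obtain s t e where f: "s \<in> {1, -1}" "t \<in> {1, -1}" "f = sq_iso s t e"
        using isometry_square_cases by blast
      obtain g g' :: "real^'n^'n" where g: "det g \<noteq> 0" "sgn (det g) = s" "det g' \<noteq> 0" "sgn (det g') = t"
        using ex[OF f(1)] ex[OF f(2)] by blast
      have "f = aut_iso (alg_aut g g' e)" using iso[OF g(1,3)] g f(3) by simp
      then show "f \<in> aut_iso ` carrier ?A"
        using alg_aut_in_Aut[OF g(1,3)] by (simp add: Aut_group_def)
    qed
  qed (use carrier in blast)
  show "kernel ?A (isometry_group square) aut_iso = neutral_component"
  proof
    show "kernel ?A (isometry_group square) aut_iso \<subseteq> neutral_component"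
    proof
      fix \<phi> assume "\<phi> \<in> kernel ?A (isometry_group square) aut_iso"
      then have "\<phi> \<in> Aut" and id: "aut_iso \<phi> = id" by (auto simp: kernel_def Aut_group_def isometry_group_def)
      then obtain g g' e where g: "\<phi> = alg_aut g g' e" "det g \<noteq> 0" "det g' \<noteq> 0" by (auto simp: Aut_eq)
      have "sgn (det g) = 1 \<and> sgn (det g') = 1 \<and> \<not> e"
        using id sq_iso_eq_id unfolding g(1) iso[OF g(2,3)] by blast
      then show "\<phi> \<in> neutral_component"
        using alg_aut_mem_piece[OF g(2,3), of e] by (simp add: neutral_component_eq[OF card] g(1))
    qed
    show "neutral_component \<subseteq> kernel ?A (isometry_group square) aut_iso"
    proof
      fix \<phi> :: "'n alg \<Rightarrow>\<^sub>L 'n alg" assume "\<phi> \<in> neutral_component"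
      then obtain g g' where g: "\<phi> = alg_aut g g' False" "det g > 0" "det g' > 0"
        by (auto simp: neutral_component_eq[OF card] aut_piece_def)
      have "aut_iso \<phi> = id" unfolding g(1) using iso[of g g' False] g(2,3) by (simp add: sq_iso_id)
      moreover have "\<phi> \<in> Aut" unfolding g(1) using g(2,3) by (intro alg_aut_in_Aut) auto
      ultimately show "\<phi> \<in> kernel ?A (isometry_group square) aut_iso"
        by (simp add: kernel_def Aut_group_def isometry_group_def)
    qed
  qed
qed

end

lemma neutral_component_normal:
  assumes card: "CARD('n::finite) \<ge> 2" "CARD('n) = 2 * d"
  shows "(neutral_component :: ('n alg \<Rightarrow>\<^sub>L 'n alg) set) \<lhd> Aut_group"
proof -
  \<comment> \<open>Normality is obtained from a kernel, for which some concrete square must be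
    supplied.\<close>
  interpret square_frame 0 "axis 1 1" "axis 2 1"
    by unfold_locales (simp_all add: inner_axis_axis axis_eq_0_iff)
  show ?thesis
    using group_hom.normal_kernel[OF aut_iso_epi(1)[OF card]] unfolding aut_iso_epi(3)[OF card] .
qed

lemma Aut_Mod_neutral_component:
  assumes card: "CARD('n::finite) \<ge> 2" "CARD('n) = 2 * d" and Q: "is_square Q"
  shows "(Aut_group :: ('n alg \<Rightarrow>\<^sub>L 'n alg) monoid) Mod neutral_component \<cong> isometry_group Q"
proof -
  obtain c u v where "u \<noteq> 0" "norm u = norm v" "inner u v = 0" and Q_eq: "Q = convex hull {c + u, c + v, c - u, c - v}"
    using Q by (auto simp: is_square_def)
  then interpret square_frame c u v by unfold_locales
  have "Q = square" by (simp add: Q_eq square_def)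
  then show ?thesis
    using group_hom.FactGroup_iso[OF aut_iso_epi(1,2)[OF card]] unfolding aut_iso_epi(3)[OF card] by simp
qed

theorem mainTheorem2:
  fixes d :: nat
  assumes "d \<ge> 1" and "CARD('n::finite) = 2 * d"
  shows
    "(\<exists>x. (sqrt_set :: 'n alg set) = conj_class x) \<and>
     (submanifold (4 * d\<^sup>2) (sqrt_set :: 'n alg set)) \<and>
     (2 * (4 * d\<^sup>2) = DIM('n alg)) \<and>
     (card (components (sqrt_set :: 'n alg set)) = 4) \<and>
     (card (components (GA :: 'n alg set)) = 4) \<and>
     (\<forall>x \<in> (sqrt_set :: 'n alg set). Scal x = 0 \<and> Spec x = 0) \<and>
     (card (components (Aut :: ('n alg \<Rightarrow>\<^sub>L 'n alg) set)) = 8) \<and>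
     (\<forall>\<phi> \<in> (Aut :: ('n alg \<Rightarrow>\<^sub>L 'n alg) set).
        component_perm (blinfun_apply \<phi>) permutes components sqrt_set) \<and>
     ({component_perm (blinfun_apply \<phi>) | \<phi>. \<phi> \<in> (Inn :: ('n alg \<Rightarrow>\<^sub>L 'n alg) set)}
        = klein_perms (components sqrt_set)) \<and>
     (blinfun_apply ` ((Aut :: ('n alg \<Rightarrow>\<^sub>L 'n alg) set) - Inn)
        = {swap_conj g g' | g g'. (g, g') \<in> GA}) \<and>
     (\<forall>g g'. ((g, g') :: 'n alg) \<in> GA \<and> det g * det g' < 0 \<longrightarrow>
        (\<exists>C1 C2 C3 C4. distinct [C1, C2, C3, C4] \<and> components sqrt_set = {C1, C2, C3, C4} \<and>
           component_perm (swap_conj g g') C1 = C2 \<and> component_perm (swap_conj g g') C2 = C3 \<and>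
           component_perm (swap_conj g g') C3 = C4 \<and> component_perm (swap_conj g g') C4 = C1)) \<and>
     (\<forall>g g'. ((g, g') :: 'n alg) \<in> GA \<and> det g * det g' > 0 \<longrightarrow>
        (\<exists>C1 C2 C3 C4. distinct [C1, C2, C3, C4] \<and> components sqrt_set = {C1, C2, C3, C4} \<and>
           component_perm (swap_conj g g') C1 = C1 \<and> component_perm (swap_conj g g') C2 = C2 \<and>
           component_perm (swap_conj g g') C3 = C4 \<and> component_perm (swap_conj g g') C4 = C3)) \<and>
     ((neutral_component :: ('n alg \<Rightarrow>\<^sub>L 'n alg) set) \<lhd> Aut_group) \<and>
     (\<forall>Q. is_square Q \<longrightarrow>
        (Aut_group :: ('n alg \<Rightarrow>\<^sub>L 'n alg) monoid) Mod neutral_component \<cong> isometry_group Q)"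
proof -
  \<comment> \<open>The lower bound gives the connected unit sphere on which the connectedness of
    the sign classes rests.\<close>
  have card: "CARD('n) \<ge> 2" "CARD('n) = 2 * d" using assms by auto
  have card_sqrt: "card (components (sqrt_set :: 'n alg set)) = 4"
  proof -
    obtain J :: "real^'n^'n" where J: "J ** J = - mat 1" using exists_sqrt_minus_one[OF card(2)] by blast
    show ?thesis unfolding components_sqrt_set(1)[OF J card] card_image[OF components_sqrt_set(2)[OF J card]]
      by (simp add: card_cartesian_product)
  qed
  have card_GA: "card (components (GA :: 'n alg set)) = 4"
    unfolding components_GA(1)[OF card(1)] card_image[OF components_GA(2)[OF card(1)]]
    by (simp add: card_cartesian_product)
  have card_Aut: "card (components (Aut :: ('n alg \<Rightarrow>\<^sub>L 'n alg) set)) = 8"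
    unfolding components_Aut(1)[OF card] card_image[OF components_Aut(2)[OF card]]
    by (simp add: card_cartesian_product)
  have dims: "2 * (4 * d\<^sup>2) = DIM('n alg)"
    by (simp add: card(2) power2_eq_square)
  show ?thesis
    by (intro conjI, rule sqrt_set_conj_class[OF card(2)], rule submanifold_sqrt_set[OF card(2)],
        rule dims, rule card_sqrt, rule card_GA, blast intro: Scal_Spec_sqrt_set[OF card(2)], rule card_Aut,
        intro ballI, rule component_perm_permutes[OF card], assumption,
        rule inner_component_perms[OF card], rule outer_automorphisms[OF card(2)],
        intro allI impI, elim conjE, rule swap_conj_four_cycle[OF card], assumption,
        intro allI impI, elim conjE, rule swap_conj_two_fixed[OF card], assumption,
        rule neutral_component_normal[OF card],
        intro allI impI, rule Aut_Mod_neutral_component[OF card], assumption)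
qed

end
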